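(* Consider the doubly intractable setting described in the context, let $K\colon(\mathcal{Z}\times\mathcal{X})\times\mathcal{B}(\mathcal{X})\to[0,1]$ be a transition kernel such that the family $(K_z)_{z\in\mathcal{Z}}$, $K_z(x,A)=K(z,x,A)$, is simultaneous Wasserstein contractive (w.r.t. the target distributions $(\pi_z)_{z\in\mathcal{Z}}$), and assume that the bounding functions $\ell,u$ exist with $R^{(\ell,u)}<\infty$. Let $\alpha\ge0$ and let $(X_n,Z_n)_{n\in\mathbb{N}_0}$ be the process generated by the AIR (adaptive increasingly rare) algorithm for doubly intractable problems with $N(t_j)=\lceil j^{1+\alpha}\rceil$ for $j\in\mathbb{N}$ and $N(0)=0$. Assume that $(X_n,Z_n)_{n\in\mathbb{N}_0}$ is metric regular and that $\mathrm{cost}(\widehat{\pi}_n)\asymp n^{\frac{3+\alpha}{2}}$. For $\varepsilon\in(0,1)$ let \[ \mathrm{cost}_\varepsilon:=\inf\left\{\mathrm{cost}(\widehat{\pi}_n)\;\Big|\;\sup_{\|h\|_\rho\le1}\mathbb{E}\left|\widehat{\pi}_n(h)-\pi_{z^*}(h)\right|^2\le\varepsilon,\ n\in\mathbb{N}\right\}. \] Then, for $\varepsilon\in(0,1)$: - if $\alpha\in[0,1)$, then $\mathrm{cost}_\varepsilon\preceq\varepsilon^{-\frac{3+\alpha}{1+\alpha}}$; - if $\alpha=1$, then $\mathrm{cost}_\varepsilon\preceq\left(\frac{\log(\varepsilon^{-1})}{\varepsilon}\right)^2$; - if $\alpha\in(1,\infty)$, then $\mathrm{cost}_\varepsilon\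preceq\varepsilon^{-\frac{3+\alpha}{2}}$.
   Context: Doubly intractable setting. $(\mathcal{D},\mathcal{F}_{\mathcal{D}},\mu)$ is a probability space, $\bar y\in\mathcal{D}$ is fixed, $(\mathcal{X},\rho)$ is a metric space that is Polish, with Borel $\sigma$-algebra $\mathcal{B}(\mathcal{X})$, $\nu$ is a probability measure on $\mathcal{X}$, and $E\colon\mathcal{D}\times\mathcal{X}\to\mathbb{R}$ is measurable. Standing assumption: for all $\varepsilon>0$ and $x\in\mathcal{X}$ there is $\delta>0$ such that for all $x'\in\mathcal{X}$, $\rho(x,x')<\delta$ implies $\sup_{y\in\mathcal{D}}|\exp(-E(y,x))-\exp(-E(y,x'))|<\varepsilon$. Put $z^*(x)=\int_{\mathcal{D}}\exp(-E(y,x))\,\mu(dy)\in(0,\infty)$. $\mathcal{P}$ is a set of probability measures on $\mathcal{D}$ containing all $\frac1N\sum_{j=1}^N\delta_{y_j}$, $N\in\mathbb{N}$, $y_1,\dots,y_N\in\mathcal{D}$, and $\mathcal{Z}$ is the set of functions $z\colon\mathcal{X}\to(0,\infty)$ of the form $z(x)=\int_{\mathcal{D}}\exp(-E(y,x))\,\gamma(dy)$ with $\gamma\in\mathcal{P}$, equipped with a suitable $\sigma$-algebra. For $z\in\mathcal{Z}\cup\{z^*\}$, $\pi_z(dx)=\frac{\exp(-E(\bar y,x))}{C_z\,z(x)}\nu(dx)$ with $C_z=\int_{\mathcal{X}}\exp(-E(\bar y,x))z(x)^{-1}\nu(dx)$ (so that $\pi_z$ is a probability measure). Bounding functions. $\ell,u\colon\mathcal{X}\to(0,\infty)$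 are functions with $\ell(x)\le\exp(-E(y,x))\le u(x)$ for all $(y,x)\in\mathcal{D}\times\mathcal{X}$. For $x_0\in\mathcal{X}$, \[ R_1(x_0)=\frac{\int_{\mathcal{X}}\rho(x,x_0)^2\exp(-E(\bar y,x))\,\ell(x)^{-1}\nu(dx)}{\int_{\mathcal{X}}\exp(-E(\bar y,x'))\,u(x')^{-1}\nu(dx')},\qquad R^{(\ell,u)}=\inf_{x_0\in\mathcal{X}}\int_{\mathcal{X}}\left(\rho(x_0,x)^2+R_1(x_0)\right)\frac{u(x)^2}{\ell(x)^2}\,\pi_{z^*}(dx). \] Algorithm. Put $t_j=j(j+1)/2$, $t_0=0$; $N\colon\{0,t_1,t_2,\dots\}\to\mathbb{N}\cup\{0\}$ is increasing. $X_0$ is drawn from an initial distribution, $Z_0\in\mathcal{Z}$ from a transition kernel given $X_0$, and $X_1\sim K(Z_0,X_0,\cdot)$. For $n\in\mathbb{N}$, given $X_0,\dots,X_n$ and $Z_0,\dots,Z_{n-1}$: if $n=t_j$ for some $j\in\mathbb{N}$, sample $Y_{N(t_{j-1})+1},\dots,Y_{N(t_j)}$ iid from $\mu$ (all $Y_k$ iid) and set $Z_n(x)=\frac1{N(n)}\sum_{k=1}^{N(n)}\exp(-E(Y_k,x))$; otherwise set $Z_n=Z_{n-1}$. Then sample $X_{n+1}\sim K(Z_n,X_n,\cdot)$ (conditionally on the whole past). Further $\widehat{\pi}_n(h)=\frac1n\sum_{j=1}^nh(X_j)$, and $m(n)$ is the unique $k\in\mathbb{N}$ with $t_k\le n<t_{k+1}$.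 Cost model. With constants $c_1,c_2,c_3>0$ (cost of one evaluation of $E$, one sample from $\mu$, one evaluation of $h$), \[ \mathrm{cost}(\widehat{\pi}_n):=c_1\sum_{i=1}^nN(t_{m(i)})+c_2N(t_{m(n)})+(c_1+c_3)n . \] Asymptotic notation. For non-negative families $(a_r)_{r\in I},(b_r)_{r\in I}$ with arbitrary index set $I\ne\emptyset$, $a_r\preceq b_r$ means there is $c\in\mathbb{R}$ with $a_r\le c\,b_r$ for all $r\in I$; $a_r\asymp b_r$ means $a_r\preceq b_r$ and $b_r\preceq a_r$. Metric notions. $\|h\|_\rho=\sup_{x\ne y}|h(x)-h(y)|/\rho(x,y)$; the supremum over $\|h\|_\rho\le1$ is over such $h\colon\mathcal{X}\to\mathbb{R}$ that are $\pi_z$-integrable for all $z\in\mathcal{Z}\cup\{z^*\}$. $W(\mu_1,\mu_2)=\inf_\xi\int\rho\,d\xi$ over couplings $\xi$ of $\mu_1,\mu_2$; $\tau(K_z^k)=\sup_{x_1\ne x_2}W(K_z^k(x_1,\cdot),K_z^k(x_2,\cdot))/\rho(x_1,x_2)$, where $K_z^k$ is the $k$-fold product of $K_z$; $\mathrm{ecc}_z(x)=\int\rho(x,x')\pi_z(dx')$; $\mathrm{diff}(z,x)=\int\int\rho(x_1,x_2)^2K_z(x,dx_1)K_z(x,dx_2)$. $(K_z)_{z\in\mathcal{Z}}$ is simultaneous Wasserstein contractive if there are $C\in(0,\infty)$, $\tau\in[0,1)$, $k_0\in\mathbb{N}$ such that for every $z\in\mathcal{Z}$ the invariant distribution of $K_z$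 is $\pi_z$, $\tau(K_z)\le C$ and $\tau(K_z^{k_0})\le\tau$ ($k_0$ taken smallest possible). $(X_n,Z_n)$ is metric regular if $\sup_{j,k\in\mathbb{N}_0}\mathbb{E}[\mathrm{ecc}_{Z_j}(X_k)^2]<\infty$ and $\sup_{j,k\in\mathbb{N}_0}\mathbb{E}[\mathrm{diff}(Z_j,X_k)]<\infty$.
   Formalization: For α=1 the bound is claimed for ε in (0,ε0], for every ε0<1, with constant depending on ε0; on all of (0,1) it is false, since cost_ε ≥ c1+c3 > 0 while (log(1/ε)/ε)^2 → 0 as ε → 1. *)

theory Defs
  imports "HOL-Probability.Probability"
begin

section \<open>Domination of families\<close>

text \<open>Infinite values are allowed on the left, so that an infimum over the empty set is covered.
  Since \<open>ennreal c = 0\<close> for \<open>c < 0\<close>, only nonnegative constants matter.\<close>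

definition dominated :: "'i set \<Rightarrow> ('i \<Rightarrow> ennreal) \<Rightarrow> ('i \<Rightarrow> ennreal) \<Rightarrow> bool" where
  "dominated I a b \<longleftrightarrow> (\<exists>c::real. \<forall>r\<in>I. a r \<le> ennreal c * b r)"

definition same_order :: "'i set \<Rightarrow> ('i \<Rightarrow> ennreal) \<Rightarrow> ('i \<Rightarrow> ennreal) \<Rightarrow> bool" where
  "same_order I a b \<longleftrightarrow> dominated I a b \<and> dominated I b a"


section \<open>Metric notions\<close>

definition lip_seminorm :: "('x::metric_space \<Rightarrow> real) \<Rightarrow> ennreal" where
  "lip_seminorm h = (SUP (x, y)\<in>{(x, y). x \<noteq> y}. ennreal (\<bar>h x - h y\<bar> / dist x y))"

definition couplings :: "'x::metric_space measure \<Rightarrow> 'x measure \<Rightarrow> ('x \<times> 'x) measure set" where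
  "couplings \<mu>1 \<mu>2 = {\<xi>. prob_space \<xi> \<and> sets \<xi> = sets (borel \<Otimes>\<^sub>M borel) \<and>
     distr \<xi> borel fst = \<mu>1 \<and> distr \<xi> borel snd = \<mu>2}"

definition wasserstein :: "'x::metric_space measure \<Rightarrow> 'x measure \<Rightarrow> ennreal" where
  "wasserstein \<mu>1 \<mu>2 = (INF \<xi>\<in>couplings \<mu>1 \<mu>2. \<integral>\<^sup>+p. ennreal (dist (fst p) (snd p)) \<partial>\<xi>)"

definition wasserstein_contraction :: "('x::metric_space \<Rightarrow> 'x measure) \<Rightarrow> ennreal" where
  "wasserstein_contraction L =
     (SUP (x1, x2)\<in>{(x1, x2). x1 \<noteq> x2}. wasserstein (L x1) (L x2) / ennreal (dist x1 x2))"

fun kernel_power :: "('x::metric_space \<Rightarrow> 'x measure) \<Rightarrow> nat \<Rightarrow> 'x \<Rightarrow> 'x measure" where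
  "kernel_power L 0 x = return borel x"
| "kernel_power L (Suc k) x = L x \<bind> kernel_power L k"


section \<open>The doubly intractable setting\<close>

definition zfun :: "('d \<Rightarrow> 'x \<Rightarrow> real) \<Rightarrow> 'd measure \<Rightarrow> 'x \<Rightarrow> real" where
  "zfun E \<gamma> x = (\<integral>y. exp (- E y x) \<partial>\<gamma>)"

definition empirical_measure :: "'d measure \<Rightarrow> nat \<Rightarrow> (nat \<Rightarrow> 'd) \<Rightarrow> 'd measure" where
  "empirical_measure \<mu> n y = measure_of (space \<mu>) (sets \<mu>)
     (\<lambda>A. ennreal (1 / real n) * (\<Sum>j=1..n. emeasure (return \<mu> (y j)) A))"

text \<open>The functions are required to be finite-valued, which for the Bochner integral
  means integrability.\<close>

definition Zset :: "('d \<Rightarrow> 'x \<Rightarrow> real) \<Rightarrow> 'd measure set \<Rightarrow> ('x \<Rightarrow> real) set" where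
  "Zset E P = {z. (\<forall>x. 0 < z x) \<and>
     (\<exists>\<gamma>\<in>P. (\<forall>x. integrable \<gamma> (\<lambda>y. exp (- E y x))) \<and> z = zfun E \<gamma>)}"

definition norm_const ::
    "('d \<Rightarrow> 'x \<Rightarrow> real) \<Rightarrow> 'd \<Rightarrow> 'x measure \<Rightarrow> ('x \<Rightarrow> real) \<Rightarrow> ennreal" where
  "norm_const E ybar \<nu> z = (\<integral>\<^sup>+x. ennreal (exp (- E ybar x) / z x) \<partial>\<nu>)"

definition target ::
    "('d \<Rightarrow> 'x \<Rightarrow> real) \<Rightarrow> 'd \<Rightarrow> 'x measure \<Rightarrow> ('x \<Rightarrow> real) \<Rightarrow> 'x measure" where
  "target E ybar \<nu> z =
     density \<nu> (\<lambda>x. ennreal (exp (- E ybar x) / z x) / norm_const E ybar \<nu> z)"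

text \<open>The space is only required to be Polish as a topological space: its metric itself need not
  be complete.\<close>

locale doubly_intractable =
  fixes \<mu> :: "'d measure" and ybar :: 'd
    and \<nu> :: "'x::{metric_space, second_countable_topology} measure"
    and E :: "'d \<Rightarrow> 'x \<Rightarrow> real" and P :: "'d measure set"
  assumes prob_mu: "prob_space \<mu>"
    and ybar: "ybar \<in> space \<mu>"
    and polish: "completely_metrizable_space (euclidean :: 'x topology)"
    and prob_nu: "prob_space \<nu>" and sets_nu: "sets \<nu> = sets borel"
    and E_measurable: "(\<lambda>(y, x). E y x) \<in> borel_measurable (\<mu> \<Otimes>\<^sub>M borel)"
    and E_uniform: "\<And>\<epsilon> x. 0 < \<epsilon> \<Longrightarrow> \<exists>\<delta>>0. \<forall>x'. dist x x' < \<delta> \<longrightarrow>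
          (SUP y\<in>space \<mu>. ennreal \<bar>exp (- E y x) - exp (- E y x')\<bar>) < ennreal \<epsilon>"
    and zstar_finite: "\<And>x. integrable \<mu> (\<lambda>y. exp (- E y x))"
    and P_prob: "\<And>\<gamma>. \<gamma> \<in> P \<Longrightarrow> prob_space \<gamma> \<and> sets \<gamma> = sets \<mu>"
    and P_empirical: "\<And>n y. 1 \<le> n \<Longrightarrow> (\<And>j. j \<in> {1..n} \<Longrightarrow> y j \<in> space \<mu>) \<Longrightarrow>
          empirical_measure \<mu> n y \<in> P"
    and norm_const_finite:
      "\<And>z. z \<in> Zset E P \<union> {zfun E \<mu>} \<Longrightarrow> norm_const E ybar \<nu> z < \<infinity>"

definition R1 :: "('d \<Rightarrow> 'x::metric_space \<Rightarrow> real) \<Rightarrow> 'd \<Rightarrow> 'x measure \<Rightarrow>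
    ('x \<Rightarrow> real) \<Rightarrow> ('x \<Rightarrow> real) \<Rightarrow> 'x \<Rightarrow> ennreal" where
  "R1 E ybar \<nu> l u x0 =
     (\<integral>\<^sup>+x. ennreal ((dist x x0)\<^sup>2 * exp (- E ybar x) / l x) \<partial>\<nu>) /
     (\<integral>\<^sup>+x. ennreal (exp (- E ybar x) / u x) \<partial>\<nu>)"

definition Rbound :: "'d measure \<Rightarrow> ('d \<Rightarrow> 'x::metric_space \<Rightarrow> real) \<Rightarrow> 'd \<Rightarrow> 'x measure \<Rightarrow>
    ('x \<Rightarrow> real) \<Rightarrow> ('x \<Rightarrow> real) \<Rightarrow> ennreal" where
  "Rbound \<mu> E ybar \<nu> l u = (INF x0. \<integral>\<^sup>+x.
     (ennreal ((dist x0 x)\<^sup>2) + R1 E ybar \<nu> l u x0) * ennreal ((u x)\<^sup>2 / (l x)\<^sup>2)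
     \<partial>(target E ybar \<nu> (zfun E \<mu>)))"


section \<open>Kernels\<close>

text \<open>A kernel on \<open>\<Z> \<times> \<X>\<close> is a map \<open>K\<close> on pairs; its sections \<open>\<lambda>x. K (z, x)\<close> are the kernels
  \<open>K\<^sub>z\<close>. The exponent \<open>k0\<close> being chosen minimal is no restriction here, as it is quantified
  existentially.\<close>

definition simultaneous_wasserstein_contractive ::
    "('x \<Rightarrow> real) set \<Rightarrow> (('x \<Rightarrow> real) \<Rightarrow> 'x::metric_space measure) \<Rightarrow>
     (('x \<Rightarrow> real) \<times> 'x \<Rightarrow> 'x measure) \<Rightarrow> bool" where
  "simultaneous_wasserstein_contractive \<Z> \<pi> K \<longleftrightarrow>
     (\<exists>(C::real) (\<tau>::real) (k0::nat). 0 < C \<and> 0 \<le> \<tau> \<and> \<tau> < 1 \<and> 1 \<le> k0 \<and>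
       (\<forall>z\<in>\<Z>. (\<pi> z \<bind> (\<lambda>x. K (z, x))) = \<pi> z \<and>
         wasserstein_contraction (\<lambda>x. K (z, x)) \<le> ennreal C \<and>
         wasserstein_contraction (kernel_power (\<lambda>x. K (z, x)) k0) \<le> ennreal \<tau>))"

definition ecc :: "(('x \<Rightarrow> real) \<Rightarrow> 'x::metric_space measure) \<Rightarrow> ('x \<Rightarrow> real) \<Rightarrow> 'x \<Rightarrow> ennreal" where
  "ecc \<pi> z x = (\<integral>\<^sup>+x'. ennreal (dist x x') \<partial>(\<pi> z))"

definition kernel_diff ::
    "(('x \<Rightarrow> real) \<times> 'x \<Rightarrow> 'x::metric_space measure) \<Rightarrow> ('x \<Rightarrow> real) \<Rightarrow> 'x \<Rightarrow> ennreal" where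
  "kernel_diff K z x =
     (\<integral>\<^sup>+x1. (\<integral>\<^sup>+x2. ennreal ((dist x1 x2)\<^sup>2) \<partial>K (z, x)) \<partial>K (z, x))"


section \<open>The AIR algorithm\<close>

definition tri :: "nat \<Rightarrow> nat" where
  "tri j = j * (j + 1) div 2"

definition epoch :: "nat \<Rightarrow> nat" where
  "epoch n = (THE k. 1 \<le> k \<and> tri k \<le> n \<and> n < tri (Suc k))"

definition history :: "'w measure \<Rightarrow> ('x \<Rightarrow> real) measure \<Rightarrow> 'd measure \<Rightarrow>
    (nat \<Rightarrow> 'w \<Rightarrow> 'x::metric_space) \<Rightarrow> (nat \<Rightarrow> 'w \<Rightarrow> 'x \<Rightarrow> real) \<Rightarrow> (nat \<Rightarrow> 'w \<Rightarrow> 'd) \<Rightarrow>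
    nat set \<Rightarrow> nat set \<Rightarrow> nat set \<Rightarrow> 'w measure" where
  "history M ZM \<mu> X Z Y I J L = sigma (space M)
     ({X i -` A \<inter> space M | i A. i \<in> I \<and> A \<in> sets borel} \<union>
      {Z i -` B \<inter> space M | i B. i \<in> J \<and> B \<in> sets ZM} \<union>
      {Y k -` C \<inter> space M | k C. k \<in> L \<and> C \<in> sets \<mu>})"

text \<open>\<open>ZM\<close> carries the \<open>\<sigma>\<close>-algebra on \<open>\<Z>\<close>, and \<open>N\<close> is only used at the times \<open>tri j\<close>.
  The existentially quantified kernel \<open>\<kappa>\<close> generates \<open>Z 0\<close> from \<open>X 0\<close>. At time \<open>tri j\<close> the newly
  sampled block of \<open>Y\<close> is independent of everything generated before, and \<open>X (Suc n)\<close> is drawn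
  from \<open>K\<close> conditionally on everything generated up to and including \<open>Z n\<close>.\<close>

definition air_process :: "'d measure \<Rightarrow> ('d \<Rightarrow> 'x::metric_space \<Rightarrow> real) \<Rightarrow>
    ('x \<Rightarrow> real) measure \<Rightarrow> (('x \<Rightarrow> real) \<times> 'x \<Rightarrow> 'x measure) \<Rightarrow> (nat \<Rightarrow> nat) \<Rightarrow>
    'w measure \<Rightarrow> (nat \<Rightarrow> 'w \<Rightarrow> 'x) \<Rightarrow> (nat \<Rightarrow> 'w \<Rightarrow> 'x \<Rightarrow> real) \<Rightarrow> (nat \<Rightarrow> 'w \<Rightarrow> 'd) \<Rightarrow> bool" where
  "air_process \<mu> E ZM K N M X Z Y \<longleftrightarrow>
     prob_space M \<and>
     (\<forall>n. X n \<in> M \<rightarrow>\<^sub>M borel) \<and>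
     (\<forall>n. Z n \<in> M \<rightarrow>\<^sub>M ZM) \<and>
     (\<forall>k\<ge>1. Y k \<in> M \<rightarrow>\<^sub>M \<mu>) \<and>
     (\<exists>\<kappa> \<in> borel \<rightarrow>\<^sub>M prob_algebra ZM.
       distr M (borel \<Otimes>\<^sub>M ZM) (\<lambda>\<omega>. (X 0 \<omega>, Z 0 \<omega>)) =
       distr M borel (X 0) \<bind> (\<lambda>x. \<kappa> x \<bind> (\<lambda>z. return (borel \<Otimes>\<^sub>M ZM) (x, z)))) \<and>
     prob_space.indep_vars M (\<lambda>_. \<mu>) Y {1..} \<and>
     (\<forall>k\<ge>1. distr M \<mu> (Y k) = \<mu>) \<and>
     (\<forall>j\<ge>1. prob_space.indep_set M
       (sets (history M ZM \<mu> X Z Y {..tri j} {..<tri j} {1..N (tri (j - 1))}))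
       (sets (history M ZM \<mu> X Z Y {} {} {N (tri (j - 1)) + 1..N (tri j)}))) \<and>
     (\<forall>j\<ge>1. \<forall>\<omega>\<in>space M.
       Z (tri j) \<omega> = (\<lambda>x. (1 / real (N (tri j))) * (\<Sum>k=1..N (tri j). exp (- E (Y k \<omega>) x)))) \<and>
     (\<forall>n\<ge>1. n \<notin> range tri \<longrightarrow> (\<forall>\<omega>\<in>space M. Z n \<omega> = Z (n - 1) \<omega>)) \<and>
     (\<forall>n. \<forall>A\<in>sets borel. AE \<omega> in M.
       real_cond_exp M
         (history M ZM \<mu> X Z Y {..n} {..n} {k. 1 \<le> k \<and> (\<exists>j. tri j \<le> n \<and> k \<le> N (tri j))})
         (indicator (X (Suc n) -` A)) \<omega> =
       measure (K (Z n \<omega>, X n \<omega>)) A)"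

definition metric_regular :: "(('x \<Rightarrow> real) \<Rightarrow> 'x::metric_space measure) \<Rightarrow>
    (('x \<Rightarrow> real) \<times> 'x \<Rightarrow> 'x measure) \<Rightarrow>
    'w measure \<Rightarrow> (nat \<Rightarrow> 'w \<Rightarrow> 'x) \<Rightarrow> (nat \<Rightarrow> 'w \<Rightarrow> 'x \<Rightarrow> real) \<Rightarrow> bool" where
  "metric_regular \<pi> K M X Z \<longleftrightarrow>
     (SUP (j, k)\<in>UNIV. \<integral>\<^sup>+\<omega>. (ecc \<pi> (Z j \<omega>) (X k \<omega>))\<^sup>2 \<partial>M) < \<infinity> \<and>
     (SUP (j, k)\<in>UNIV. \<integral>\<^sup>+\<omega>. kernel_diff K (Z j \<omega>) (X k \<omega>) \<partial>M) < \<infinity>"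


section \<open>Error and cost\<close>

definition pi_hat :: "(nat \<Rightarrow> 'w \<Rightarrow> 'x) \<Rightarrow> nat \<Rightarrow> ('x \<Rightarrow> real) \<Rightarrow> 'w \<Rightarrow> real" where
  "pi_hat X n h \<omega> = (1 / real n) * (\<Sum>j=1..n. h (X j \<omega>))"

text \<open>Worst-case mean squared error for the target \<open>\<pi> zs\<close>.\<close>

definition mse_sup :: "('x \<Rightarrow> real) set \<Rightarrow> (('x \<Rightarrow> real) \<Rightarrow> 'x::metric_space measure) \<Rightarrow>
    ('x \<Rightarrow> real) \<Rightarrow> 'w measure \<Rightarrow> (nat \<Rightarrow> 'w \<Rightarrow> 'x) \<Rightarrow> nat \<Rightarrow> ennreal" where
  "mse_sup \<Z> \<pi> zs M X n =
     (SUP h\<in>{h. lip_seminorm h \<le> 1 \<and> (\<forall>z\<in>\<Z> \<union> {zs}. integrable (\<pi> z) h)}.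
        \<integral>\<^sup>+\<omega>. ennreal (\<bar>pi_hat X n h \<omega> - (\<integral>x. h x \<partial>(\<pi> zs))\<bar>\<^sup>2) \<partial>M)"

definition cost :: "real \<Rightarrow> real \<Rightarrow> real \<Rightarrow> (nat \<Rightarrow> nat) \<Rightarrow> nat \<Rightarrow> real" where
  "cost c1 c2 c3 N n =
     c1 * (\<Sum>i=1..n. real (N (tri (epoch i)))) + c2 * real (N (tri (epoch n))) + (c1 + c3) * real n"

text \<open>Pitfall: since \<open>n \<ge> 1\<close> and \<open>c1 + c3 > 0\<close>, this quantity is bounded away from \<open>0\<close>
  uniformly in \<open>\<epsilon>\<close>. Hence it cannot be dominated on all of \<open>0 < \<epsilon> < 1\<close> by a function that
  vanishes as \<open>\<epsilon>\<close> tends to \<open>1\<close>, such as \<open>(ln (1 / \<epsilon>) / \<epsilon>)\<^sup>2\<close>; a bound of that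
  form can only be asserted on sets \<open>0 < \<epsilon> \<le> \<epsilon>0\<close> with \<open>\<epsilon>0 < 1\<close>.\<close>

definition cost_eps :: "real \<Rightarrow> real \<Rightarrow> real \<Rightarrow> (nat \<Rightarrow> nat) \<Rightarrow>
    ('x \<Rightarrow> real) set \<Rightarrow> (('x \<Rightarrow> real) \<Rightarrow> 'x::metric_space measure) \<Rightarrow>
    ('x \<Rightarrow> real) \<Rightarrow> 'w measure \<Rightarrow> (nat \<Rightarrow> 'w \<Rightarrow> 'x) \<Rightarrow> real \<Rightarrow> ennreal" where
  "cost_eps c1 c2 c3 N \<Z> \<pi> zs M X \<epsilon> =
     (INF n\<in>{n. 1 \<le> n \<and> mse_sup \<Z> \<pi> zs M X n \<le> ennreal \<epsilon>}. ennreal (cost c1 c2 c3 N n))"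

end

theory Submission
  imports Defs
begin

text \<open>Let \<open>L = K\<^sub>z\<close> and let \<open>U = (\<Sum>k<m. L\<^sup>k h)\<close> be a truncated solution of the Poisson equation
  \<open>U - L U = h - L\<^sup>m h\<close>. The contraction assumption bounds the Lipschitz constant of \<open>U\<close>
  independently of \<open>m\<close>. Summed over the path, \<open>h\<close> minus its target mean splits into martingale
  increments (mean square of order \<open>n\<close>), a part that telescopes within each of the about
  \<open>sqrt (2 * n)\<close> epochs (again of order \<open>n\<close>), the small remainder \<open>L\<^sup>m h\<close> minus its mean, and the bias of
  the target of \<open>Z\<^sub>i\<close>, whose mean square is at most of the order of one over the sample size. Hence
  the mean squared error is at most of order \<open>n powr - min 1 ((1 + \<alpha>) / 2)\<close>, which together with
  the order of the cost gives the claim; no logarithm is needed for \<open>\<alpha> = 1\<close>.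

  The argument is carried out for bounded \<open>h\<close>, where all integrals exist; truncation and Fatou's
  lemma give the general case.\<close>


section \<open>Rates\<close>

text \<open>Two constants are kept apart throughout: a sup bound, which only makes integrals exist,
  and a Lipschitz constant, which alone reaches the estimates. The full Poisson series need not be
  bounded; a truncated one is, though with a bound that grows with \<open>m\<close>. Its Lipschitz
  bound involves neither \<open>m\<close> nor the size of \<open>h\<close>. Hence \<open>m\<close>
  can be taken so large, depending on \<open>n\<close>, that the remainder has Lipschitz constant at
  most \<open>1 / n\<close>, and the truncation of \<open>h\<close> can be removed at the end with
  the same constants. The other obstacle is that the states and the normalizing functions depend on
  the same samples, and that samples are reused in all later epochs. The bias terms are therefore
  neither independent of the path nor orthogonal to each other. They involve the parameter
  \<open>Z i\<close> but not the state, so each is bounded in mean square by the sampling error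
  alone, and they are combined by a Cauchy-Schwarz inequality with suitable weights.\<close>

lemma real_tri: "real (tri k) = real k * (real k + 1) / 2"
proof -
  have "even (k * (k + 1))" by simp
  then have "real (k * (k + 1) div 2) = real (k * (k + 1)) / 2"
    using real_of_nat_div[of 2 "k * (k + 1)"] by simp
  then show ?thesis by (simp add: tri_def algebra_simps)
qed

lemma tri_mono: "i \<le> j \<Longrightarrow> tri i \<le> tri j"
  unfolding tri_def by (intro div_le_mono mult_le_mono) auto

lemma tri_ge_self: "k \<le> tri k"
proof (cases k)
  case (Suc m)
  have "2 * k \<le> k * (k + 1)" using Suc by simp
  then show ?thesis unfolding tri_def by linarith
qed (simp add: tri_def)

lemma epoch_unique:
  assumes "1 \<le> k" "tri k \<le> n" "n < tri (Suc k)"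
  shows "epoch n = k"
  unfolding epoch_def
proof (rule the_equality)
  fix k' assume k': "1 \<le> k' \<and> tri k' \<le> n \<and> n < tri (Suc k')"
  show "k' = k"
  proof (rule ccontr)
    assume "k' \<noteq> k"
    then have "Suc k' \<le> k \<or> Suc k \<le> k'" by linarith
    then show False
      using tri_mono[of "Suc k'" k] tri_mono[of "Suc k" k'] assms k' by linarith
  qed
qed (use assms in auto)

text \<open>The definite description in \<open>epoch\<close> is well defined: since
  \<open>k \<le> tri k\<close>, the set of \<open>k\<close> with \<open>tri k \<le> n\<close> is
  finite, and its largest element has the defining property. The condition \<open>1 \<le> n\<close>
  puts \<open>1\<close> into this set.\<close>

lemma epoch_bounds:
  assumes "1 \<le> n"
  shows "1 \<le> epoch n" "tri (epoch n) \<le> n" "n < tri (Suc (epoch n))"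
proof -
  define k where "k = (GREATEST k. tri k \<le> n)"
  have bnd: "\<And>y. tri y \<le> n \<Longrightarrow> y \<le> n" using tri_ge_self le_trans by blast
  have tri1: "tri 1 \<le> n" using assms by (simp add: tri_def)
  have k1: "tri k \<le> n" unfolding k_def using GreatestI_nat[of "\<lambda>k. tri k \<le> n" 1 n] tri1 bnd by blast
  have kmax: "\<And>y. tri y \<le> n \<Longrightarrow> y \<le> k"
    unfolding k_def using Greatest_le_nat[of "\<lambda>k. tri k \<le> n" _ n] bnd by blast
  have "1 \<le> k" using kmax[OF tri1] .
  moreover have "n < tri (Suc k)" using kmax[of "Suc k"] by (meson Suc_n_not_le_n not_le)
  ultimately have "epoch n = k" using k1 by (intro epoch_unique)
  then show "1 \<le> epoch n" "tri (epoch n) \<le> n" "n < tri (Suc (epoch n))"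
    using \<open>1 \<le> k\<close> k1 \<open>n < tri (Suc k)\<close> by auto
qed

lemma epoch_tri: "1 \<le> j \<Longrightarrow> epoch (tri j) = j"
  by (rule epoch_unique) (auto simp: tri_def)

lemma epoch_step:
  assumes "1 \<le> n" "Suc n \<notin> range tri"
  shows "epoch (Suc n) = epoch n"
proof (rule epoch_unique)
  show "Suc n < tri (Suc (epoch n))"
    using epoch_bounds(3)[OF assms(1)] assms(2) by (metis Suc_lessI rangeI)
qed (use epoch_bounds[OF assms(1)] in auto)

lemma epoch_sq_ge:
  assumes "1 \<le> n"
  shows "real n \<le> 3 * (real (epoch n))\<^sup>2"
proof -
  define k where "k = real (epoch n)"
  have k: "1 \<le> k" using epoch_bounds(1)[OF assms] by (simp add: k_def)
  have "real n \<le> real (tri (Suc (epoch n)))" using epoch_bounds(3)[OF assms] by simp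
  also have "\<dots> = (k\<^sup>2 + 3 * k + 2) / 2"
    by (simp add: k_def real_tri power2_eq_square algebra_simps)
  \<comment> \<open>Since \<open>1 \<le> k\<close>, both \<open>3 * k\<close> and \<open>2\<close>
    are absorbed into multiples of \<open>k\<^sup>2\<close>, and
    \<open>(1 + 3 + 2) / 2 = 3\<close>.\<close>
  also have "\<dots> \<le> 3 * k\<^sup>2"
  proof -
    have "k \<le> k\<^sup>2" "1 \<le> k\<^sup>2" using k by (simp_all add: self_le_power)
    then show ?thesis by argo
  qed
  finally show ?thesis by (simp add: k_def)
qed

lemma tri_sq_ge: "(real k)\<^sup>2 \<le> 2 * real (tri k)"
  by (simp add: real_tri power2_eq_square algebra_simps)

text \<open>The update times up to \<open>n\<close> are among
  \<open>tri 1, ..., tri (epoch n)\<close>, so there are at most \<open>epoch n\<close> of them, and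
  the square of \<open>epoch n\<close> is at most \<open>2 * tri (epoch n)\<close>. The squared form
  is the one that appears when this many terms are summed in mean square.\<close>

lemma card_tri_le:
  "(real (card {i \<in> {1..n}. i \<in> range tri}))\<^sup>2 \<le> 2 * real n"
proof (cases "n = 0")
  case False
  then have n: "1 \<le> n" by simp
  have "{i \<in> {1..n}. i \<in> range tri} \<subseteq> tri ` {1..epoch n}"
  proof
    fix i assume "i \<in> {i \<in> {1..n}. i \<in> range tri}"
    then obtain k where k: "i = tri k" "1 \<le> i" "i \<le> n" by auto
    have "1 \<le> k" using k by (cases k) (auto simp: tri_def)
    moreover have "k \<le> epoch n"
    proof (rule ccontr)
      assume "\<not> k \<le> epoch n"
      then have "tri (Suc (epoch n)) \<le> tri k" by (intro tri_mono) auto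
      then show False using epoch_bounds(3)[OF n] k by simp
    qed
    ultimately show "i \<in> tri ` {1..epoch n}" using k by auto
  qed
  then have "card {i \<in> {1..n}. i \<in> range tri} \<le> card (tri ` {1..epoch n})"
    by (intro card_mono) auto
  also have "\<dots> \<le> epoch n" using card_image_le[of "{1..epoch n}" tri] by simp
  finally have "(real (card {i \<in> {1..n}. i \<in> range tri}))\<^sup>2 \<le> (real (epoch n))\<^sup>2"
    by (simp add: power_mono)
  also have "\<dots> \<le> 2 * real (tri (epoch n))" by (rule tri_sq_ge)
  also have "\<dots> \<le> 2 * real n" using epoch_bounds(2)[OF n] by simp
  finally show ?thesis .
qed simp

lemma sum_inverse_sqrt_le: "(\<Sum>i=1..n. 1 / sqrt (real i)) \<le> 2 * sqrt (real n)"
proof (induction n)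
  case (Suc n)
  define a b where "a = sqrt (real n)" and "b = sqrt (real (Suc n))"
  have b: "0 < b" "b\<^sup>2 = a\<^sup>2 + 1" by (simp_all add: a_def b_def)
  \<comment> \<open>With \<open>b\<^sup>2 = a\<^sup>2 + 1\<close> this square gives
    \<open>1 / b \<le> 2 * b - 2 * a\<close>, so the sum is dominated by a telescoping one.\<close>
  have "0 \<le> (a - b)\<^sup>2" by simp
  then have "2 * a * b + 1 \<le> 2 * b\<^sup>2" using b(2) by (simp add: power2_eq_square algebra_simps)
  then have "1 \<le> (2 * b - 2 * a) * b" by (simp add: power2_eq_square algebra_simps)
  then have "1 / b \<le> 2 * b - 2 * a" using b(1) by (simp add: pos_divide_le_eq)
  then show ?case using Suc by (simp add: a_def b_def)
qed simp

text \<open>The epoch of \<open>n\<close> is of order \<open>sqrt n\<close>.\<close>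

lemma sample_size_ge:
  assumes n: "1 \<le> n" and \<beta>: "0 \<le> \<beta>" "\<beta> \<le> 1" "2 * \<beta> \<le> 1 + \<alpha>"
  shows "real n powr \<beta> / 3 \<le> real (nat \<lceil>real (epoch n) powr (1 + \<alpha>)\<rceil>)"
proof -
  let ?k = "real (epoch n)"
  have k: "1 \<le> ?k" using epoch_bounds(1)[OF n] by simp
  have "real n powr \<beta> \<le> (3 * ?k\<^sup>2) powr \<beta>"
    using epoch_sq_ge[OF n] \<beta>(1) by (intro powr_mono2) auto
  also have "\<dots> = 3 powr \<beta> * ?k powr (2 * \<beta>)"
    using k by (simp add: powr_mult powr_powr flip: powr_numeral)
  also have "\<dots> \<le> 3 powr 1 * ?k powr (1 + \<alpha>)"
    using \<beta> k by (intro mult_mono powr_mono) auto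
  finally have "real n powr \<beta> / 3 \<le> ?k powr (1 + \<alpha>)" by simp
  also have "\<dots> \<le> real (nat \<lceil>?k powr (1 + \<alpha>)\<rceil>)" by linarith
  finally show ?thesis .
qed

text \<open>A run length of about \<open>(A / \<epsilon>) powr (1 / \<beta>)\<close> reaches the
  accuracy, and its cost bounds the infimum from above. The condition \<open>1 \<le> A\<close> makes
  this length at least 1, so that rounding up costs at most a factor 2.\<close>

lemma cost_eps_le:
  assumes mse: "\<And>n. 1 \<le> n \<Longrightarrow> mse_sup \<Z> \<pi> zs M X n \<le> ennreal (A * real n powr - \<beta>)"
    and cost: "\<And>n. 1 \<le> n \<Longrightarrow>
      ennreal (cost c1 c2 c3 N n) \<le> ennreal c * ennreal (real n powr \<gamma>)"
    and A: "1 \<le> A" and \<beta>: "0 < \<beta>" and \<gamma>: "0 \<le> \<gamma>" and \<epsilon>: "0 < \<epsilon>" "\<epsilon> < 1"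
  shows "cost_eps c1 c2 c3 N \<Z> \<pi> zs M X \<epsilon> \<le>
    ennreal (\<bar>c\<bar> * (2 * A powr (1 / \<beta>)) powr \<gamma>) * ennreal (\<epsilon> powr (- (\<gamma> / \<beta>)))"
proof -
  define t where "t = (A / \<epsilon>) powr (1 / \<beta>)"
  define n where "n = nat \<lceil>t\<rceil>"
  have "1 \<le> A / \<epsilon>" using A \<epsilon> by (simp add: field_simps)
  then have t1: "1 \<le> t" unfolding t_def using \<beta> by (intro ge_one_powr_ge_zero) auto
  have n: "1 \<le> n" "t \<le> real n" "real n \<le> 2 * t"
    unfolding n_def using t1 by linarith+
  have "A * real n powr - \<beta> \<le> A * t powr - \<beta>"
    using n t1 A \<beta> by (intro mult_left_mono powr_mono2') auto
  also have "t powr - \<beta> = \<epsilon> / A"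
    unfolding t_def using A \<epsilon> \<beta> by (simp add: powr_powr powr_minus)
  also have "A * (\<epsilon> / A) = \<epsilon>" using A by simp
  finally have "mse_sup \<Z> \<pi> zs M X n \<le> ennreal \<epsilon>"
    using mse[OF n(1)] by (meson ennreal_leI order_trans)
  then have "cost_eps c1 c2 c3 N \<Z> \<pi> zs M X \<epsilon> \<le> ennreal (cost c1 c2 c3 N n)"
    unfolding cost_eps_def using n by (intro INF_lower) auto
  also have "\<dots> \<le> ennreal c * ennreal (real n powr \<gamma>)" by (rule cost[OF n(1)])
  also have "\<dots> \<le> ennreal \<bar>c\<bar> * ennreal ((2 * t) powr \<gamma>)"
    using n \<gamma> by (intro mult_mono ennreal_leI powr_mono2) auto
  also have "\<dots> = ennreal (\<bar>c\<bar> * (2 * A powr (1 / \<beta>)) powr \<gamma>) * ennreal (\<epsilon> powr (- (\<gamma> / \<beta>)))"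
  proof -
    have "(2 * t) powr \<gamma> = (2 * A powr (1 / \<beta>)) powr \<gamma> * \<epsilon> powr (- (\<gamma> / \<beta>))"
      unfolding t_def using A \<epsilon> by (simp add: powr_divide powr_mult powr_powr powr_minus field_simps)
    then show ?thesis by (simp flip: ennreal_mult add: mult.assoc)
  qed
  finally show ?thesis .
qed

section \<open>Bounded Lipschitz functions and Wasserstein contractions\<close>

text \<open>The two constants are carried separately because iterating a contracting kernel shrinks
  \<open>c\<close> but merely preserves \<open>B\<close>.\<close>

definition blip :: "real \<Rightarrow> real \<Rightarrow> ('x::metric_space \<Rightarrow> real) \<Rightarrow> bool" where
  "blip B c f \<longleftrightarrow> (\<forall>x. \<bar>f x\<bar> \<le> B) \<and> (\<forall>x y. \<bar>f x - f y\<bar> \<le> c * dist x y)"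

lemma blipD: "blip B c f \<Longrightarrow> \<bar>f x\<bar> \<le> B" "blip B c f \<Longrightarrow> \<bar>f x - f y\<bar> \<le> c * dist x y"
  by (auto simp: blip_def)

lemma blip_mono:
  assumes "blip B c f" "c \<le> c'" shows "blip B c' f"
  unfolding blip_def
proof (intro conjI allI)
  fix x y
  show "\<bar>f x\<bar> \<le> B" using assms(1) by (rule blipD)
  show "\<bar>f x - f y\<bar> \<le> c' * dist x y"
    using blipD(2)[OF assms(1)] mult_right_mono[OF assms(2) zero_le_dist] by (rule order_trans)
qed

lemma blip_measurable:
  assumes "blip B c f" shows "f \<in> borel_measurable borel"
proof (rule borel_measurable_continuous_onI)
  have "\<bar>c\<bar>-lipschitz_on UNIV f"
  proof (rule lipschitz_onI)
    fix x y show "dist (f x) (f y) \<le> \<bar>c\<bar> * dist x y"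
      using order_trans[OF blipD(2)[OF assms, of x y]
        mult_right_mono[of c "\<bar>c\<bar>" "dist x y"]] by (simp add: dist_real_def)
  qed simp
  then show "continuous_on UNIV f" by (rule lipschitz_on_continuous_on)
qed

lemma blip_integrable:
  assumes f: "blip B c f" and \<mu>: "prob_space \<mu>" "sets \<mu> = sets borel"
  shows "integrable \<mu> f"
proof -
  interpret prob_space \<mu> by fact
  have "f \<in> borel_measurable \<mu>"
    using blip_measurable[OF f] \<mu>(2) by (simp cong: measurable_cong_sets)
  then show ?thesis
    using blipD(1)[OF f] by (intro integrable_const_bound[where B=B]) auto
qed

lemma bounded_integral_le:
  fixes f :: "'a \<Rightarrow> real"
  assumes "prob_space \<mu>" "f \<in> borel_measurable \<mu>" "\<And>x. x \<in> space \<mu> \<Longrightarrow> \<bar>f x\<bar> \<le> B"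
  shows "\<bar>\<integral>x. f x \<partial>\<mu>\<bar> \<le> B"
proof -
  interpret prob_space \<mu> by fact
  have "integrable \<mu> f"
    using assms by (intro integrable_const_bound[where B=B]) auto
  then have "\<bar>\<integral>x. f x \<partial>\<mu>\<bar> \<le> (\<integral>x. \<bar>f x\<bar> \<partial>\<mu>)" using integral_abs_bound by blast
  also have "\<dots> \<le> B"
    using \<open>integrable \<mu> f\<close> assms by (intro integral_le_const) auto
  finally show ?thesis .
qed

text \<open>The easy half of Kantorovich-Rubinstein duality: the difference of the means is the mean
  of \<open>f (fst p) - f (snd p)\<close> under any coupling. Dividing by \<open>c\<close> first
  lets the bound be checked coupling by coupling, without moving a factor through the
  infimum.\<close>

lemma wasserstein_dual:
  fixes \<mu>1 \<mu>2 :: "'x::{metric_space, second_countable_topology} measure"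
  assumes f: "blip B c f" and c: "0 < c"
  shows "ennreal \<bar>(\<integral>x. f x \<partial>\<mu>1) - (\<integral>x. f x \<partial>\<mu>2)\<bar> \<le> ennreal c * wasserstein \<mu>1 \<mu>2"
proof -
  let ?\<Delta> = "\<bar>(\<integral>x. f x \<partial>\<mu>1) - (\<integral>x. f x \<partial>\<mu>2)\<bar>"
  have "ennreal ?\<Delta> / ennreal c \<le> wasserstein \<mu>1 \<mu>2"
    unfolding wasserstein_def
  proof (rule INF_greatest)
    fix \<xi> assume "\<xi> \<in> couplings \<mu>1 \<mu>2"
    then have \<xi>: "prob_space \<xi>" and s[measurable_cong]: "sets \<xi> = sets (borel \<Otimes>\<^sub>M borel)"
      and m: "distr \<xi> borel fst = \<mu>1" "distr \<xi> borel snd = \<mu>2"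
      by (auto simp: couplings_def)
    interpret \<xi>: prob_space \<xi> by fact
    note [measurable] = blip_measurable[OF f]
    have i: "integrable \<xi> (\<lambda>p. f (fst p))" "integrable \<xi> (\<lambda>p. f (snd p))"
      using blipD(1)[OF f] by (auto intro!: \<xi>.integrable_const_bound[where B=B])
    have "(\<integral>x. f x \<partial>\<mu>1) - (\<integral>x. f x \<partial>\<mu>2) = (\<integral>p. f (fst p) - f (snd p) \<partial>\<xi>)"
      unfolding m[symmetric] using i by (simp add: integral_distr)
    then have "ennreal ?\<Delta> \<le> (\<integral>\<^sup>+p. ennreal \<bar>f (fst p) - f (snd p)\<bar> \<partial>\<xi>)"
      using integral_norm_bound_ennreal[of \<xi> "\<lambda>p. f (fst p) - f (snd p)"] i by simp
    also have "\<dots> \<le> (\<integral>\<^sup>+p. ennreal c * ennreal (dist (fst p) (snd p)) \<partial>\<xi>)"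
      using blipD(2)[OF f] c by (intro nn_integral_mono) (simp flip: ennreal_mult)
    also have "\<dots> = ennreal c * (\<integral>\<^sup>+p. ennreal (dist (fst p) (snd p)) \<partial>\<xi>)"
      by (rule nn_integral_cmult) measurable
    finally show "ennreal ?\<Delta> / ennreal c \<le> (\<integral>\<^sup>+p. ennreal (dist (fst p) (snd p)) \<partial>\<xi>)"
      using c by (intro divide_le_posI_ennreal) auto
  qed
  then have "ennreal c * (ennreal ?\<Delta> / ennreal c) \<le> ennreal c * wasserstein \<mu>1 \<mu>2"
    by (rule mult_left_mono) simp
  then show ?thesis using c by (simp add: ennreal_times_divide divide_ennreal flip: ennreal_mult)
qed

lemma wasserstein_contraction_blip:
  fixes L :: "'x::{metric_space, second_countable_topology} \<Rightarrow> 'x measure"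
  assumes L: "wasserstein_contraction L \<le> ennreal C" and C: "0 \<le> C"
    and f: "blip B c f" and c: "0 < c"
  shows "\<bar>(\<integral>y. f y \<partial>L x1) - (\<integral>y. f y \<partial>L x2)\<bar> \<le> C * c * dist x1 x2"
proof (cases "x1 = x2")
  case False
  have "wasserstein (L x1) (L x2) / ennreal (dist x1 x2) \<le> wasserstein_contraction L"
    unfolding wasserstein_contraction_def using False by (intro SUP_upper2[of "(x1, x2)"]) auto
  then have "wasserstein (L x1) (L x2) / ennreal (dist x1 x2) \<le> ennreal C"
    using L by (rule order_trans)
  then have "wasserstein (L x1) (L x2) / ennreal (dist x1 x2) * ennreal (dist x1 x2) \<le>
      ennreal C * ennreal (dist x1 x2)"
    by (rule mult_right_mono) simp
  moreover have "wasserstein (L x1) (L x2) / ennreal (dist x1 x2) * ennreal (dist x1 x2) =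
      wasserstein (L x1) (L x2)"
    using False by (simp add: ennreal_divide_times mult_divide_eq_ennreal)
  ultimately have W: "wasserstein (L x1) (L x2) \<le> ennreal C * ennreal (dist x1 x2)"
    by simp
  have "ennreal \<bar>(\<integral>y. f y \<partial>L x1) - (\<integral>y. f y \<partial>L x2)\<bar> \<le> ennreal c * wasserstein (L x1) (L x2)"
    by (rule wasserstein_dual[OF f c])
  also have "\<dots> \<le> ennreal c * (ennreal C * ennreal (dist x1 x2))"
    using W by (rule mult_left_mono) simp
  also have "\<dots> = ennreal (C * c * dist x1 x2)"
    using C c by (simp flip: ennreal_mult add: mult_ac)
  finally show ?thesis using C c by simp
qed simp

lemma prob_kernel:
  assumes "L \<in> N \<rightarrow>\<^sub>M prob_algebra R" "x \<in> space N"
  shows "prob_space (L x)" "sets (L x) = sets R" "space (L x) = space R"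
  using measurable_space[OF assms] by (auto simp: space_prob_algebra dest: sets_eq_imp_space_eq)

definition kernel_op :: "('x \<Rightarrow> 'y measure) \<Rightarrow> ('y \<Rightarrow> real) \<Rightarrow> 'x \<Rightarrow> real" where
  "kernel_op L f x = (\<integral>y. f y \<partial>L x)"

lemma kernel_op_blip:
  fixes L :: "'x::{metric_space, second_countable_topology} \<Rightarrow> 'x measure"
  assumes L: "L \<in> borel \<rightarrow>\<^sub>M prob_algebra borel" "wasserstein_contraction L \<le> ennreal C"
    and C: "0 \<le> C" and f: "blip B c f" and c: "0 < c"
  shows "blip B (C * c) (kernel_op L f)"
  unfolding blip_def kernel_op_def
proof (intro conjI allI)
  show "\<bar>(\<integral>y. f y \<partial>L x) - (\<integral>y. f y \<partial>L y)\<bar> \<le> C * c * dist x y" for x y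
    by (rule wasserstein_contraction_blip[OF L(2) C f c])
next
  fix x
  note [measurable_cong] = prob_kernel(2)[OF L(1), of x, simplified]
  show "\<bar>\<integral>y. f y \<partial>L x\<bar> \<le> B"
    using prob_kernel[OF L(1), of x] blipD(1)[OF f] blip_measurable[OF f]
    by (intro bounded_integral_le) auto
qed

lemma kernel_power_measurable:
  assumes "L \<in> borel \<rightarrow>\<^sub>M prob_algebra borel"
  shows "kernel_power L k \<in> borel \<rightarrow>\<^sub>M prob_algebra borel"
proof (induction k)
  case 0
  have "kernel_power L 0 = return borel" by auto
  then show ?case by (auto intro!: measurable_prob_algebraI prob_space_return)
next
  case (Suc k)
  have "kernel_power L (Suc k) = (\<lambda>x. L x \<bind> kernel_power L k)" by auto
  then show ?case using measurable_bind_prob_space[OF assms Suc] by simp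
qed

text \<open>The constants are normalized: \<open>1 \<le> C\<close> makes the powers of
  \<open>C\<close> increase with the exponent, and \<open>0 < \<tau>\<close> keeps the Lipschitz
  constants \<open>\<tau> ^ q * b\<close> positive, as the duality bound demands.\<close>

locale contractive_kernel =
  fixes L :: "'x::{metric_space, second_countable_topology} \<Rightarrow> 'x measure"
    and C \<tau> :: real and k0 :: nat
  assumes L: "L \<in> borel \<rightarrow>\<^sub>M prob_algebra borel"
    and C: "1 \<le> C" "wasserstein_contraction L \<le> ennreal C"
    and \<tau>: "0 < \<tau>" "\<tau> < 1" "wasserstein_contraction (kernel_power L k0) \<le> ennreal \<tau>"
    and k0: "1 \<le> k0"
begin

lemma kernel_op_pow_blip_weak:
  assumes "blip B c f" "0 < c"
  shows "blip B (C ^ k * c) ((kernel_op L ^^ k) f)"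
proof (induction k)
  case (Suc k)
  have "0 < C ^ k * c" using C assms by simp
  then show ?case using kernel_op_blip[OF L C(2) _ Suc] C by (simp add: mult_ac)
qed (simp add: assms)

text \<open>The contraction hypothesis concerns powers of the kernel, the estimates use iterates of
  the operator; this identifies the two. \<open>kernel_power\<close> splits off the first
  transition, so the induction runs over all starting points.\<close>

lemma kernel_op_pow_eq:
  assumes "blip B c f" "0 < c"
  shows "(\<integral>y. f y \<partial>kernel_power L k x) = (kernel_op L ^^ k) f x"
proof (induction k arbitrary: x)
  case 0
  then show ?case using blip_measurable[OF assms(1)] by (simp add: integral_return)
next
  case (Suc k)
  have "(\<integral>y. f y \<partial>(L x \<bind> kernel_power L k)) = (\<integral>y. \<integral>z. f z \<partial>kernel_power L k y \<partial>L x)"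
  proof (rule integral_bind[where K=borel and B=B and B'=1])
    show "kernel_power L k \<in> L x \<rightarrow>\<^sub>M subprob_algebra borel"
      using measurable_prob_algebraD[OF kernel_power_measurable[OF L]] prob_kernel(2)[OF L, of x]
      by (simp cong: measurable_cong_sets)
    show "finite_measure (L x)" using prob_kernel(1)[OF L, of x] by (simp add: prob_space_def)
    show "AE x in L x. emeasure (kernel_power L k x) (space (kernel_power L k x)) \<le> ennreal 1"
      using prob_kernel(1)[OF kernel_power_measurable[OF L]]
      by (simp add: prob_space.emeasure_space_1)
  qed (use blip_measurable[OF assms(1)] blipD(1)[OF assms(1)] in auto)
  then show ?case by (simp add: Suc kernel_op_def)
qed

text \<open>Write \<open>k = k0 * q + r\<close> with \<open>r < k0\<close>. The \<open>r\<close>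
  innermost applications enlarge the Lipschitz constant by at most \<open>C ^ k0\<close>, and each
  of the \<open>q\<close> blocks of length \<open>k0\<close> around them contracts it by
  \<open>\<tau>\<close>.\<close>

lemma kernel_op_pow_blip:
  assumes f: "blip B c f" and c: "0 < c"
  shows "blip B (\<tau> ^ (k div k0) * (C ^ k0 * c)) ((kernel_op L ^^ k) f)"
proof -
  have step: "blip B (\<tau> ^ q * b) ((kernel_op L ^^ (k0 * q)) g)" if g: "blip B b g" "0 < b" for q b g
  proof (induction q)
    case (Suc q)
    let ?g = "(kernel_op L ^^ (k0 * q)) g"
    have pos: "0 < \<tau> ^ q * b" using \<tau> g by simp
    have eq: "(kernel_op L ^^ (k0 * Suc q)) g = kernel_op (kernel_power L k0) ?g"
      by (rule ext) (simp add: kernel_op_def[of "kernel_power L k0"] kernel_op_pow_eq[OF Suc pos] funpow_add)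
    have "blip B (\<tau> * (\<tau> ^ q * b)) (kernel_op (kernel_power L k0) ?g)"
      using kernel_op_blip[OF kernel_power_measurable[OF L] \<tau>(3) _ Suc pos] \<tau> by simp
    then show ?case unfolding eq by (simp add: mult_ac)
  qed (use g in simp)
  have "blip B (C ^ (k mod k0) * c) ((kernel_op L ^^ (k mod k0)) f)"
    by (rule kernel_op_pow_blip_weak[OF f c])
  moreover have "C ^ (k mod k0) * c \<le> C ^ k0 * c"
  proof (rule mult_right_mono)
    have "k mod k0 \<le> k0" using k0 by (simp add: less_imp_le)
    then show "C ^ (k mod k0) \<le> C ^ k0" using C(1) by (rule power_increasing)
  qed (use c in simp)
  ultimately have "blip B (C ^ k0 * c) ((kernel_op L ^^ (k mod k0)) f)"
    by (rule blip_mono)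
  from step[OF this, of "k div k0"] C c
  show ?thesis by (simp add: funpow_add[symmetric, THEN fun_cong, unfolded comp_def])
qed

text \<open>A partial sum of the Neumann series for the Poisson equation. Its length is a multiple
  of \<open>k0\<close>, so that the geometric weights group into complete blocks and the remainder
  carries the full factor \<open>\<tau> ^ m\<close>.\<close>

definition pot :: "nat \<Rightarrow> ('x \<Rightarrow> real) \<Rightarrow> 'x \<Rightarrow> real" where
  "pot m f x = (\<Sum>k<m * k0. (kernel_op L ^^ k) f x)"

lemma sum_geometric_blocks: "(\<Sum>k<m * k0. \<tau> ^ (k div k0)) \<le> real k0 / (1 - \<tau>)"
proof -
  have "(\<Sum>k<m * k0. \<tau> ^ (k div k0)) = (\<Sum>q<m. \<Sum>k\<in>{q * k0..<q * k0 + k0}. \<tau> ^ (k div k0))"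
    by (rule sum.nat_group[symmetric])
  also have "\<dots> = (\<Sum>q<m. real k0 * \<tau> ^ q)"
  proof (intro sum.cong refl)
    fix q
    have "(\<Sum>k\<in>{q * k0..<q * k0 + k0}. \<tau> ^ (k div k0)) = (\<Sum>k\<in>{q * k0..<q * k0 + k0}. \<tau> ^ q)"
    proof (intro sum.cong refl)
      fix k assume "k \<in> {q * k0..<q * k0 + k0}"
      then have "k div k0 = q" by (intro div_nat_eqI) (auto simp: mult.commute)
      then show "\<tau> ^ (k div k0) = \<tau> ^ q" by simp
    qed
    then show "(\<Sum>k\<in>{q * k0..<q * k0 + k0}. \<tau> ^ (k div k0)) = real k0 * \<tau> ^ q" by simp
  qed
  also have "\<dots> = real k0 * ((1 - \<tau> ^ m) / (1 - \<tau>))"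
    using \<tau> by (simp add: sum_distrib_left[symmetric] sum_gp_strict)
  also have "\<dots> \<le> real k0 * (1 / (1 - \<tau>))"
    using \<tau> by (intro mult_left_mono divide_right_mono) auto
  finally show ?thesis by simp
qed

text \<open>The sup bound grows linearly in \<open>m\<close>; the Lipschitz constants of the
  summands decay geometrically, so their sum is bounded independently of \<open>m\<close>.\<close>

lemma pot_blip:
  assumes f: "blip B c f" and c: "0 < c"
  shows "blip (real (m * k0) * B) (C ^ k0 * c * (real k0 / (1 - \<tau>))) (pot m f)"
  unfolding blip_def
proof (intro conjI allI)
  fix x
  have "\<bar>pot m f x\<bar> \<le> (\<Sum>k<m * k0. \<bar>(kernel_op L ^^ k) f x\<bar>)" unfolding pot_def by (rule sum_abs)
  also have "\<dots> \<le> (\<Sum>k<m * k0. B)"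
    using blipD(1)[OF kernel_op_pow_blip[OF f c]] by (intro sum_mono)
  finally show "\<bar>pot m f x\<bar> \<le> real (m * k0) * B" by simp
next
  fix x y
  have "\<bar>pot m f x - pot m f y\<bar> \<le> (\<Sum>k<m * k0. \<bar>(kernel_op L ^^ k) f x - (kernel_op L ^^ k) f y\<bar>)"
    unfolding pot_def sum_subtractf[symmetric] by (rule sum_abs)
  also have "\<dots> \<le> (\<Sum>k<m * k0. \<tau> ^ (k div k0) * (C ^ k0 * c * dist x y))"
    using blipD(2)[OF kernel_op_pow_blip[OF f c]] by (intro sum_mono) (simp add: mult_ac)
  also have "\<dots> \<le> (real k0 / (1 - \<tau>)) * (C ^ k0 * c * dist x y)"
    unfolding sum_distrib_right[symmetric]
    using sum_geometric_blocks C c by (intro mult_right_mono) auto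
  finally show "\<bar>pot m f x - pot m f y\<bar> \<le> C ^ k0 * c * (real k0 / (1 - \<tau>)) * dist x y"
    by (simp add: mult_ac)
qed

lemma kernel_op_pot_eq:
  assumes f: "blip B c f" and c: "0 < c"
  shows "kernel_op L (pot m f) x = (\<Sum>k<m * k0. (kernel_op L ^^ Suc k) f x)"
proof -
  have "integrable (L x) ((kernel_op L ^^ k) f)" for k
    using prob_kernel[OF L, of x] by (intro blip_integrable[OF kernel_op_pow_blip[OF f c]]) auto
  then show ?thesis
    unfolding kernel_op_def[of L "pot m f"] pot_def by (simp add: kernel_op_def)
qed

lemma pot_minus_kernel_op_pot:
  assumes f: "blip B c f" and c: "0 < c"
  shows "pot m f x - kernel_op L (pot m f) x = f x - (kernel_op L ^^ (m * k0)) f x"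
  unfolding kernel_op_pot_eq[OF assms] pot_def sum_subtractf[symmetric]
  by (subst sum_lessThan_telescope') simp

lemma kernel_op_pot_blip:
  assumes f: "blip B c f" and c: "0 < c"
  shows "blip (real (m * k0) * B) (C ^ k0 * c * (real k0 / (1 - \<tau>)) * C) (kernel_op L (pot m f))"
proof -
  have "0 < C ^ k0 * c * (real k0 / (1 - \<tau>))" using C c k0 \<tau> by simp
  from kernel_op_blip[OF L C(2) _ pot_blip[OF assms] this, of m] C show ?thesis by (simp add: mult_ac)
qed

lemma kernel_op_pow_stationary:
  assumes f: "blip B c f" and c: "0 < c"
    and \<pi>: "prob_space \<pi>" "sets \<pi> = sets borel" "\<pi> \<bind> L = \<pi>"
  shows "(\<integral>x. (kernel_op L ^^ k) f x \<partial>\<pi>) = (\<integral>x. f x \<partial>\<pi>)"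
proof (induction k)
  case (Suc k)
  let ?g = "(kernel_op L ^^ k) f"
  have g: "blip B (\<tau> ^ (k div k0) * (C ^ k0 * c)) ?g" by (rule kernel_op_pow_blip[OF f c])
  have "(\<integral>y. ?g y \<partial>(\<pi> \<bind> L)) = (\<integral>y. \<integral>z. ?g z \<partial>L y \<partial>\<pi>)"
  proof (rule integral_bind[where K=borel and B=B and B'=1])
    show "L \<in> \<pi> \<rightarrow>\<^sub>M subprob_algebra borel"
      using measurable_prob_algebraD[OF L] \<pi>(2) by (simp cong: measurable_cong_sets)
    show "finite_measure \<pi>" using \<pi>(1) by (simp add: prob_space_def)
    show "AE x in \<pi>. emeasure (L x) (space (L x)) \<le> ennreal 1"
      using prob_kernel(1)[OF L] by (simp add: prob_space.emeasure_space_1)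
  qed (use blip_measurable[OF g] blipD(1)[OF g] in auto)
  then show ?case using Suc by (simp add: \<pi>(3) kernel_op_def[abs_def])
qed simp

end

text \<open>\<open>f x\<close> minus the mean is the mean of \<open>f x - f x'\<close>. The integral
  on the right is an eccentricity and may be infinite, hence the extended nonnegative form.\<close>

lemma stationary_mean_deviation:
  fixes f :: "'x::{metric_space, second_countable_topology} \<Rightarrow> real"
  assumes f: "blip B c f" and c: "0 \<le> c" and \<pi>: "prob_space \<pi>" "sets \<pi> = sets borel"
  shows "ennreal \<bar>f x - (\<integral>x'. f x' \<partial>\<pi>)\<bar> \<le> ennreal c * (\<integral>\<^sup>+x'. ennreal (dist x x') \<partial>\<pi>)"
proof -
  interpret prob_space \<pi> by fact
  note [measurable_cong] = \<pi>(2)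
  have i: "integrable \<pi> f" by (rule blip_integrable[OF f \<pi>])
  have "f x - (\<integral>x'. f x' \<partial>\<pi>) = (\<integral>x'. f x - f x' \<partial>\<pi>)" using i by (simp add: prob_space)
  then have "ennreal \<bar>f x - (\<integral>x'. f x' \<partial>\<pi>)\<bar> \<le> (\<integral>\<^sup>+x'. ennreal \<bar>f x - f x'\<bar> \<partial>\<pi>)"
    using integral_norm_bound_ennreal[of \<pi> "\<lambda>x'. f x - f x'"] i
    by (simp del: Bochner_Integration.integral_diff)
  also have "\<dots> \<le> (\<integral>\<^sup>+x'. ennreal c * ennreal (dist x x') \<partial>\<pi>)"
    using blipD(2)[OF f] c by (intro nn_integral_mono) (simp flip: ennreal_mult)
  also have "\<dots> = ennreal c * (\<integral>\<^sup>+x'. ennreal (dist x x') \<partial>\<pi>)"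
    by (rule nn_integral_cmult) measurable
  finally show ?thesis .
qed

section \<open>Square means\<close>

lemma integral_sum_sq_orthogonal:
  fixes f :: "'i \<Rightarrow> 'a \<Rightarrow> real"
  assumes int: "\<And>i j. i \<in> I \<Longrightarrow> j \<in> I \<Longrightarrow> integrable M (\<lambda>\<omega>. f i \<omega> * f j \<omega>)"
    and orth: "\<And>i j. i \<in> I \<Longrightarrow> j \<in> I \<Longrightarrow> i \<noteq> j \<Longrightarrow> (\<integral>\<omega>. f i \<omega> * f j \<omega> \<partial>M) = 0"
    and fin: "finite I"
  shows "(\<integral>\<omega>. (\<Sum>i\<in>I. f i \<omega>)\<^sup>2 \<partial>M) = (\<Sum>i\<in>I. \<integral>\<omega>. (f i \<omega>)\<^sup>2 \<partial>M)"
    and "integrable M (\<lambda>\<omega>. (\<Sum>i\<in>I. f i \<omega>)\<^sup>2)"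
proof -
  have eq: "(\<Sum>i\<in>I. f i \<omega>)\<^sup>2 = (\<Sum>i\<in>I. \<Sum>j\<in>I. f i \<omega> * f j \<omega>)" for \<omega>
    by (simp add: power2_eq_square sum_product)
  show "integrable M (\<lambda>\<omega>. (\<Sum>i\<in>I. f i \<omega>)\<^sup>2)"
    unfolding eq using int by auto
  have "(\<integral>\<omega>. (\<Sum>i\<in>I. f i \<omega>)\<^sup>2 \<partial>M) = (\<Sum>i\<in>I. \<Sum>j\<in>I. \<integral>\<omega>. f i \<omega> * f j \<omega> \<partial>M)"
    unfolding eq using int by simp
  also have "\<dots> = (\<Sum>i\<in>I. \<Sum>j\<in>I. if j = i then \<integral>\<omega>. (f i \<omega>)\<^sup>2 \<partial>M else 0)"
    using orth by (intro sum.cong refl) (auto simp: power2_eq_square)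
  also have "\<dots> = (\<Sum>i\<in>I. \<integral>\<omega>. (f i \<omega>)\<^sup>2 \<partial>M)" using fin by simp
  finally show "(\<integral>\<omega>. (\<Sum>i\<in>I. f i \<omega>)\<^sup>2 \<partial>M) = (\<Sum>i\<in>I. \<integral>\<omega>. (f i \<omega>)\<^sup>2 \<partial>M)" .
qed

text \<open>Cauchy-Schwarz after writing \<open>f i = sqrt (w i) * (f i / sqrt (w i))\<close>; the
  summands may be correlated in any way. Weights proportional to the root mean squares of the
  \<open>f i\<close> would reproduce Minkowski's inequality, weights 1 give the crude factor
  \<open>card I\<close>.\<close>

lemma nn_integral_sum_sq_weighted:
  fixes f :: "'i \<Rightarrow> 'a \<Rightarrow> real"
  assumes [measurable]: "\<And>i. i \<in> I \<Longrightarrow> f i \<in> borel_measurable M"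
    and w: "\<And>i. i \<in> I \<Longrightarrow> 0 < w i"
  shows "(\<integral>\<^sup>+\<omega>. ennreal ((\<Sum>i\<in>I. f i \<omega>)\<^sup>2) \<partial>M) \<le>
    ennreal (\<Sum>i\<in>I. w i) * (\<Sum>i\<in>I. ennreal (1 / w i) * (\<integral>\<^sup>+\<omega>. ennreal ((f i \<omega>)\<^sup>2) \<partial>M))"
proof -
  have pt: "(\<Sum>i\<in>I. f i \<omega>)\<^sup>2 \<le> (\<Sum>i\<in>I. w i) * (\<Sum>i\<in>I. (f i \<omega>)\<^sup>2 / w i)" for \<omega>
  proof -
    have "(\<Sum>i\<in>I. f i \<omega>) = (\<Sum>i\<in>I. sqrt (w i) * (f i \<omega> / sqrt (w i)))"
      by (intro sum.cong refl) (use w in \<open>auto dest: order_less_imp_not_eq2\<close>)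
    moreover have "\<dots>\<^sup>2 \<le> (\<Sum>i\<in>I. (sqrt (w i))\<^sup>2) * (\<Sum>i\<in>I. (f i \<omega> / sqrt (w i))\<^sup>2)"
      by (rule Cauchy_Schwarz_ineq_sum)
    moreover have "(\<Sum>i\<in>I. (sqrt (w i))\<^sup>2) = (\<Sum>i\<in>I. w i)"
      using w by (intro sum.cong refl) (auto simp: less_imp_le)
    moreover have "(\<Sum>i\<in>I. (f i \<omega> / sqrt (w i))\<^sup>2) = (\<Sum>i\<in>I. (f i \<omega>)\<^sup>2 / w i)"
      using w by (intro sum.cong refl) (auto simp: power_divide less_imp_le)
    ultimately show ?thesis by simp
  qed
  have wpos: "0 \<le> (\<Sum>i\<in>I. w i)" using w by (intro sum_nonneg) (simp add: less_imp_le)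
  have "(\<integral>\<^sup>+\<omega>. ennreal ((\<Sum>i\<in>I. f i \<omega>)\<^sup>2) \<partial>M) \<le>
      (\<integral>\<^sup>+\<omega>. ennreal (\<Sum>i\<in>I. w i) * (\<Sum>i\<in>I. ennreal (1 / w i) * ennreal ((f i \<omega>)\<^sup>2)) \<partial>M)"
  proof (rule nn_integral_mono)
    fix \<omega>
    have "(\<Sum>i\<in>I. ennreal (1 / w i) * ennreal ((f i \<omega>)\<^sup>2)) = (\<Sum>i\<in>I. ennreal ((f i \<omega>)\<^sup>2 / w i))"
      using w by (intro sum.cong refl) (auto simp: less_imp_le simp flip: ennreal_mult)
    also have "\<dots> = ennreal (\<Sum>i\<in>I. (f i \<omega>)\<^sup>2 / w i)"
      using w by (intro sum_ennreal) (auto simp: less_imp_le)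
    finally show "ennreal ((\<Sum>i\<in>I. f i \<omega>)\<^sup>2) \<le>
        ennreal (\<Sum>i\<in>I. w i) * (\<Sum>i\<in>I. ennreal (1 / w i) * ennreal ((f i \<omega>)\<^sup>2))"
      using pt[of \<omega>] wpos w
      by (simp add: sum_nonneg less_imp_le flip: ennreal_mult)
  qed
  also have "\<dots> = ennreal (\<Sum>i\<in>I. w i) *
      (\<Sum>i\<in>I. ennreal (1 / w i) * (\<integral>\<^sup>+\<omega>. ennreal ((f i \<omega>)\<^sup>2) \<partial>M))"
    by (simp add: nn_integral_cmult nn_integral_sum)
  finally show ?thesis .
qed

lemma nn_integral_sum_sq_le:
  fixes f :: "'i \<Rightarrow> 'a \<Rightarrow> real"
  assumes "\<And>i. i \<in> I \<Longrightarrow> f i \<in> borel_measurable M"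
  shows "(\<integral>\<^sup>+\<omega>. ennreal ((\<Sum>i\<in>I. f i \<omega>)\<^sup>2) \<partial>M) \<le>
    of_nat (card I) * (\<Sum>i\<in>I. \<integral>\<^sup>+\<omega>. ennreal ((f i \<omega>)\<^sup>2) \<partial>M)"
  using nn_integral_sum_sq_weighted[of I f M "\<lambda>_. 1"] assms
  by (simp add: ennreal_of_nat_eq_real_of_nat)

text \<open>If \<open>f\<close> is not integrable, its integral has the default value
  \<open>0\<close>; if \<open>f\<close> is integrable but its square is not, the right-hand side is
  \<open>top\<close>; otherwise the claim is that a variance is nonnegative.\<close>

lemma jensen_sq:
  fixes f :: "'a \<Rightarrow> real"
  assumes \<pi>: "prob_space \<pi>" and f[measurable]: "f \<in> borel_measurable \<pi>"
  shows "ennreal ((\<integral>x. f x \<partial>\<pi>)\<^sup>2) \<le> (\<integral>\<^sup>+x. ennreal ((f x)\<^sup>2) \<partial>\<pi>)"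
proof (cases "integrable \<pi> f \<and> integrable \<pi> (\<lambda>x. (f x)\<^sup>2)")
  case True
  interpret prob_space \<pi> by fact
  have "(\<integral>x. f x \<partial>\<pi>)\<^sup>2 \<le> (\<integral>x. (f x)\<^sup>2 \<partial>\<pi>)"
    using variance_positive[of f] variance_eq[of f] True by simp
  moreover have "(\<integral>\<^sup>+x. ennreal ((f x)\<^sup>2) \<partial>\<pi>) = ennreal (\<integral>x. (f x)\<^sup>2 \<partial>\<pi>)"
    using True by (intro nn_integral_eq_integral) auto
  ultimately show ?thesis by simp
next
  case False
  show ?thesis
  proof (cases "integrable \<pi> f")
    case True
    then have "\<not> integrable \<pi> (\<lambda>x. (f x)\<^sup>2)" using False by simp
    moreover have "integrable \<pi> (\<lambda>x. (f x)\<^sup>2)" if "(\<integral>\<^sup>+x. ennreal ((f x)\<^sup>2) \<partial>\<pi>) < \<infinity>"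
      using that by (intro integrableI_nonneg) simp_all
    ultimately have "(\<integral>\<^sup>+x. ennreal ((f x)\<^sup>2) \<partial>\<pi>) = top"
      unfolding infinity_ennreal_def less_top[symmetric] by blast
    then show ?thesis by simp
  qed (simp add: not_integrable_integral_eq)
qed

text \<open>Independence makes the centred terms pairwise orthogonal, so only \<open>n\<close>
  variances divided by \<open>n\<^sup>2\<close> remain, and a variance is at most the second moment,
  here at most \<open>b\<^sup>2\<close>.\<close>

lemma (in prob_space) mean_of_iid_sq_le:
  fixes f :: "nat \<Rightarrow> 'a \<Rightarrow> real"
  assumes indep: "indep_vars (\<lambda>_. borel) f {1..n}" and n: "1 \<le> n"
    and bnd: "\<And>k \<omega>. k \<in> {1..n} \<Longrightarrow> \<omega> \<in> space M \<Longrightarrow> \<bar>f k \<omega>\<bar> \<le> b"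
    and mean: "\<And>k. k \<in> {1..n} \<Longrightarrow> expectation (f k) = m"
  shows "(\<integral>\<^sup>+\<omega>. ennreal ((1 / real n * (\<Sum>k=1..n. f k \<omega>) - m)\<^sup>2) \<partial>M) \<le> ennreal (b\<^sup>2 / real n)"
proof -
  let ?g = "\<lambda>k \<omega>. (f k \<omega> - m) / real n"
  have f[measurable]: "f k \<in> borel_measurable M" if "k \<in> {1..n}" for k
    using indep that unfolding indep_vars_def by auto
  have int: "integrable M (f k)" if "k \<in> {1..n}" for k
    using f[OF that] bnd[OF that] by (intro integrable_const_bound[where B=b]) auto
  have bg: "\<bar>?g k \<omega>\<bar> \<le> (b + \<bar>m\<bar>) / real n" if "k \<in> {1..n}" "\<omega> \<in> space M" for k \<omega>
    using bnd[OF that] n by (auto simp: abs_divide intro!: divide_right_mono)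
  have bgg: "\<bar>?g i \<omega> * ?g j \<omega>\<bar> \<le> ((b + \<bar>m\<bar>) / real n) * ((b + \<bar>m\<bar>) / real n)"
    if "i \<in> {1..n}" "j \<in> {1..n}" "\<omega> \<in> space M" for i j \<omega>
    unfolding abs_mult using bg[OF that(1,3)] bg[OF that(2,3)]
    by (intro mult_mono order_trans[OF abs_ge_zero bg[OF that(1,3)]]) auto
  have igg: "integrable M (\<lambda>\<omega>. ?g i \<omega> * ?g j \<omega>)" if "i \<in> {1..n}" "j \<in> {1..n}" for i j
  proof (rule integrable_const_bound)
    show "AE \<omega> in M. norm (?g i \<omega> * ?g j \<omega>) \<le> ((b + \<bar>m\<bar>) / real n) * ((b + \<bar>m\<bar>) / real n)"
      unfolding real_norm_def by (rule AE_I2) (rule bgg[OF that])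
    note [measurable] = f[OF that(1)] f[OF that(2)]
    show "(\<lambda>\<omega>. ?g i \<omega> * ?g j \<omega>) \<in> borel_measurable M" by measurable
  qed
  have g0: "expectation (?g k) = 0" if "k \<in> {1..n}" for k
    using int[OF that] mean[OF that] by (simp add: prob_space)
  have orth: "expectation (\<lambda>\<omega>. ?g i \<omega> * ?g j \<omega>) = 0"
    if "i \<in> {1..n}" "j \<in> {1..n}" "i \<noteq> j" for i j
  proof -
    have "indep_vars (\<lambda>_. borel) (\<lambda>k \<omega>. ?g k \<omega>) {1..n}"
      by (rule indep_vars_compose2[OF indep]) measurable
    then have "indep_vars (\<lambda>_. borel) (\<lambda>k \<omega>. ?g k \<omega>) {i, j}"
      by (rule indep_vars_subset) (use that in auto)
    then have "expectation (\<lambda>\<omega>. \<Prod>k\<in>{i, j}. ?g k \<omega>) = (\<Prod>k\<in>{i, j}. expectation (?g k))"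
      by (intro indep_vars_lebesgue_integral) (use int that in auto)
    then show ?thesis using g0[OF that(1)] that(3) by auto
  qed
  have sumeq: "(1 / real n * (\<Sum>k=1..n. f k \<omega>) - m) = (\<Sum>k=1..n. ?g k \<omega>)" for \<omega>
  proof -
    have "(\<Sum>k=1..n. ?g k \<omega>) = ((\<Sum>k=1..n. f k \<omega>) - real n * m) / real n"
      unfolding sum_divide_distrib[symmetric] sum_subtractf by simp
    then show ?thesis using n by (simp add: diff_divide_distrib)
  qed
  have gsq: "expectation (\<lambda>\<omega>. (?g k \<omega>)\<^sup>2) \<le> b\<^sup>2 / (real n)\<^sup>2" if k: "k \<in> {1..n}" for k
  proof -
    have sq: "(f k \<omega>)\<^sup>2 \<le> b\<^sup>2" if "\<omega> \<in> space M" for \<omega>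
      using bnd[OF k that] by (meson abs_ge_self abs_le_square_iff order_trans)
    have fsq: "integrable M (\<lambda>\<omega>. (f k \<omega>)\<^sup>2)"
      using f[OF k] sq by (intro integrable_const_bound[where B="b\<^sup>2"]) auto
    have "expectation (\<lambda>\<omega>. (f k \<omega> - m)\<^sup>2) \<le> expectation (\<lambda>\<omega>. (f k \<omega>)\<^sup>2)"
      using variance_eq[OF int[OF k] fsq] mean[OF k] by simp
    also have "\<dots> \<le> b\<^sup>2"
      using fsq sq by (intro integral_le_const) auto
    finally show ?thesis using n by (simp add: power_divide divide_right_mono)
  qed
  have "(\<integral>\<omega>. (\<Sum>k=1..n. ?g k \<omega>)\<^sup>2 \<partial>M) = (\<Sum>k=1..n. expectation (\<lambda>\<omega>. (?g k \<omega>)\<^sup>2))"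
    by (rule integral_sum_sq_orthogonal(1)[OF igg orth]) auto
  also have "\<dots> \<le> (\<Sum>k=1..n. b\<^sup>2 / (real n)\<^sup>2)" by (intro sum_mono gsq)
  also have "\<dots> = b\<^sup>2 / real n" using n by (simp add: power2_eq_square)
  finally have le: "(\<integral>\<omega>. (\<Sum>k=1..n. ?g k \<omega>)\<^sup>2 \<partial>M) \<le> b\<^sup>2 / real n" .
  have "integrable M (\<lambda>\<omega>. (\<Sum>k=1..n. ?g k \<omega>)\<^sup>2)"
    by (rule integral_sum_sq_orthogonal(2)[OF igg orth]) auto
  then have "(\<integral>\<^sup>+\<omega>. ennreal ((\<Sum>k=1..n. ?g k \<omega>)\<^sup>2) \<partial>M) = ennreal (\<integral>\<omega>. (\<Sum>k=1..n. ?g k \<omega>)\<^sup>2 \<partial>M)"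
    by (rule nn_integral_eq_integral) simp
  then show ?thesis unfolding sumeq using le by (simp add: ennreal_leI)
qed

section \<open>The bias caused by the approximate normalizing function\<close>

lemma inverse_antimono_ennreal:
  fixes a b :: ennreal
  assumes "a \<le> b" shows "inverse b \<le> inverse a"
proof (cases "a = 0 \<or> b = top")
  case False
  then have "a < top" using assms by (metis le_less_trans less_top)
  then obtain r s where rs: "a = ennreal r" "b = ennreal s" "0 \<le> r" "0 \<le> s"
    using False by (metis ennreal_cases less_top_ennreal)
  then have "0 < r" "r \<le> s" using False assms by (auto simp: less_le)
  then show ?thesis using rs by (simp add: inverse_ennreal ennreal_leI)
qed auto

lemma measurable_zfun:
  fixes E :: "'d \<Rightarrow> 'x::topological_space \<Rightarrow> real"
  assumes E[measurable]: "(\<lambda>(y, x). E y x) \<in> borel_measurable (\<mu> \<Otimes>\<^sub>M borel)"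
    and \<gamma>: "prob_space \<gamma>" "sets \<gamma> = sets \<mu>"
  shows "zfun E \<gamma> \<in> borel_measurable borel"
proof -
  interpret prob_space \<gamma> by fact
  have [measurable]: "(\<lambda>(y, x). E y x) \<in> borel_measurable (\<gamma> \<Otimes>\<^sub>M borel)"
    using E by (subst measurable_cong_sets[OF sets_pair_measure_cong[OF \<gamma>(2) refl] refl])
  have "(\<lambda>x. \<integral>y. exp (- E y x) \<partial>\<gamma>) \<in> borel_measurable borel"
    by (rule borel_measurable_lebesgue_integral) measurable
  then show ?thesis by (simp add: zfun_def[abs_def])
qed

context doubly_intractable
begin

interpretation mu: prob_space \<mu> by (rule prob_mu)
interpretation nu: prob_space \<nu> by (rule prob_nu)

abbreviation (input) w :: "'x \<Rightarrow> real" where "w x \<equiv> exp (- E ybar x)"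

abbreviation (input) \<pi> :: "('x \<Rightarrow> real) \<Rightarrow> 'x measure" where "\<pi> \<equiv> target E ybar \<nu>"

lemma measurable_w[measurable]: "w \<in> borel_measurable borel"
proof -
  have "(\<lambda>x. (ybar, x)) \<in> borel \<rightarrow>\<^sub>M \<mu> \<Otimes>\<^sub>M borel" using ybar by simp
  from measurable_compose[OF this E_measurable] show ?thesis by simp
qed

text \<open>What the computations with \<open>\<pi> z\<close> need from \<open>z\<close>. It covers
  the elements of \<open>Zset E P\<close> and also \<open>zfun E \<mu>\<close>, which need not be
  one of them.\<close>

definition admissible :: "('x \<Rightarrow> real) \<Rightarrow> bool" where
  "admissible z \<longleftrightarrow> z \<in> borel_measurable borel \<and> (\<forall>x. 0 < z x) \<and> norm_const E ybar \<nu> z < \<infinity>"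

lemma admissible_Zset:
  assumes "z \<in> Zset E P" shows "admissible z"
proof -
  obtain \<gamma> where "\<gamma> \<in> P" and z: "z = zfun E \<gamma>" and pos: "\<forall>x. 0 < z x"
    using assms by (auto simp: Zset_def)
  then have "zfun E \<gamma> \<in> borel_measurable borel"
    using P_prob by (intro measurable_zfun[OF E_measurable]) auto
  then show ?thesis using z pos norm_const_finite assms by (simp add: admissible_def)
qed

lemma admissible_zstar: "admissible (zfun E \<mu>)"
proof -
  have "0 < zfun E \<mu> x" for x
  proof -
    have "0 \<le> zfun E \<mu> x" unfolding zfun_def by (rule integral_nonneg_AE) auto
    moreover have "zfun E \<mu> x \<noteq> 0"
    proof
      assume "zfun E \<mu> x = 0"
      then have "AE y in \<mu>. exp (- E y x) = 0"
        unfolding zfun_def using zstar_finite by (subst (asm) integral_nonneg_eq_0_iff_AE) auto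
      then show False by simp
    qed
    ultimately show ?thesis by simp
  qed
  then show ?thesis
    using norm_const_finite measurable_zfun[OF E_measurable prob_mu refl]
    by (auto simp: admissible_def)
qed

definition nc :: "('x \<Rightarrow> real) \<Rightarrow> real" where
  "nc z = (\<integral>x. w x / z x \<partial>\<nu>)"

context
  fixes z assumes z: "admissible z"
begin

lemma z_measurable[measurable]: "z \<in> borel_measurable borel" and z_pos: "0 < z x"
  using z by (auto simp: admissible_def)

lemma integrable_w_z: "integrable \<nu> (\<lambda>x. w x / z x)"
proof (rule integrableI_nonneg)
  show "(\<integral>\<^sup>+x. ennreal (w x / z x) \<partial>\<nu>) < \<infinity>"
    using z by (simp add: admissible_def norm_const_def)
  show "(\<lambda>x. w x / z x) \<in> borel_measurable \<nu>"
    using sets_nu by (simp cong: measurable_cong_sets)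
qed (use z_pos in \<open>auto simp: less_imp_le\<close>)

lemma norm_const_eq: "norm_const E ybar \<nu> z = ennreal (nc z)"
  unfolding norm_const_def nc_def
  using integrable_w_z z_pos by (intro nn_integral_eq_integral) (auto simp: less_imp_le)

lemma nc_pos: "0 < nc z"
proof -
  have "0 \<le> nc z" unfolding nc_def using z_pos by (intro integral_nonneg_AE) (auto simp: less_imp_le)
  moreover have "nc z \<noteq> 0"
  proof
    assume "nc z = 0"
    then have "AE x in \<nu>. w x / z x = 0"
      unfolding nc_def using integrable_w_z z_pos
      by (subst (asm) integral_nonneg_eq_0_iff_AE) (auto simp: less_imp_le)
    moreover have "w x / z x \<noteq> 0" for x using z_pos[of x] by simp
    ultimately show False by simp
  qed
  ultimately show ?thesis by simp
qed

lemma target_eq: "\<pi> z = density \<nu> (\<lambda>x. ennreal (w x / z x / nc z))"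
  unfolding target_def norm_const_eq
  using nc_pos z_pos by (simp add: divide_ennreal less_imp_le)

lemma sets_target: "sets (\<pi> z) = sets borel" by (simp add: target_def sets_nu)

lemma nn_integral_target:
  assumes [measurable]: "f \<in> borel_measurable borel"
  shows "(\<integral>\<^sup>+x. f x \<partial>\<pi> z) = (\<integral>\<^sup>+x. ennreal (w x / z x) * f x \<partial>\<nu>) / norm_const E ybar \<nu> z"
proof -
  note [measurable_cong] = sets_nu
  have "(\<integral>\<^sup>+x. f x \<partial>\<pi> z) = (\<integral>\<^sup>+x. ennreal (w x / z x / nc z) * f x \<partial>\<nu>)"
    unfolding target_eq by (subst nn_integral_density) auto
  also have "\<dots> = (\<integral>\<^sup>+x. ennreal (w x / z x) * f x / ennreal (nc z) \<partial>\<nu>)"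
  proof (rule nn_integral_cong)
    fix x
    have "ennreal (w x / z x / nc z) = ennreal (w x / z x) / ennreal (nc z)"
      using nc_pos z_pos[of x] by (intro divide_ennreal[symmetric]) auto
    then show "ennreal (w x / z x / nc z) * f x = ennreal (w x / z x) * f x / ennreal (nc z)"
      by (simp only: ennreal_times_divide mult.commute)
  qed
  also have "\<dots> = (\<integral>\<^sup>+x. ennreal (w x / z x) * f x \<partial>\<nu>) / norm_const E ybar \<nu> z"
    unfolding norm_const_eq by (subst nn_integral_divide) auto
  finally show ?thesis .
qed

lemma prob_target: "prob_space (\<pi> z)"
proof (rule prob_spaceI)
  have "emeasure (\<pi> z) (space (\<pi> z)) = (\<integral>\<^sup>+x. 1 \<partial>\<pi> z)" by simp
  also have "\<dots> = norm_const E ybar \<nu> z / norm_const E ybar \<nu> z"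
    by (subst nn_integral_target) (auto simp: norm_const_def)
  also have "\<dots> = 1" unfolding norm_const_eq using nc_pos by (simp add: divide_ennreal)
  finally show "emeasure (\<pi> z) (space (\<pi> z)) = 1" .
qed

lemma integral_target:
  assumes [measurable]: "f \<in> borel_measurable borel"
  shows "(\<integral>x. f x \<partial>\<pi> z) = (\<integral>x. w x / z x * f x \<partial>\<nu>) / nc z"
proof -
  note [measurable_cong] = sets_nu
  have "(\<integral>x. f x \<partial>\<pi> z) = (\<integral>x. (w x / z x / nc z) *\<^sub>R f x \<partial>\<nu>)"
    unfolding target_eq using nc_pos z_pos by (intro integral_density) (auto simp: less_imp_le)
  also have "\<dots> = (\<integral>x. (w x / z x * f x) / nc z \<partial>\<nu>)"
    by (simp only: real_scaleR_def times_divide_eq_left)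
  also have "\<dots> = (\<integral>x. w x / z x * f x \<partial>\<nu>) / nc z" by (rule integral_divide_zero)
  finally show ?thesis .
qed

lemma integrable_target:
  assumes [measurable]: "f \<in> borel_measurable borel"
  shows "integrable (\<pi> z) f \<longleftrightarrow> integrable \<nu> (\<lambda>x. w x / z x * f x)"
proof -
  note [measurable_cong] = sets_nu
  have "integrable (\<pi> z) f \<longleftrightarrow> integrable \<nu> (\<lambda>x. (w x / z x / nc z) *\<^sub>R f x)"
    unfolding target_eq using nc_pos z_pos by (intro integrable_density) (auto simp: less_imp_le)
  also have "\<dots> \<longleftrightarrow> integrable \<nu> (\<lambda>x. (w x / z x * f x) * inverse (nc z))"
    by (simp only: real_scaleR_def divide_inverse mult_ac)
  also have "\<dots> \<longleftrightarrow> integrable \<nu> (\<lambda>x. w x / z x * f x)"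
    using nc_pos by (intro integrable_mult_right_iff[THEN trans]) simp
  finally show ?thesis .
qed

end

text \<open>\<open>\<pi> z\<close> has density proportional to \<open>zfun E \<mu> / z = 1 - q\<close> with respect to the target
  distribution.\<close>

lemma target_diff_sq_le:
  assumes z: "admissible z"
    and f[measurable]: "f \<in> borel_measurable borel" and bf: "\<And>x. \<bar>f x\<bar> \<le> B"
    and df: "\<And>x. \<bar>f x\<bar> \<le> dist x x0"
    and lz: "\<And>x. l x \<le> z x" and zu: "\<And>x. z x \<le> u x" and l: "\<And>x. 0 < l x"
  shows "ennreal (((\<integral>x. f x \<partial>\<pi> z) - (\<integral>x. f x \<partial>\<pi> (zfun E \<mu>)))\<^sup>2) \<le>
    2 * (\<integral>\<^sup>+x. (ennreal ((dist x0 x)\<^sup>2) + R1 E ybar \<nu> l u x0) *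
      ennreal (((z x - zfun E \<mu> x) / z x)\<^sup>2) \<partial>\<pi> (zfun E \<mu>))"
proof -
  define zs where "zs = zfun E \<mu>"
  have zs: "admissible zs" unfolding zs_def by (rule admissible_zstar)
  define q where "q x = (z x - zs x) / z x" for x
  note [measurable] = z_measurable[OF z] z_measurable[OF zs]
  have [measurable]: "q \<in> borel_measurable borel" unfolding q_def[abs_def] by measurable
  note [measurable_cong] = sets_target[OF zs]
  interpret zs: prob_space "\<pi> zs" by (rule prob_target[OF zs])
  have q: "w x / zs x * (1 - q x) = w x / z x" for x
    using z_pos[OF z, of x] z_pos[OF zs, of x] by (simp add: q_def field_simps)
  have int1q: "integrable (\<pi> zs) (\<lambda>x. 1 - q x)"
  proof (subst integrable_target[OF zs])
    show "integrable \<nu> (\<lambda>x. w x / zs x * (1 - q x))" unfolding q by (rule integrable_w_z[OF z])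
  qed measurable
  \<comment> \<open>Integrability of \<open>q\<close> comes from that of \<open>1 - q\<close>, whose
    integral under the target of \<open>zs\<close> is a multiple of the integral of
    \<open>w / z\<close> under \<nu>; the ratio \<open>zs / z\<close> may be unbounded.\<close>
  have intq: "integrable (\<pi> zs) q"
    using Bochner_Integration.integrable_diff[OF zs.integrable_const[of 1] int1q]
    by (simp only: diff_diff_eq2 add_diff_cancel_left' diff_add_cancel)
  have intf: "integrable (\<pi> zs) f"
    using bf by (intro zs.integrable_const_bound[where B=B]) auto
  have intfq: "integrable (\<pi> zs) (\<lambda>x. f x * q x)"
  proof (rule Bochner_Integration.integrable_bound)
    show "integrable (\<pi> zs) (\<lambda>x. B * q x)" using intq by simp
    have "\<bar>f x\<bar> * \<bar>q x\<bar> \<le> \<bar>B\<bar> * \<bar>q x\<bar>" for x using bf[of x] by (intro mult_right_mono) auto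
    then show "AE x in \<pi> zs. norm (f x * q x) \<le> norm (B * q x)" by (simp add: abs_mult)
  qed measurable
  define a where "a = (\<integral>x. f x \<partial>\<pi> z)"
  define b where "b = (\<integral>x. f x \<partial>\<pi> zs)"
  define r where "r = (\<integral>x. q x \<partial>\<pi> zs)"
  define s where "s = (\<integral>x. f x * q x \<partial>\<pi> zs)"
  have e1: "1 - r = nc z / nc zs"
  proof -
    have "1 - r = (\<integral>x. 1 - q x \<partial>\<pi> zs)" unfolding r_def using intq by (simp add: zs.prob_space)
    also have "\<dots> = (\<integral>x. w x / zs x * (1 - q x) \<partial>\<nu>) / nc zs" by (rule integral_target[OF zs]) measurable
    finally show ?thesis by (simp only: q nc_def[of z])
  qed
  have e2: "b - s = a * nc z / nc zs"
  proof -
    have "b - s = (\<integral>x. f x - f x * q x \<partial>\<pi> zs)" unfolding b_def s_def using intf intfq by simp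
    also have "\<dots> = (\<integral>x. w x / zs x * (f x - f x * q x) \<partial>\<nu>) / nc zs"
      by (rule integral_target[OF zs]) measurable
    also have "(\<lambda>x. w x / zs x * (f x - f x * q x)) = (\<lambda>x. w x / z x * f x)"
    proof
      fix x
      have "w x / zs x * (f x - f x * q x) = w x / zs x * (1 - q x) * f x" by (simp add: algebra_simps)
      then show "w x / zs x * (f x - f x * q x) = w x / z x * f x" by (simp only: q)
    qed
    also have "(\<integral>x. w x / z x * f x \<partial>\<nu>) = a * nc z"
      unfolding a_def using nc_pos[OF z] by (subst integral_target[OF z]) auto
    finally show ?thesis .
  qed
  \<comment> \<open>\<open>e1\<close> and \<open>e2\<close> contain the same factor
    \<open>nc z / nc zs\<close>, which cancels. The resulting identity
    \<open>a - b = a * r - s\<close> has \<open>r\<close> and \<open>s\<close> linear in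
    \<open>q\<close>, so no quotient of normalizing constants has to be estimated.\<close>
  have "b - s = a * (1 - r)" unfolding e1 e2 by simp
  then have ab: "a - b = a * r - s" by (simp add: algebra_simps)
  have sq2: "(a - b)\<^sup>2 \<le> 2 * (a\<^sup>2 * r\<^sup>2) + 2 * s\<^sup>2"
  proof -
    have "0 \<le> (a * r + s)\<^sup>2" by simp
    then show ?thesis unfolding ab by (simp add: power2_eq_square algebra_simps)
  qed
  \<comment> \<open>Here \<open>R1\<close> arises: with \<open>l \<le> z \<le> u\<close> the
    numerator of a second moment under \<open>\<pi> z\<close> is enlarged by means of
    \<open>l\<close> and its normalizing constant is reduced by means of \<open>u\<close>, which
    bounds \<open>a\<^sup>2\<close> uniformly in \<open>z\<close>.\<close>
  have a2: "ennreal (a\<^sup>2) \<le> R1 E ybar \<nu> l u x0"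
  proof -
    have "ennreal (a\<^sup>2) \<le> (\<integral>\<^sup>+x. ennreal ((f x)\<^sup>2) \<partial>\<pi> z)"
      unfolding a_def by (rule jensen_sq[OF prob_target[OF z]]) (simp cong: measurable_cong_sets add: sets_target[OF z])
    also have "\<dots> = (\<integral>\<^sup>+x. ennreal (w x / z x) * ennreal ((f x)\<^sup>2) \<partial>\<nu>) / norm_const E ybar \<nu> z"
      by (rule nn_integral_target[OF z]) measurable
    also have "\<dots> \<le> (\<integral>\<^sup>+x. ennreal ((dist x x0)\<^sup>2 * exp (- E ybar x) / l x) \<partial>\<nu>) /
        (\<integral>\<^sup>+x. ennreal (exp (- E ybar x) / u x) \<partial>\<nu>)"
      unfolding divide_ennreal_def
    proof (intro mult_mono inverse_antimono_ennreal nn_integral_mono)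
      fix x
      have "w x / z x * (f x)\<^sup>2 \<le> w x / l x * (dist x x0)\<^sup>2"
        using lz[of x] l[of x] df[of x] z_pos[OF z, of x]
        by (intro mult_mono divide_left_mono power2_le_iff_abs_le[THEN iffD2]) auto
      then show "ennreal (w x / z x) * ennreal ((f x)\<^sup>2) \<le> ennreal ((dist x x0)\<^sup>2 * w x / l x)"
        using z_pos[OF z, of x] by (simp add: mult.commute less_imp_le ennreal_leI flip: ennreal_mult)
    next
      show "(\<integral>\<^sup>+x. ennreal (w x / u x) \<partial>\<nu>) \<le> norm_const E ybar \<nu> z"
        unfolding norm_const_def
      proof (intro nn_integral_mono ennreal_leI divide_left_mono zu)
        show "0 < u x * z x" for x
          using z_pos[OF z, of x] zu[of x] by (intro mult_pos_pos) auto
      qed auto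
    qed auto
    also have "\<dots> = R1 E ybar \<nu> l u x0" by (simp add: R1_def)
    finally show ?thesis .
  qed
  have r2: "ennreal (r\<^sup>2) \<le> (\<integral>\<^sup>+x. ennreal ((q x)\<^sup>2) \<partial>\<pi> zs)"
    unfolding r_def by (rule jensen_sq) (auto intro: prob_target[OF zs])
  have s2: "ennreal (s\<^sup>2) \<le> (\<integral>\<^sup>+x. ennreal ((dist x0 x)\<^sup>2) * ennreal ((q x)\<^sup>2) \<partial>\<pi> zs)"
  proof -
    have "ennreal (s\<^sup>2) \<le> (\<integral>\<^sup>+x. ennreal ((f x * q x)\<^sup>2) \<partial>\<pi> zs)"
      unfolding s_def by (rule jensen_sq) (auto intro: prob_target[OF zs])
    also have "\<dots> \<le> (\<integral>\<^sup>+x. ennreal ((dist x0 x)\<^sup>2) * ennreal ((q x)\<^sup>2) \<partial>\<pi> zs)"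
    proof (rule nn_integral_mono)
      fix x
      have "(f x)\<^sup>2 \<le> (dist x0 x)\<^sup>2"
        using df[of x] by (simp add: power2_le_iff_abs_le dist_commute)
      then show "ennreal ((f x * q x)\<^sup>2) \<le> ennreal ((dist x0 x)\<^sup>2) * ennreal ((q x)\<^sup>2)"
        by (auto simp: power_mult_distrib simp flip: ennreal_mult intro!: ennreal_leI mult_right_mono)
    qed
    finally show ?thesis .
  qed
  have "ennreal ((a - b)\<^sup>2) \<le> ennreal (2 * (a\<^sup>2 * r\<^sup>2) + 2 * s\<^sup>2)"
    using sq2 by (rule ennreal_leI)
  also have "\<dots> = 2 * (ennreal (a\<^sup>2) * ennreal (r\<^sup>2) + ennreal (s\<^sup>2))"
    by (simp add: ennreal_plus ennreal_mult distrib_left)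
  also have "\<dots> \<le> 2 * (R1 E ybar \<nu> l u x0 * (\<integral>\<^sup>+x. ennreal ((q x)\<^sup>2) \<partial>\<pi> zs) +
      (\<integral>\<^sup>+x. ennreal ((dist x0 x)\<^sup>2) * ennreal ((q x)\<^sup>2) \<partial>\<pi> zs))"
    using a2 r2 s2 by (intro mult_left_mono add_mono mult_mono) auto
  also have "\<dots> = 2 * (\<integral>\<^sup>+x. (ennreal ((dist x0 x)\<^sup>2) + R1 E ybar \<nu> l u x0) *
      ennreal ((q x)\<^sup>2) \<partial>\<pi> zs)"
    by (simp add: distrib_right nn_integral_add nn_integral_cmult add.commute)
  finally show ?thesis unfolding a_def b_def q_def zs_def .
qed

section \<open>Mean square bias for a random normalizing function\<close>

context
  fixes M :: "'w measure" and \<zeta> :: "'w \<Rightarrow> 'x \<Rightarrow> real"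
  assumes M: "prob_space M"
    and \<zeta>[measurable]: "(\<lambda>(\<omega>, x). \<zeta> \<omega> x) \<in> borel_measurable (M \<Otimes>\<^sub>M borel)"
    and adm: "\<And>\<omega>. \<omega> \<in> space M \<Longrightarrow> admissible (\<zeta> \<omega>)"
begin

text \<open>The target mean is a quotient of integrals over the fixed measure \<nu> with integrands
  jointly measurable in \<open>\<omega>\<close> and \<open>x\<close>, so its measurability is that
  of parameter integrals.\<close>

lemma measurable_target_integral:
  fixes f :: "'x \<Rightarrow> real"
  assumes f[measurable]: "f \<in> borel_measurable borel"
  shows "(\<lambda>\<omega>. \<integral>x. f x \<partial>\<pi> (\<zeta> \<omega>)) \<in> borel_measurable M"
proof (subst measurable_cong)
  show "\<omega> \<in> space M \<Longrightarrow>
      (\<integral>x. f x \<partial>\<pi> (\<zeta> \<omega>)) = (\<integral>x. w x / \<zeta> \<omega> x * f x \<partial>\<nu>) / (\<integral>x. w x / \<zeta> \<omega> x \<partial>\<nu>)" for \<omega>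
    using integral_target[OF adm f] by (simp add: nc_def)
  note [measurable_cong] = sets_nu
  show "(\<lambda>\<omega>. (\<integral>x. w x / \<zeta> \<omega> x * f x \<partial>\<nu>) / (\<integral>x. w x / \<zeta> \<omega> x \<partial>\<nu>)) \<in> borel_measurable M"
    by (intro borel_measurable_divide nu.borel_measurable_lebesgue_integral) measurable
qed

lemma measurable_ecc:
  assumes X[measurable]: "X \<in> M \<rightarrow>\<^sub>M borel"
  shows "(\<lambda>\<omega>. ecc \<pi> (\<zeta> \<omega>) (X \<omega>)) \<in> borel_measurable M"
proof (subst measurable_cong)
  show "\<omega> \<in> space M \<Longrightarrow>
      ecc \<pi> (\<zeta> \<omega>) (X \<omega>) =
      (\<integral>\<^sup>+x. ennreal (w x / \<zeta> \<omega> x) * ennreal (dist (X \<omega>) x) \<partial>\<nu>) /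
      (\<integral>\<^sup>+x. ennreal (w x / \<zeta> \<omega> x) \<partial>\<nu>)" for \<omega>
    unfolding ecc_def by (subst nn_integral_target[OF adm]) (auto simp: norm_const_def)
  note [measurable_cong] = sets_nu
  show "(\<lambda>\<omega>. (\<integral>\<^sup>+x. ennreal (w x / \<zeta> \<omega> x) * ennreal (dist (X \<omega>) x) \<partial>\<nu>) /
      (\<integral>\<^sup>+x. ennreal (w x / \<zeta> \<omega> x) \<partial>\<nu>)) \<in> borel_measurable M"
    by (intro borel_measurable_divide_ennreal nu.borel_measurable_nn_integral) measurable
qed

text \<open>As \<open>l\<close> and \<open>u\<close> need not be measurable, the integral on the right is only a lower integral;
  it is compared with measurable integrands by monotonicity alone.\<close>

lemma target_bias_le:
  assumes f[measurable]: "f \<in> borel_measurable borel" and bf: "\<And>x. \<bar>f x\<bar> \<le> B"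
    and df: "\<And>x. \<bar>f x\<bar> \<le> dist x x0"
    and lz: "\<And>\<omega> x. \<omega> \<in> space M \<Longrightarrow> l x \<le> \<zeta> \<omega> x"
    and zu: "\<And>\<omega> x. \<omega> \<in> space M \<Longrightarrow> \<zeta> \<omega> x \<le> u x"
    and l: "\<And>x. 0 < l x" and n: "1 \<le> n"
    and var: "\<And>x. (\<integral>\<^sup>+\<omega>. ennreal ((\<zeta> \<omega> x - zfun E \<mu> x)\<^sup>2) \<partial>M) \<le> ennreal ((u x)\<^sup>2 / real n)"
  shows "(\<integral>\<^sup>+\<omega>. ennreal (((\<integral>x. f x \<partial>\<pi> (\<zeta> \<omega>)) - (\<integral>x. f x \<partial>\<pi> (zfun E \<mu>)))\<^sup>2) \<partial>M) \<le>
    ennreal (2 / real n) * (\<integral>\<^sup>+x. (ennreal ((dist x0 x)\<^sup>2) + R1 E ybar \<nu> l u x0) *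
      ennreal ((u x)\<^sup>2 / (l x)\<^sup>2) \<partial>\<pi> (zfun E \<mu>))"
proof -
  define zs where "zs = zfun E \<mu>"
  have zs: "admissible zs" unfolding zs_def by (rule admissible_zstar)
  note [measurable] = z_measurable[OF zs]
  note [measurable_cong] = sets_target[OF zs]
  interpret M: prob_space M by fact
  interpret zs: prob_space "\<pi> zs" by (rule prob_target[OF zs])
  interpret pair_sigma_finite M "\<pi> zs" ..
  define g where "g x = ennreal ((dist x0 x)\<^sup>2) + R1 E ybar \<nu> l u x0" for x
  define Q where "Q \<omega> x = ennreal (((\<zeta> \<omega> x - zs x) / \<zeta> \<omega> x)\<^sup>2)" for \<omega> x
  define V where "V x = (\<integral>\<^sup>+\<omega>. Q \<omega> x \<partial>M)" for x
  have [measurable]: "g \<in> borel_measurable borel" unfolding g_def[abs_def] by measurable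
  have [measurable]: "(\<lambda>(\<omega>, x). Q \<omega> x) \<in> borel_measurable (M \<Otimes>\<^sub>M borel)"
    unfolding Q_def[abs_def] by measurable
  have [measurable]: "V \<in> borel_measurable borel"
    unfolding V_def[abs_def] by (rule M.borel_measurable_nn_integral) measurable
  \<comment> \<open>Bounding the denominator from below by \<open>l\<close> leaves the mean square
    error at the single point \<open>x\<close>, to which \<open>var\<close> applies. The factor
    \<open>n\<close> stands on the left so that the right-hand side is exactly the weight in
    \<open>Rbound\<close>.\<close>
  have V_le: "of_nat n * V x \<le> ennreal ((u x)\<^sup>2 / (l x)\<^sup>2)" for x
  proof -
    have "V x \<le> (\<integral>\<^sup>+\<omega>. ennreal ((\<zeta> \<omega> x - zs x)\<^sup>2) * ennreal (1 / (l x)\<^sup>2) \<partial>M)"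
      unfolding V_def Q_def
    proof (rule nn_integral_mono)
      fix \<omega> assume \<omega>: "\<omega> \<in> space M"
      have "(l x)\<^sup>2 \<le> (\<zeta> \<omega> x)\<^sup>2" using lz[OF \<omega>, of x] l[of x] by (intro power_mono) auto
      then have "(\<zeta> \<omega> x - zs x)\<^sup>2 / (\<zeta> \<omega> x)\<^sup>2 \<le> (\<zeta> \<omega> x - zs x)\<^sup>2 / (l x)\<^sup>2"
        using lz[OF \<omega>, of x] l[of x] by (intro divide_left_mono) auto
      then show "ennreal (((\<zeta> \<omega> x - zs x) / \<zeta> \<omega> x)\<^sup>2) \<le> ennreal ((\<zeta> \<omega> x - zs x)\<^sup>2) * ennreal (1 / (l x)\<^sup>2)"
        by (simp add: power_divide ennreal_leI flip: ennreal_mult)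
    qed
    also have "\<dots> = (\<integral>\<^sup>+\<omega>. ennreal ((\<zeta> \<omega> x - zs x)\<^sup>2) \<partial>M) * ennreal (1 / (l x)\<^sup>2)"
      by (rule nn_integral_multc) measurable
    also have "\<dots> \<le> ennreal ((u x)\<^sup>2 / real n) * ennreal (1 / (l x)\<^sup>2)"
      using var[of x] unfolding zs_def by (rule mult_right_mono) simp
    finally have "of_nat n * V x \<le> ennreal (real n) * (ennreal ((u x)\<^sup>2 / real n) * ennreal (1 / (l x)\<^sup>2))"
      unfolding ennreal_of_nat_eq_real_of_nat by (rule mult_left_mono) simp
    also have "\<dots> = ennreal (real n * ((u x)\<^sup>2 / real n * (1 / (l x)\<^sup>2)))"
      by (subst ennreal_mult[symmetric], simp, simp)+ simp
    also have "real n * ((u x)\<^sup>2 / real n * (1 / (l x)\<^sup>2)) = (u x)\<^sup>2 / (l x)\<^sup>2" using n by simp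
    finally show ?thesis .
  qed
  have "(\<integral>\<^sup>+\<omega>. ennreal (((\<integral>x. f x \<partial>\<pi> (\<zeta> \<omega>)) - (\<integral>x. f x \<partial>\<pi> zs))\<^sup>2) \<partial>M) \<le>
      (\<integral>\<^sup>+\<omega>. 2 * (\<integral>\<^sup>+x. g x * Q \<omega> x \<partial>\<pi> zs) \<partial>M)"
  proof (rule nn_integral_mono)
    fix \<omega> assume \<omega>: "\<omega> \<in> space M"
    show "ennreal (((\<integral>x. f x \<partial>\<pi> (\<zeta> \<omega>)) - (\<integral>x. f x \<partial>\<pi> zs))\<^sup>2) \<le> 2 * (\<integral>\<^sup>+x. g x * Q \<omega> x \<partial>\<pi> zs)"
      unfolding g_def Q_def zs_def
      by (rule target_diff_sq_le[OF adm[OF \<omega>] f bf df lz[OF \<omega>] zu[OF \<omega>] l])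
  qed
  also have "\<dots> = 2 * (\<integral>\<^sup>+\<omega>. \<integral>\<^sup>+x. g x * Q \<omega> x \<partial>\<pi> zs \<partial>M)"
    by (rule nn_integral_cmult) measurable
  also have "(\<integral>\<^sup>+\<omega>. \<integral>\<^sup>+x. g x * Q \<omega> x \<partial>\<pi> zs \<partial>M) = (\<integral>\<^sup>+x. \<integral>\<^sup>+\<omega>. g x * Q \<omega> x \<partial>M \<partial>\<pi> zs)"
    by (rule Fubini'[symmetric]) measurable
  also have "\<dots> = (\<integral>\<^sup>+x. g x * V x \<partial>\<pi> zs)"
    unfolding V_def by (intro nn_integral_cong nn_integral_cmult) measurable
  \<comment> \<open>The factor \<open>1 / n\<close> is taken out while the integrand is still built
    from the measurable \<open>V\<close>; the weight made of \<open>u\<close> and \<open>l\<close>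
    enters only afterwards.\<close>
  also have "\<dots> = (\<integral>\<^sup>+x. ennreal (1 / real n) * (g x * (of_nat n * V x)) \<partial>\<pi> zs)"
  proof (rule nn_integral_cong)
    fix x
    have "ennreal (1 / real n) * of_nat n = 1"
      using n unfolding ennreal_of_nat_eq_real_of_nat by (simp flip: ennreal_mult)
    then have "g x * V x = (ennreal (1 / real n) * of_nat n) * (g x * V x)" by simp
    also have "\<dots> = ennreal (1 / real n) * (g x * (of_nat n * V x))" by (simp only: mult_ac)
    finally show "g x * V x = ennreal (1 / real n) * (g x * (of_nat n * V x))" .
  qed
  also have "\<dots> = ennreal (1 / real n) * (\<integral>\<^sup>+x. g x * (of_nat n * V x) \<partial>\<pi> zs)"
    by (rule nn_integral_cmult) measurable
  also have "\<dots> \<le> ennreal (1 / real n) * (\<integral>\<^sup>+x. g x * ennreal ((u x)\<^sup>2 / (l x)\<^sup>2) \<partial>\<pi> zs)"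
    using V_le by (intro mult_left_mono nn_integral_mono) auto
  finally have "(\<integral>\<^sup>+\<omega>. ennreal (((\<integral>x. f x \<partial>\<pi> (\<zeta> \<omega>)) - (\<integral>x. f x \<partial>\<pi> zs))\<^sup>2) \<partial>M) \<le>
      2 * (ennreal (1 / real n) * (\<integral>\<^sup>+x. g x * ennreal ((u x)\<^sup>2 / (l x)\<^sup>2) \<partial>\<pi> zs))"
    by (simp add: mult_left_mono)
  also have "\<dots> = ennreal (2 / real n) * (\<integral>\<^sup>+x. g x * ennreal ((u x)\<^sup>2 / (l x)\<^sup>2) \<partial>\<pi> zs)"
  proof -
    have "2 * ennreal (1 / real n) = ennreal (2 / real n)"
      using ennreal_mult[of 2 "1 / real n"] by simp
    then show ?thesis by (simp only: mult.assoc[symmetric])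
  qed
  finally show ?thesis unfolding g_def zs_def .
qed

end

end

section \<open>Conditionally sampled variables\<close>

text \<open>The integral is rewritten over the image of \<open>L x\<close> under
  \<open>y \<mapsto> (x, y)\<close>. This image is a kernel into the product space, and the
  integrand on the product no longer depends on \<open>x\<close>.\<close>

lemma integral_measurable_kernel:
  fixes f :: "'a \<Rightarrow> 'b \<Rightarrow> real"
  assumes f[measurable]: "(\<lambda>(x, y). f x y) \<in> borel_measurable (M \<Otimes>\<^sub>M N)"
    and L[measurable]: "L \<in> M \<rightarrow>\<^sub>M subprob_algebra N"
  shows "(\<lambda>x. \<integral>y. f x y \<partial>L x) \<in> borel_measurable M"
proof -
  note [measurable] = measurable_distr2
  have "(\<lambda>x. \<integral>p. (\<lambda>(x, y). f x y) p \<partial>distr (L x) (M \<Otimes>\<^sub>M N) (\<lambda>y. (x, y))) \<in> borel_measurable M"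
    by measurable
  then show ?thesis
  proof (rule measurable_cong[THEN iffD1, rotated])
    fix x assume x: "x \<in> space M"
    have "(\<lambda>y. (x, y)) \<in> L x \<rightarrow>\<^sub>M M \<Otimes>\<^sub>M N"
      using x sets_kernel[OF L x] by (simp cong: measurable_cong_sets)
    from integral_distr[OF this f]
    show "(\<integral>p. (\<lambda>(x, y). f x y) p \<partial>distr (L x) (M \<Otimes>\<^sub>M N) (\<lambda>y. (x, y))) = (\<integral>y. f x y \<partial>L x)"
      by simp
  qed
qed

text \<open>Measurability is required jointly in parameter and state, because the parameter will be
  the random \<open>Z i\<close>. The recursion therefore keeps \<open>fst p\<close> as a coordinate
  while the state is integrated out.\<close>

lemma measurable_kernel_op_pow:
  fixes K :: "'z \<times> 'x::topological_space \<Rightarrow> 'x measure"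
  assumes K[measurable]: "K \<in> ZM \<Otimes>\<^sub>M borel \<rightarrow>\<^sub>M prob_algebra borel"
    and f: "f \<in> borel_measurable borel"
  shows "(\<lambda>p. (kernel_op (\<lambda>x. K (fst p, x)) ^^ k) f (snd p)) \<in> borel_measurable (ZM \<Otimes>\<^sub>M borel)"
proof (induction k)
  case 0
  show ?case unfolding funpow.simps id_apply by (rule measurable_compose[OF measurable_snd f])
next
  case (Suc k)
  have "(\<lambda>p. \<integral>y. (kernel_op (\<lambda>x. K (fst p, x)) ^^ k) f y \<partial>K p) \<in> borel_measurable (ZM \<Otimes>\<^sub>M borel)"
  proof (rule integral_measurable_kernel[where N=borel])
    show "K \<in> ZM \<Otimes>\<^sub>M borel \<rightarrow>\<^sub>M subprob_algebra borel" by (rule measurable_prob_algebraD[OF K])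
    have "(\<lambda>q. (fst (fst q), snd q)) \<in> (ZM \<Otimes>\<^sub>M borel) \<Otimes>\<^sub>M borel \<rightarrow>\<^sub>M ZM \<Otimes>\<^sub>M borel" by measurable
    from measurable_compose[OF this Suc]
    show "(\<lambda>(p, y). (kernel_op (\<lambda>x. K (fst p, x)) ^^ k) f y) \<in> borel_measurable ((ZM \<Otimes>\<^sub>M borel) \<Otimes>\<^sub>M borel)"
      by (simp add: case_prod_beta')
  qed
  then show ?case by (simp add: kernel_op_def[of _ "(_ ^^ k) f"])
qed

text \<open>\<open>\<kappa> \<omega>\<close> plays the role of a regular conditional distribution of
  \<open>X'\<close> given \<open>H\<close>. The hypothesis \<open>cond\<close> is an almost sure
  identity for each single \<open>A\<close>, with an exceptional set that depends on
  \<open>A\<close>; the lemmas below turn it into identities for integrals of functions of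
  \<open>(\<omega>, X' \<omega>)\<close>.\<close>

locale cond_sampled = prob_space M for M :: "'w measure" +
  fixes H :: "'w measure" and X' :: "'w \<Rightarrow> 'x::{metric_space, second_countable_topology}"
    and \<kappa> :: "'w \<Rightarrow> 'x measure"
  assumes sub: "subalgebra M H"
    and X'[measurable]: "X' \<in> M \<rightarrow>\<^sub>M borel"
    and \<kappa>: "\<kappa> \<in> H \<rightarrow>\<^sub>M prob_algebra borel"
    and cond: "\<And>A. A \<in> sets borel \<Longrightarrow>
      AE \<omega> in M. real_cond_exp M H (indicator (X' -` A)) \<omega> = measure (\<kappa> \<omega>) A"
begin

lemma space_H: "space H = space M" using sub by (simp add: subalgebra_def)

lemma prob_\<kappa>:
  assumes "\<omega> \<in> space M"
  shows "prob_space (\<kappa> \<omega>)" "sets (\<kappa> \<omega>) = sets borel"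
  using prob_kernel[OF \<kappa>, of \<omega>] assms by (auto simp: space_H)

lemma \<kappa>_subprob: "\<kappa> \<in> H \<rightarrow>\<^sub>M subprob_algebra borel" by (rule measurable_prob_algebraD[OF \<kappa>])

lemma from_H: "f \<in> H \<rightarrow>\<^sub>M N \<Longrightarrow> f \<in> M \<rightarrow>\<^sub>M N"
  using sub by (rule measurable_from_subalg)

lemma ident_H: "(\<lambda>\<omega>. \<omega>) \<in> M \<rightarrow>\<^sub>M H"
  by (rule from_H) simp

text \<open>The law of a pair whose first entry is drawn from \<open>M\<close> restricted to
  \<open>H\<close> and whose second entry is drawn from \<open>\<kappa>\<close>. Keeping the whole
  sample point as first entry, measured by \<open>H\<close>, admits every
  \<open>H\<close>-measurable dependence of the integrand.\<close>

definition joint :: "('w \<times> 'x) measure" where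
  "joint = restr_to_subalg M H \<bind> (\<lambda>\<omega>. \<kappa> \<omega> \<bind> (\<lambda>x. return (H \<Otimes>\<^sub>M borel) (\<omega>, x)))"

lemma joint_kernel:
  "(\<lambda>\<omega>. \<kappa> \<omega> \<bind> (\<lambda>x. return (H \<Otimes>\<^sub>M borel) (\<omega>, x))) \<in>
    restr_to_subalg M H \<rightarrow>\<^sub>M subprob_algebra (H \<Otimes>\<^sub>M borel)"
proof -
  have "(\<lambda>\<omega>. \<kappa> \<omega> \<bind> (\<lambda>x. return (H \<Otimes>\<^sub>M borel) (\<omega>, x))) \<in> H \<rightarrow>\<^sub>M subprob_algebra (H \<Otimes>\<^sub>M borel)"
    by (rule measurable_bind[OF \<kappa>_subprob]) measurable
  then show ?thesis by (simp cong: measurable_cong_sets add: sets_restr_to_subalg[OF sub])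
qed

lemma sets_joint: "sets joint = sets (H \<Otimes>\<^sub>M borel)"
  unfolding joint_def using not_empty
  by (intro sets_bind[OF sets_kernel[OF joint_kernel]]) (auto simp: space_restr_to_subalg)

lemma nn_integral_joint:
  assumes \<phi>: "\<phi> \<in> borel_measurable (H \<Otimes>\<^sub>M borel)"
  shows "(\<integral>\<^sup>+p. \<phi> p \<partial>joint) = (\<integral>\<^sup>+\<omega>. \<integral>\<^sup>+x. \<phi> (\<omega>, x) \<partial>\<kappa> \<omega> \<partial>M)"
proof -
  have m: "(\<lambda>\<omega>. \<integral>\<^sup>+x. \<phi> (\<omega>, x) \<partial>\<kappa> \<omega>) \<in> borel_measurable H"
    using \<phi> by (intro nn_integral_measurable_subprob_algebra2[OF _ \<kappa>_subprob]) simp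
  have "(\<integral>\<^sup>+p. \<phi> p \<partial>joint) =
      (\<integral>\<^sup>+\<omega>. \<integral>\<^sup>+p. \<phi> p \<partial>(\<kappa> \<omega> \<bind> (\<lambda>x. return (H \<Otimes>\<^sub>M borel) (\<omega>, x))) \<partial>restr_to_subalg M H)"
    unfolding joint_def by (rule nn_integral_bind[OF \<phi> joint_kernel])
  also have "\<dots> = (\<integral>\<^sup>+\<omega>. \<integral>\<^sup>+x. \<phi> (\<omega>, x) \<partial>\<kappa> \<omega> \<partial>restr_to_subalg M H)"
  proof (rule nn_integral_cong)
    fix \<omega> assume "\<omega> \<in> space (restr_to_subalg M H)"
    then have \<omega>: "\<omega> \<in> space M" by (simp add: space_restr_to_subalg)
    have "(\<lambda>x. return (H \<Otimes>\<^sub>M borel) (\<omega>, x)) \<in> \<kappa> \<omega> \<rightarrow>\<^sub>M subprob_algebra (H \<Otimes>\<^sub>M borel)"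
      using \<omega> prob_\<kappa>(2)[OF \<omega>]
      by (intro measurable_compose[OF _ return_measurable]) (simp cong: measurable_cong_sets add: space_H)
    then have "(\<integral>\<^sup>+p. \<phi> p \<partial>(\<kappa> \<omega> \<bind> (\<lambda>x. return (H \<Otimes>\<^sub>M borel) (\<omega>, x)))) =
        (\<integral>\<^sup>+x. \<integral>\<^sup>+p. \<phi> p \<partial>return (H \<Otimes>\<^sub>M borel) (\<omega>, x) \<partial>\<kappa> \<omega>)"
      by (rule nn_integral_bind[OF \<phi>])
    also have "\<dots> = (\<integral>\<^sup>+x. \<phi> (\<omega>, x) \<partial>\<kappa> \<omega>)"
      using \<omega> \<phi> by (intro nn_integral_cong nn_integral_return) (auto simp: space_pair_measure space_H)
    finally show "(\<integral>\<^sup>+p. \<phi> p \<partial>(\<kappa> \<omega> \<bind> (\<lambda>x. return (H \<Otimes>\<^sub>M borel) (\<omega>, x)))) =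
        (\<integral>\<^sup>+x. \<phi> (\<omega>, x) \<partial>\<kappa> \<omega>)" .
  qed
  also have "\<dots> = (\<integral>\<^sup>+\<omega>. \<integral>\<^sup>+x. \<phi> (\<omega>, x) \<partial>\<kappa> \<omega> \<partial>M)"
    by (rule nn_integral_subalgebra2[OF sub m])
  finally show ?thesis .
qed

text \<open>On a rectangle \<open>F \<times> A\<close> the identity is the defining property of the
  conditional expectation, integrated over \<open>F\<close>. Rectangles are stable under
  intersection and generate the product, so the exceptional sets for different \<open>A\<close>
  never have to be united.\<close>

lemma distr_eq_joint: "distr M (H \<Otimes>\<^sub>M borel) (\<lambda>\<omega>. (\<omega>, X' \<omega>)) = joint"
proof (rule measure_eqI_generator_eq[where
      E="{F \<times> A |F A. F \<in> sets H \<and> A \<in> sets borel}" and \<Omega>="space H \<times> space borel" and A="\<lambda>_. space H \<times> space borel"])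
  note [measurable] = ident_H
  have pair[measurable]: "(\<lambda>\<omega>. (\<omega>, X' \<omega>)) \<in> M \<rightarrow>\<^sub>M H \<Otimes>\<^sub>M borel" by measurable
  show "Int_stable {F \<times> A |F A. F \<in> sets H \<and> A \<in> sets (borel :: 'x measure)}"
    by (rule Int_stable_pair_measure_generator)
  show "{F \<times> A |F A. F \<in> sets H \<and> A \<in> sets (borel :: 'x measure)} \<subseteq> Pow (space H \<times> space borel)"
    by (rule pair_measure_closed)
  show "sets (distr M (H \<Otimes>\<^sub>M borel) (\<lambda>\<omega>. (\<omega>, X' \<omega>))) =
      sigma_sets (space H \<times> space borel) {F \<times> A |F A. F \<in> sets H \<and> A \<in> sets borel}"
    by (simp add: sets_pair_measure)
  show "sets joint = sigma_sets (space H \<times> space borel) {F \<times> A |F A. F \<in> sets H \<and> A \<in> sets borel}"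
    by (simp add: sets_joint sets_pair_measure)
  show "range (\<lambda>_::nat. space H \<times> space borel) \<subseteq> {F \<times> A |F A. F \<in> sets H \<and> A \<in> sets (borel :: 'x measure)}"
    using sets.top[of H] sets.top[of "borel :: 'x measure"] by blast
  show "(\<Union>i::nat. space H \<times> space (borel :: 'x measure)) = space H \<times> space borel" by simp
  interpret D: prob_space "distr M (H \<Otimes>\<^sub>M borel) (\<lambda>\<omega>. (\<omega>, X' \<omega>))"
    by (rule prob_space_distr) measurable
  show "emeasure (distr M (H \<Otimes>\<^sub>M borel) (\<lambda>\<omega>. (\<omega>, X' \<omega>))) (space H \<times> space borel) \<noteq> \<infinity>" for i :: nat
    by (simp add: D.emeasure_eq_measure)
next
  fix S assume "S \<in> {F \<times> A |F A. F \<in> sets H \<and> A \<in> sets (borel :: 'x measure)}"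
  then obtain F A where S: "S = F \<times> A" and F: "F \<in> sets H" and A[measurable]: "A \<in> sets borel" by auto
  have FM[measurable]: "F \<in> sets M" using F sub by (auto simp: subalgebra_def)
  note [measurable] = ident_H
  have pair[measurable]: "(\<lambda>\<omega>. (\<omega>, X' \<omega>)) \<in> M \<rightarrow>\<^sub>M H \<Otimes>\<^sub>M borel" by measurable
  have Sm: "S \<in> sets (H \<Otimes>\<^sub>M borel)" unfolding S using F A by simp
  interpret finite_measure_subalgebra M H
    using sub by unfold_locales
  have XA: "X' -` A \<inter> space M \<in> sets M" by measurable
  have ind: "integrable M (indicator (X' -` A) :: 'w \<Rightarrow> real)"
  proof (rule integrable_const_bound[where B=1])
    have "(indicator (X' -` A) :: 'w \<Rightarrow> real) = (\<lambda>\<omega>. indicator A (X' \<omega>))"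
      by (auto simp: indicator_def)
    then show "(indicator (X' -` A) :: 'w \<Rightarrow> real) \<in> borel_measurable M" by simp
  qed (auto simp: indicator_def)
  have m\<kappa>: "(\<lambda>\<omega>. measure (\<kappa> \<omega>) A) \<in> borel_measurable M"
    using A \<kappa> by (intro from_H) measurable
  have "measure M (F \<inter> (X' -` A \<inter> space M)) =
      (\<integral>\<omega>. indicator (F \<inter> (X' -` A \<inter> space M)) \<omega> \<partial>M)"
    using sets.sets_into_space[OF FM] by (simp add: Int_absorb2 Int_assoc)
  also have "\<dots> = (\<integral>\<omega>\<in>F. indicator (X' -` A) \<omega> \<partial>M)"
    unfolding set_lebesgue_integral_def
    by (intro Bochner_Integration.integral_cong) (auto simp: indicator_def)
  also have "\<dots> = (\<integral>\<omega>\<in>F. real_cond_exp M H (indicator (X' -` A)) \<omega> \<partial>M)"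
    by (rule real_cond_exp_intA[OF ind F])
  also have "\<dots> = (\<integral>\<omega>. indicator F \<omega> * measure (\<kappa> \<omega>) A \<partial>M)"
    unfolding set_lebesgue_integral_def real_scaleR_def
    using cond[OF A] m\<kappa> borel_measurable_cond_exp2
    by (intro integral_cong_AE) auto
  finally have 1: "measure M (F \<inter> (X' -` A \<inter> space M)) = (\<integral>\<omega>. indicator F \<omega> * measure (\<kappa> \<omega>) A \<partial>M)" .
  have "emeasure (distr M (H \<Otimes>\<^sub>M borel) (\<lambda>\<omega>. (\<omega>, X' \<omega>))) S = emeasure M (F \<inter> (X' -` A \<inter> space M))"
    using Sm sets.sets_into_space[OF FM] unfolding S
    by (subst emeasure_distr) (auto intro!: arg_cong[where f="emeasure M"])
  also have "\<dots> = ennreal (\<integral>\<omega>. indicator F \<omega> * measure (\<kappa> \<omega>) A \<partial>M)"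
    by (simp add: emeasure_eq_measure 1)
  also have "\<dots> = (\<integral>\<^sup>+\<omega>. ennreal (indicator F \<omega> * measure (\<kappa> \<omega>) A) \<partial>M)"
  proof (rule nn_integral_eq_integral[symmetric])
    show "integrable M (\<lambda>\<omega>. indicator F \<omega> * measure (\<kappa> \<omega>) A)"
      using m\<kappa> prob_\<kappa>(1)
      by (intro integrable_const_bound[where B=1])
         (auto simp: indicator_def prob_space.prob_le_1)
  qed auto
  also have "\<dots> = (\<integral>\<^sup>+\<omega>. \<integral>\<^sup>+x. indicator S (\<omega>, x) \<partial>\<kappa> \<omega> \<partial>M)"
  proof (rule nn_integral_cong)
    fix \<omega> assume \<omega>: "\<omega> \<in> space M"
    interpret \<kappa>: prob_space "\<kappa> \<omega>" by (rule prob_\<kappa>[OF \<omega>])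
    have "(\<integral>\<^sup>+x. indicator S (\<omega>, x) \<partial>\<kappa> \<omega>) = (\<integral>\<^sup>+x. indicator F \<omega> * indicator A x \<partial>\<kappa> \<omega>)"
      unfolding S by (simp add: indicator_times)
    also have "\<dots> = indicator F \<omega> * emeasure (\<kappa> \<omega>) A"
      using prob_\<kappa>(2)[OF \<omega>] A by (subst nn_integral_cmult_indicator) auto
    finally show "ennreal (indicator F \<omega> * measure (\<kappa> \<omega>) A) = (\<integral>\<^sup>+x. indicator S (\<omega>, x) \<partial>\<kappa> \<omega>)"
      by (simp add: \<kappa>.emeasure_eq_measure indicator_def)
  qed
  also have "\<dots> = (\<integral>\<^sup>+p. indicator S p \<partial>joint)"
    by (rule nn_integral_joint[symmetric]) (use Sm in simp)
  also have "\<dots> = emeasure joint S"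
    using Sm by (intro nn_integral_indicator) (simp add: sets_joint)
  finally show "emeasure (distr M (H \<Otimes>\<^sub>M borel) (\<lambda>\<omega>. (\<omega>, X' \<omega>))) S = emeasure joint S" .
qed

lemma nn_integral_next:
  assumes \<phi>: "\<phi> \<in> borel_measurable (H \<Otimes>\<^sub>M borel)"
  shows "(\<integral>\<^sup>+\<omega>. \<phi> (\<omega>, X' \<omega>) \<partial>M) = (\<integral>\<^sup>+\<omega>. \<integral>\<^sup>+x. \<phi> (\<omega>, x) \<partial>\<kappa> \<omega> \<partial>M)"
proof -
  note [measurable] = ident_H
  have "(\<integral>\<^sup>+\<omega>. \<phi> (\<omega>, X' \<omega>) \<partial>M) = (\<integral>\<^sup>+p. \<phi> p \<partial>distr M (H \<Otimes>\<^sub>M borel) (\<lambda>\<omega>. (\<omega>, X' \<omega>)))"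
    using \<phi> by (subst nn_integral_distr) simp_all
  then show ?thesis unfolding distr_eq_joint nn_integral_joint[OF \<phi>] .
qed

text \<open>Adding \<open>b\<close> makes the bounded integrand nonnegative, which reduces the claim
  to \<open>nn_integral_next\<close>; the constant is removed again at the end.\<close>

lemma integral_next:
  fixes \<phi> :: "'w \<times> 'x \<Rightarrow> real"
  assumes \<phi>: "\<phi> \<in> borel_measurable (H \<Otimes>\<^sub>M borel)"
    and bnd: "\<And>\<omega> x. \<omega> \<in> space M \<Longrightarrow> \<bar>\<phi> (\<omega>, x)\<bar> \<le> b"
  shows "(\<integral>\<omega>. \<phi> (\<omega>, X' \<omega>) \<partial>M) = (\<integral>\<omega>. \<integral>x. \<phi> (\<omega>, x) \<partial>\<kappa> \<omega> \<partial>M)"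
proof -
  note [measurable] = ident_H
  have m1: "(\<lambda>\<omega>. \<phi> (\<omega>, X' \<omega>)) \<in> borel_measurable M"
    by (rule measurable_compose[OF _ \<phi>]) measurable
  have m2: "(\<lambda>\<omega>. \<integral>x. \<phi> (\<omega>, x) \<partial>\<kappa> \<omega>) \<in> borel_measurable M"
    using \<phi> by (intro from_H integral_measurable_kernel[OF _ \<kappa>_subprob]) simp
  have m\<kappa>: "(\<lambda>x. \<phi> (\<omega>, x)) \<in> borel_measurable (\<kappa> \<omega>)" if "\<omega> \<in> space M" for \<omega>
  proof -
    have "(\<lambda>x. \<phi> (\<omega>, x)) \<in> borel_measurable borel"
      using that by (intro measurable_compose[OF measurable_Pair1' \<phi>]) (simp add: space_H)
    then show ?thesis using prob_\<kappa>(2)[OF that] by (simp cong: measurable_cong_sets)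
  qed
  have b2: "\<bar>\<integral>x. \<phi> (\<omega>, x) \<partial>\<kappa> \<omega>\<bar> \<le> b" if "\<omega> \<in> space M" for \<omega>
    by (rule bounded_integral_le[OF prob_\<kappa>(1)[OF that] m\<kappa>[OF that] bnd[OF that]])
  have i1: "integrable M (\<lambda>\<omega>. \<phi> (\<omega>, X' \<omega>))"
    using m1 bnd by (intro integrable_const_bound[where B=b]) auto
  have i2: "integrable M (\<lambda>\<omega>. \<integral>x. \<phi> (\<omega>, x) \<partial>\<kappa> \<omega>)"
    using m2 b2 by (intro integrable_const_bound[where B=b]) auto
  have n1: "0 \<le> \<phi> (\<omega>, x) + b" if "\<omega> \<in> space M" for \<omega> x using bnd[OF that, of x] by linarith
  have n2: "0 \<le> (\<integral>x. \<phi> (\<omega>, x) \<partial>\<kappa> \<omega>) + b" if "\<omega> \<in> space M" for \<omega> using b2[OF that] by linarith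
  have "ennreal (\<integral>\<omega>. \<phi> (\<omega>, X' \<omega>) + b \<partial>M) = (\<integral>\<^sup>+\<omega>. ennreal (\<phi> (\<omega>, X' \<omega>) + b) \<partial>M)"
    using i1 n1 by (intro nn_integral_eq_integral[symmetric] AE_I2) simp_all
  also have "\<dots> = (\<integral>\<^sup>+\<omega>. \<integral>\<^sup>+x. ennreal (\<phi> (\<omega>, x) + b) \<partial>\<kappa> \<omega> \<partial>M)"
    by (rule nn_integral_next[of "\<lambda>p. ennreal (\<phi> p + b)"])
       (rule measurable_compose[OF borel_measurable_add[OF \<phi> borel_measurable_const] measurable_ennreal])
  also have "\<dots> = (\<integral>\<^sup>+\<omega>. ennreal ((\<integral>x. \<phi> (\<omega>, x) \<partial>\<kappa> \<omega>) + b) \<partial>M)"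
  proof (rule nn_integral_cong)
    fix \<omega> assume \<omega>: "\<omega> \<in> space M"
    interpret \<kappa>: prob_space "\<kappa> \<omega>" by (rule prob_\<kappa>[OF \<omega>])
    have i: "integrable (\<kappa> \<omega>) (\<lambda>x. \<phi> (\<omega>, x))"
      using m\<kappa>[OF \<omega>] bnd[OF \<omega>] by (intro \<kappa>.integrable_const_bound[where B=b]) auto
    have "(\<integral>\<^sup>+x. ennreal (\<phi> (\<omega>, x) + b) \<partial>\<kappa> \<omega>) = ennreal (\<integral>x. \<phi> (\<omega>, x) + b \<partial>\<kappa> \<omega>)"
      using i n1[OF \<omega>] by (intro nn_integral_eq_integral AE_I2) simp_all
    also have "(\<integral>x. \<phi> (\<omega>, x) + b \<partial>\<kappa> \<omega>) = (\<integral>x. \<phi> (\<omega>, x) \<partial>\<kappa> \<omega>) + b"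
      using i by (simp add: \<kappa>.prob_space)
    finally show "(\<integral>\<^sup>+x. ennreal (\<phi> (\<omega>, x) + b) \<partial>\<kappa> \<omega>) = ennreal ((\<integral>x. \<phi> (\<omega>, x) \<partial>\<kappa> \<omega>) + b)" .
  qed
  also have "\<dots> = ennreal (\<integral>\<omega>. (\<integral>x. \<phi> (\<omega>, x) \<partial>\<kappa> \<omega>) + b \<partial>M)"
    using i2 n2 by (intro nn_integral_eq_integral AE_I2) simp_all
  finally have "(\<integral>\<omega>. \<phi> (\<omega>, X' \<omega>) + b \<partial>M) = (\<integral>\<omega>. (\<integral>x. \<phi> (\<omega>, x) \<partial>\<kappa> \<omega>) + b \<partial>M)"
  proof (subst (asm) ennreal_inj)
    show "0 \<le> (\<integral>\<omega>. \<phi> (\<omega>, X' \<omega>) + b \<partial>M)"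
      using n1 by (intro integral_nonneg_AE AE_I2)
    show "0 \<le> (\<integral>\<omega>. (\<integral>x. \<phi> (\<omega>, x) \<partial>\<kappa> \<omega>) + b \<partial>M)"
      using n2 by (intro integral_nonneg_AE AE_I2)
  qed
  then show ?thesis using i1 i2 by (simp add: prob_space)
qed

context
  fixes g :: "'w \<Rightarrow> 'x \<Rightarrow> real" and b c :: real
  assumes g: "(\<lambda>p. g (fst p) (snd p)) \<in> borel_measurable (H \<Otimes>\<^sub>M borel)"
    and blip: "\<And>\<omega>. \<omega> \<in> space M \<Longrightarrow> blip b c (g \<omega>)"
begin

lemma measurable_centering: "(\<lambda>\<omega>. \<integral>x. g \<omega> x \<partial>\<kappa> \<omega>) \<in> borel_measurable H"
  using g by (intro integral_measurable_kernel[OF _ \<kappa>_subprob]) (simp add: case_prod_beta')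

lemma centering_le:
  assumes "\<omega> \<in> space M" shows "\<bar>\<integral>x. g \<omega> x \<partial>\<kappa> \<omega>\<bar> \<le> b"
proof -
  have "g \<omega> \<in> borel_measurable (\<kappa> \<omega>)"
    using blip_measurable[OF blip[OF assms]] prob_\<kappa>(2)[OF assms] by (simp cong: measurable_cong_sets)
  then show ?thesis
    using blipD(1)[OF blip[OF assms]] by (intro bounded_integral_le prob_\<kappa>(1)[OF assms])
qed

lemma measurable_increment:
  "(\<lambda>p. g (fst p) (snd p) - (\<integral>x. g (fst p) x \<partial>\<kappa> (fst p))) \<in> borel_measurable (H \<Otimes>\<^sub>M borel)"
  using g measurable_compose[OF measurable_fst measurable_centering]
  by (rule borel_measurable_diff)

text \<open>Given \<open>H\<close>, the factor \<open>G\<close> is a constant and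
  \<open>g \<omega> (X' \<omega>)\<close> is centred by its mean under
  \<open>\<kappa> \<omega>\<close>. The function \<open>g\<close> may itself depend on the past, as
  it will when it is built from the current kernel.\<close>

lemma increment_orthogonal:
  assumes G: "G \<in> borel_measurable H" and bG: "\<And>\<omega>. \<omega> \<in> space M \<Longrightarrow> \<bar>G \<omega>\<bar> \<le> b'"
  shows "(\<integral>\<omega>. G \<omega> * (g \<omega> (X' \<omega>) - (\<integral>x. g \<omega> x \<partial>\<kappa> \<omega>)) \<partial>M) = 0"
proof -
  let ?\<phi> = "\<lambda>p. G (fst p) * (g (fst p) (snd p) - (\<integral>x. g (fst p) x \<partial>\<kappa> (fst p)))"
  have "(\<integral>\<omega>. ?\<phi> (\<omega>, X' \<omega>) \<partial>M) = (\<integral>\<omega>. \<integral>x. ?\<phi> (\<omega>, x) \<partial>\<kappa> \<omega> \<partial>M)"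
  proof (rule integral_next)
    show "?\<phi> \<in> borel_measurable (H \<Otimes>\<^sub>M borel)"
      using measurable_compose[OF measurable_fst G] measurable_increment
      by (rule borel_measurable_times)
    fix \<omega> x assume \<omega>: "\<omega> \<in> space M"
    have "\<bar>g \<omega> x - (\<integral>x. g \<omega> x \<partial>\<kappa> \<omega>)\<bar> \<le> b + b"
      using centering_le[OF \<omega>] blipD(1)[OF blip[OF \<omega>], of x] by linarith
    then have "\<bar>G \<omega>\<bar> * \<bar>g \<omega> x - (\<integral>x. g \<omega> x \<partial>\<kappa> \<omega>)\<bar> \<le> b' * (b + b)"
      using bG[OF \<omega>] by (intro mult_mono) (auto intro: order_trans[OF abs_ge_zero])
    then show "\<bar>?\<phi> (\<omega>, x)\<bar> \<le> b' * (b + b)" by (simp add: abs_mult)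
  qed
  also have "\<dots> = (\<integral>\<omega>. 0 \<partial>M)"
  proof (rule Bochner_Integration.integral_cong[OF refl])
    fix \<omega> assume \<omega>: "\<omega> \<in> space M"
    interpret \<kappa>: prob_space "\<kappa> \<omega>" by (rule prob_\<kappa>[OF \<omega>])
    have "integrable (\<kappa> \<omega>) (g \<omega>)" by (rule blip_integrable[OF blip[OF \<omega>] prob_\<kappa>[OF \<omega>]])
    then show "(\<integral>x. ?\<phi> (\<omega>, x) \<partial>\<kappa> \<omega>) = 0" by (simp add: \<kappa>.prob_space)
  qed
  finally show ?thesis by simp
qed

text \<open>The centring is read as an average over a second point \<open>y\<close> drawn from the
  same \<open>\<kappa> \<omega>\<close>. Jensen's inequality in \<open>y\<close> and the Lipschitz
  bound then produce the double integral known as \<open>kernel_diff\<close>.\<close>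

lemma increment_sq_le:
  assumes c: "0 \<le> c"
  shows "(\<integral>\<^sup>+\<omega>. ennreal ((g \<omega> (X' \<omega>) - (\<integral>x. g \<omega> x \<partial>\<kappa> \<omega>))\<^sup>2) \<partial>M) \<le>
    (\<integral>\<^sup>+\<omega>. ennreal (c\<^sup>2) * (\<integral>\<^sup>+x. \<integral>\<^sup>+y. ennreal ((dist x y)\<^sup>2) \<partial>\<kappa> \<omega> \<partial>\<kappa> \<omega>) \<partial>M)"
proof -
  let ?\<phi> = "\<lambda>p. ennreal ((g (fst p) (snd p) - (\<integral>x. g (fst p) x \<partial>\<kappa> (fst p)))\<^sup>2)"
  have "(\<integral>\<^sup>+\<omega>. ?\<phi> (\<omega>, X' \<omega>) \<partial>M) = (\<integral>\<^sup>+\<omega>. \<integral>\<^sup>+x. ?\<phi> (\<omega>, x) \<partial>\<kappa> \<omega> \<partial>M)"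
    by (intro nn_integral_next
        measurable_compose[OF borel_measurable_power[OF measurable_increment] measurable_ennreal])
  also have "\<dots> \<le> (\<integral>\<^sup>+\<omega>. ennreal (c\<^sup>2) * (\<integral>\<^sup>+x. \<integral>\<^sup>+y. ennreal ((dist x y)\<^sup>2) \<partial>\<kappa> \<omega> \<partial>\<kappa> \<omega>) \<partial>M)"
  proof (rule nn_integral_mono)
    fix \<omega> assume \<omega>: "\<omega> \<in> space M"
    interpret \<kappa>: prob_space "\<kappa> \<omega>" by (rule prob_\<kappa>[OF \<omega>])
    note [measurable_cong] = prob_\<kappa>(2)[OF \<omega>]
    note [measurable] = blip_measurable[OF blip[OF \<omega>]]
    have i: "integrable (\<kappa> \<omega>) (g \<omega>)" by (rule blip_integrable[OF blip[OF \<omega>] prob_\<kappa>[OF \<omega>]])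
    have "?\<phi> (\<omega>, x) \<le> ennreal (c\<^sup>2) * (\<integral>\<^sup>+y. ennreal ((dist x y)\<^sup>2) \<partial>\<kappa> \<omega>)" for x
    proof -
      have "g \<omega> x - (\<integral>y. g \<omega> y \<partial>\<kappa> \<omega>) = (\<integral>y. g \<omega> x - g \<omega> y \<partial>\<kappa> \<omega>)"
        using i by (simp add: \<kappa>.prob_space)
      then have "?\<phi> (\<omega>, x) = ennreal ((\<integral>y. g \<omega> x - g \<omega> y \<partial>\<kappa> \<omega>)\<^sup>2)" by simp
      also have "\<dots> \<le> (\<integral>\<^sup>+y. ennreal ((g \<omega> x - g \<omega> y)\<^sup>2) \<partial>\<kappa> \<omega>)"
        by (rule jensen_sq) (auto intro: prob_\<kappa>[OF \<omega>])
      also have "\<dots> \<le> (\<integral>\<^sup>+y. ennreal (c\<^sup>2) * ennreal ((dist x y)\<^sup>2) \<partial>\<kappa> \<omega>)"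
      proof (rule nn_integral_mono)
        fix y
        have "\<bar>g \<omega> x - g \<omega> y\<bar>\<^sup>2 \<le> (c * dist x y)\<^sup>2"
          by (rule power_mono[OF blipD(2)[OF blip[OF \<omega>]]]) simp
        then show "ennreal ((g \<omega> x - g \<omega> y)\<^sup>2) \<le> ennreal (c\<^sup>2) * ennreal ((dist x y)\<^sup>2)"
          by (simp add: power_mult_distrib ennreal_leI flip: ennreal_mult)
      qed
      also have "\<dots> = ennreal (c\<^sup>2) * (\<integral>\<^sup>+y. ennreal ((dist x y)\<^sup>2) \<partial>\<kappa> \<omega>)"
        by (rule nn_integral_cmult) measurable
      finally show ?thesis .
    qed
    then have "(\<integral>\<^sup>+x. ?\<phi> (\<omega>, x) \<partial>\<kappa> \<omega>) \<le>
        (\<integral>\<^sup>+x. ennreal (c\<^sup>2) * (\<integral>\<^sup>+y. ennreal ((dist x y)\<^sup>2) \<partial>\<kappa> \<omega>) \<partial>\<kappa> \<omega>)"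
      by (intro nn_integral_mono)
    also have "\<dots> = ennreal (c\<^sup>2) * (\<integral>\<^sup>+x. \<integral>\<^sup>+y. ennreal ((dist x y)\<^sup>2) \<partial>\<kappa> \<omega> \<partial>\<kappa> \<omega>)"
      by (rule nn_integral_cmult) (intro \<kappa>.borel_measurable_nn_integral, measurable)
    finally show "(\<integral>\<^sup>+x. ?\<phi> (\<omega>, x) \<partial>\<kappa> \<omega>) \<le>
        ennreal (c\<^sup>2) * (\<integral>\<^sup>+x. \<integral>\<^sup>+y. ennreal ((dist x y)\<^sup>2) \<partial>\<kappa> \<omega> \<partial>\<kappa> \<omega>)" .
  qed
  finally show ?thesis by simp
qed

end

end

section \<open>The adaptive process\<close>

definition sqmean :: "'a measure \<Rightarrow> ('a \<Rightarrow> real) \<Rightarrow> ennreal" where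
  "sqmean M f = (\<integral>\<^sup>+\<omega>. ennreal ((f \<omega>)\<^sup>2) \<partial>M)"

lemma sqmean_mono:
  assumes "\<And>\<omega>. \<omega> \<in> space M \<Longrightarrow> \<bar>f \<omega>\<bar> \<le> \<bar>g \<omega>\<bar>"
  shows "sqmean M f \<le> sqmean M g"
  unfolding sqmean_def
  using assms by (intro nn_integral_mono ennreal_leI) (simp add: abs_le_square_iff)

lemma sqmean_cong: "(\<And>\<omega>. \<omega> \<in> space M \<Longrightarrow> f \<omega> = g \<omega>) \<Longrightarrow> sqmean M f = sqmean M g"
  unfolding sqmean_def by (intro nn_integral_cong) simp

lemma sqmean_cmult:
  assumes [measurable]: "f \<in> borel_measurable M"
  shows "sqmean M (\<lambda>\<omega>. c * f \<omega>) = ennreal (c\<^sup>2) * sqmean M f"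
  unfolding sqmean_def power_mult_distrib
  by (simp add: ennreal_mult nn_integral_cmult)

lemma sqmean_cmult_le:
  assumes "f \<in> borel_measurable M" "sqmean M f \<le> ennreal b" "0 \<le> b"
  shows "sqmean M (\<lambda>\<omega>. c * f \<omega>) \<le> ennreal (c\<^sup>2 * b)"
proof -
  have "sqmean M (\<lambda>\<omega>. c * f \<omega>) = ennreal (c\<^sup>2) * sqmean M f" by (rule sqmean_cmult[OF assms(1)])
  also have "\<dots> \<le> ennreal (c\<^sup>2) * ennreal b" using assms(2) by (rule mult_left_mono) simp
  also have "\<dots> = ennreal (c\<^sup>2 * b)" using assms(3) by (simp flip: ennreal_mult)
  finally show ?thesis .
qed

lemma sqmean_sum_const:
  assumes "\<And>i. i \<in> I \<Longrightarrow> f i \<in> borel_measurable M"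
    and b: "\<And>i. i \<in> I \<Longrightarrow> sqmean M (f i) \<le> ennreal b" "0 \<le> b"
  shows "sqmean M (\<lambda>\<omega>. \<Sum>i\<in>I. f i \<omega>) \<le> ennreal ((real (card I))\<^sup>2 * b)"
proof -
  have "sqmean M (\<lambda>\<omega>. \<Sum>i\<in>I. f i \<omega>) \<le> of_nat (card I) * (\<Sum>i\<in>I. sqmean M (f i))"
    unfolding sqmean_def by (rule nn_integral_sum_sq_le) (rule assms)
  also have "\<dots> \<le> of_nat (card I) * (\<Sum>i\<in>I. ennreal b)"
    using b by (intro mult_left_mono sum_mono) auto
  also have "\<dots> = ennreal ((real (card I))\<^sup>2 * b)"
    using b by (simp add: ennreal_of_nat_eq_real_of_nat power2_eq_square mult.assoc flip: ennreal_mult)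
  finally show ?thesis .
qed

lemma sqmean_add:
  assumes [measurable]: "f \<in> borel_measurable M" "g \<in> borel_measurable M"
    and b: "sqmean M f \<le> ennreal a" "sqmean M g \<le> ennreal b" and ab: "0 \<le> a" "0 \<le> b"
  shows "sqmean M (\<lambda>\<omega>. f \<omega> + g \<omega>) \<le> ennreal (2 * (a + b))"
proof -
  have "sqmean M (\<lambda>\<omega>. f \<omega> + g \<omega>) \<le> (\<integral>\<^sup>+\<omega>. 2 * ennreal ((f \<omega>)\<^sup>2) + 2 * ennreal ((g \<omega>)\<^sup>2) \<partial>M)"
    unfolding sqmean_def
  proof (rule nn_integral_mono)
    fix \<omega>
    have "0 \<le> (f \<omega> - g \<omega>)\<^sup>2" by simp
    then have "(f \<omega> + g \<omega>)\<^sup>2 \<le> 2 * (f \<omega>)\<^sup>2 + 2 * (g \<omega>)\<^sup>2" by (simp add: power2_eq_square algebra_simps)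
    then have "ennreal ((f \<omega> + g \<omega>)\<^sup>2) \<le> ennreal (2 * (f \<omega>)\<^sup>2 + 2 * (g \<omega>)\<^sup>2)" by (rule ennreal_leI)
    then show "ennreal ((f \<omega> + g \<omega>)\<^sup>2) \<le> 2 * ennreal ((f \<omega>)\<^sup>2) + 2 * ennreal ((g \<omega>)\<^sup>2)"
      by (simp add: ennreal_plus ennreal_mult)
  qed
  also have "\<dots> = 2 * sqmean M f + 2 * sqmean M g"
    unfolding sqmean_def by (simp add: nn_integral_add nn_integral_cmult)
  also have "\<dots> \<le> 2 * ennreal a + 2 * ennreal b" using b by (intro add_mono mult_left_mono) auto
  also have "\<dots> = ennreal (2 * (a + b))" using ab by (simp add: ennreal_plus ennreal_mult distrib_left)
  finally show ?thesis .
qed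

lemma ennreal_le_mult_sq:
  assumes "ennreal \<bar>r\<bar> \<le> ennreal c * e" "0 \<le> c"
  shows "ennreal (r\<^sup>2) \<le> ennreal (c\<^sup>2) * e\<^sup>2"
proof -
  have "ennreal (r\<^sup>2) = ennreal \<bar>r\<bar> * ennreal \<bar>r\<bar>"
    by (simp add: power2_eq_square flip: ennreal_mult)
  also have "\<dots> \<le> (ennreal c * e) * (ennreal c * e)" using assms by (intro mult_mono) auto
  also have "\<dots> = ennreal (c\<^sup>2) * e\<^sup>2"
    using assms(2) by (simp add: power2_eq_square ennreal_mult mult_ac)
  finally show ?thesis .
qed

lemma (in cond_sampled) measurable_kernel_diff:
  "(\<lambda>\<omega>. \<integral>\<^sup>+x. \<integral>\<^sup>+y. ennreal ((dist x y)\<^sup>2) \<partial>\<kappa> \<omega> \<partial>\<kappa> \<omega>) \<in> borel_measurable M"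
proof (rule from_H, rule nn_integral_measurable_subprob_algebra2[OF _ \<kappa>_subprob])
  have "(\<lambda>p. \<integral>\<^sup>+y. ennreal ((dist (snd p) y)\<^sup>2) \<partial>\<kappa> (fst p)) \<in> borel_measurable (H \<Otimes>\<^sub>M borel)"
    by (rule nn_integral_measurable_subprob_algebra2[OF _ measurable_compose[OF measurable_fst \<kappa>_subprob]])
       measurable
  then show "(\<lambda>(\<omega>, x). \<integral>\<^sup>+y. ennreal ((dist x y)\<^sup>2) \<partial>\<kappa> \<omega>) \<in> borel_measurable (H \<Otimes>\<^sub>M borel)"
    by (simp add: case_prod_beta')
qed

text \<open>Suprema and infima of the hypotheses are replaced by real witnesses: \<open>S1\<close>
  and \<open>S2\<close> bound the two moments of metric regularity, and \<open>x0\<close> is a point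
  at which the expression under the infimum in \<open>Rbound\<close> is at most \<open>R\<close>.
  Together with \<open>C\<close>, \<open>\<tau>\<close> and \<open>k0\<close> they determine the
  constant of the rate.\<close>

locale air = doubly_intractable \<mu> ybar \<nu> E P
  for \<mu> :: "'d measure" and ybar :: 'd
    and \<nu> :: "'x::{metric_space, second_countable_topology} measure"
    and E :: "'d \<Rightarrow> 'x \<Rightarrow> real" and P :: "'d measure set" +
  fixes ZM :: "('x \<Rightarrow> real) measure" and K :: "('x \<Rightarrow> real) \<times> 'x \<Rightarrow> 'x measure"
    and l u :: "'x \<Rightarrow> real" and \<alpha> :: real and N :: "nat \<Rightarrow> nat"
    and M :: "'w measure" and X :: "nat \<Rightarrow> 'w \<Rightarrow> 'x"
    and Z :: "nat \<Rightarrow> 'w \<Rightarrow> 'x \<Rightarrow> real" and Y :: "nat \<Rightarrow> 'w \<Rightarrow> 'd"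
    and C \<tau> S1 S2 R :: real and k0 :: nat and x0 :: 'x
  assumes ZM: "space ZM = Zset E P"
    and K: "K \<in> ZM \<Otimes>\<^sub>M borel \<rightarrow>\<^sub>M prob_algebra borel"
    and C: "1 \<le> C" and \<tau>: "0 < \<tau>" "\<tau> < 1" and k0: "1 \<le> k0"
    and contr: "\<And>z. z \<in> Zset E P \<Longrightarrow> (target E ybar \<nu> z \<bind> (\<lambda>x. K (z, x))) = target E ybar \<nu> z"
      "\<And>z. z \<in> Zset E P \<Longrightarrow> wasserstein_contraction (\<lambda>x. K (z, x)) \<le> ennreal C"
      "\<And>z. z \<in> Zset E P \<Longrightarrow> wasserstein_contraction (kernel_power (\<lambda>x. K (z, x)) k0) \<le> ennreal \<tau>"
    and l_pos: "\<And>x. 0 < l x"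
    and bounds: "\<And>y x. y \<in> space \<mu> \<Longrightarrow> l x \<le> exp (- E y x) \<and> exp (- E y x) \<le> u x"
    and R: "0 \<le> R" "(\<integral>\<^sup>+x. (ennreal ((dist x0 x)\<^sup>2) + R1 E ybar \<nu> l u x0) *
      ennreal ((u x)\<^sup>2 / (l x)\<^sup>2) \<partial>(target E ybar \<nu> (zfun E \<mu>))) \<le> ennreal R"
    and alpha: "0 \<le> \<alpha>"
    and N: "\<And>j. 1 \<le> j \<Longrightarrow> N (tri j) = nat \<lceil>real j powr (1 + \<alpha>)\<rceil>"
    and process: "air_process \<mu> E ZM K N M X Z Y"
    and S1: "0 \<le> S1" "\<And>j k. (\<integral>\<^sup>+\<omega>. (ecc (target E ybar \<nu>) (Z j \<omega>) (X k \<omega>))\<^sup>2 \<partial>M) \<le> ennreal S1"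
    and S2: "0 \<le> S2" "\<And>j k. (\<integral>\<^sup>+\<omega>. kernel_diff K (Z j \<omega>) (X k \<omega>) \<partial>M) \<le> ennreal S2"
begin

abbreviation (input) zs :: "'x \<Rightarrow> real" where "zs \<equiv> zfun E \<mu>"

lemma prob_M: "prob_space M" using process by (simp add: air_process_def)

sublocale prob_space M by (rule prob_M)

lemma X[measurable]: "X n \<in> M \<rightarrow>\<^sub>M borel" using process by (simp add: air_process_def)

lemma Z[measurable]: "Z n \<in> M \<rightarrow>\<^sub>M ZM" using process by (simp add: air_process_def)

lemma Y: "1 \<le> k \<Longrightarrow> Y k \<in> M \<rightarrow>\<^sub>M \<mu>" using process by (simp add: air_process_def)

lemma Y_indep: "indep_vars (\<lambda>_. \<mu>) Y {1..}" using process by (simp add: air_process_def)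

lemma Y_distr: "1 \<le> k \<Longrightarrow> distr M \<mu> (Y k) = \<mu>" using process by (simp add: air_process_def)

lemma Z_in: "\<omega> \<in> space M \<Longrightarrow> Z n \<omega> \<in> Zset E P"
  using measurable_space[OF Z] by (simp add: ZM)

lemma Z_adm: "\<omega> \<in> space M \<Longrightarrow> admissible (Z n \<omega>)"
  by (rule admissible_Zset[OF Z_in])

lemma Z_step: "1 \<le> n \<Longrightarrow> n \<notin> range tri \<Longrightarrow> \<omega> \<in> space M \<Longrightarrow> Z n \<omega> = Z (n - 1) \<omega>"
  using process by (simp add: air_process_def)

lemma Z_tri:
  "1 \<le> j \<Longrightarrow> \<omega> \<in> space M \<Longrightarrow>
    Z (tri j) \<omega> = (\<lambda>x. (1 / real (N (tri j))) * (\<Sum>k=1..N (tri j). exp (- E (Y k \<omega>) x)))"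
  using process by (simp add: air_process_def)

section \<open>Sample sizes, normalizing functions and bias along the process\<close>

definition Nn :: "nat \<Rightarrow> nat" where "Nn n = N (tri (epoch n))"

text \<open>Between update times neither \<open>Z\<close> nor \<open>epoch\<close> changes. The
  induction starts at \<open>1 = tri 1\<close>: \<open>Z 0\<close> comes from the initial kernel and
  is in general not a sample average, which is why later sums over parameters start at index
  1.\<close>

lemma Z_eq:
  assumes "1 \<le> n" "\<omega> \<in> space M"
  shows "Z n \<omega> = (\<lambda>x. (1 / real (Nn n)) * (\<Sum>k=1..Nn n. exp (- E (Y k \<omega>) x)))"
  using assms(1)
proof (induction n rule: dec_induct)
  case base
  have "epoch (tri 1) = 1" "tri 1 = 1" using epoch_tri[of 1] by (auto simp: tri_def)
  then show ?case using Z_tri[OF _ assms(2), of 1] by (simp add: Nn_def)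
next
  case (step n)
  show ?case
  proof (cases "Suc n \<in> range tri")
    case True
    then obtain j where j: "Suc n = tri j" by auto
    have "1 \<le> j" using j by (cases j) (auto simp: tri_def)
    then show ?thesis using Z_tri[OF _ assms(2), of j] epoch_tri[of j] by (simp add: j Nn_def)
  next
    case False
    then have "Z (Suc n) \<omega> = Z n \<omega>" using Z_step[of "Suc n" \<omega>] assms(2) by simp
    moreover have "Nn (Suc n) = Nn n" using epoch_step[OF step(1) False] by (simp add: Nn_def)
    ultimately show ?thesis using step by simp
  qed
qed

text \<open>In epoch \<open>k\<close> about \<open>k powr (1 + \<alpha>)\<close> samples are in use
  and \<open>k\<close> is of order \<open>sqrt n\<close>, whence the exponent
  \<open>(1 + \<alpha>) / 2\<close>. It is capped at 1, the exponent supplied by the martingale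
  part, whose bound does not improve with the number of samples.\<close>

definition \<beta> :: real where "\<beta> = min 1 ((1 + \<alpha>) / 2)"

lemma \<beta>: "0 < \<beta>" "\<beta> \<le> 1" "2 * \<beta> \<le> 1 + \<alpha>"
  using alpha by (auto simp: \<beta>_def min_def)

lemma Nn_ge:
  assumes "1 \<le> n" shows "real n powr \<beta> / 3 \<le> real (Nn n)" "1 \<le> Nn n"
proof -
  show *: "real n powr \<beta> / 3 \<le> real (Nn n)"
    using sample_size_ge[OF assms] \<beta> N[OF epoch_bounds(1)[OF assms]] by (simp add: Nn_def)
  have "0 < real n powr \<beta> / 3" using assms by simp
  with * have "0 < real (Nn n)" by linarith
  then show "1 \<le> Nn n" by simp
qed

lemma E_Y_measurable:
  assumes "1 \<le> k"
  shows "(\<lambda>p. exp (- E (Y k (fst p)) (snd p))) \<in> borel_measurable (M \<Otimes>\<^sub>M borel)"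
proof -
  note [measurable] = Y[OF assms]
  have "(\<lambda>p. (Y k (fst p), snd p)) \<in> M \<Otimes>\<^sub>M borel \<rightarrow>\<^sub>M \<mu> \<Otimes>\<^sub>M borel" by measurable
  from measurable_compose[OF this E_measurable]
  have [measurable]: "(\<lambda>p. E (Y k (fst p)) (snd p)) \<in> borel_measurable (M \<Otimes>\<^sub>M borel)" by simp
  show ?thesis by measurable
qed

lemma Z_joint:
  assumes "1 \<le> n"
  shows "(\<lambda>(\<omega>, x). Z n \<omega> x) \<in> borel_measurable (M \<Otimes>\<^sub>M borel)"
proof (rule measurable_cong[THEN iffD1])
  show "(\<lambda>p. (1 / real (Nn n)) * (\<Sum>k=1..Nn n. exp (- E (Y k (fst p)) (snd p)))) \<in> borel_measurable (M \<Otimes>\<^sub>M borel)"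
    by (intro borel_measurable_times borel_measurable_const borel_measurable_sum E_Y_measurable) simp
  show "p \<in> space (M \<Otimes>\<^sub>M borel) \<Longrightarrow>
      (1 / real (Nn n)) * (\<Sum>k=1..Nn n. exp (- E (Y k (fst p)) (snd p))) = (\<lambda>(\<omega>, x). Z n \<omega> x) p" for p
    using Z_eq[OF assms] by (auto simp: space_pair_measure)
qed

lemma Z_bounds:
  assumes n: "1 \<le> n" and \<omega>: "\<omega> \<in> space M"
  shows "l x \<le> Z n \<omega> x" "Z n \<omega> x \<le> u x"
proof -
  have Nn: "1 \<le> Nn n" by (rule Nn_ge[OF n])
  have b: "l x \<le> exp (- E (Y k \<omega>) x) \<and> exp (- E (Y k \<omega>) x) \<le> u x" if "k \<in> {1..Nn n}" for k
    using that measurable_space[OF Y \<omega>, of k] by (intro bounds) auto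
  have "real (Nn n) * l x \<le> (\<Sum>k=1..Nn n. exp (- E (Y k \<omega>) x))"
    using sum_mono[of "{1..Nn n}" "\<lambda>_. l x" "\<lambda>k. exp (- E (Y k \<omega>) x)"] b by simp
  moreover have "(\<Sum>k=1..Nn n. exp (- E (Y k \<omega>) x)) \<le> real (Nn n) * u x"
    using sum_mono[of "{1..Nn n}" "\<lambda>k. exp (- E (Y k \<omega>) x)" "\<lambda>_. u x"] b by simp
  ultimately show "l x \<le> Z n \<omega> x" "Z n \<omega> x \<le> u x"
    unfolding Z_eq[OF n \<omega>] using Nn by (simp_all add: field_simps)
qed

lemma Z_variance:
  assumes n: "1 \<le> n"
  shows "(\<integral>\<^sup>+\<omega>. ennreal ((Z n \<omega> x - zs x)\<^sup>2) \<partial>M) \<le> ennreal ((u x)\<^sup>2 / real (Nn n))"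
proof -
  have Ex: "(\<lambda>y. exp (- E y x)) \<in> borel_measurable \<mu>"
  proof -
    have "(\<lambda>y. (y, x)) \<in> \<mu> \<rightarrow>\<^sub>M \<mu> \<Otimes>\<^sub>M borel" by simp
    from measurable_compose[OF this E_measurable] have [measurable]: "(\<lambda>y. E y x) \<in> borel_measurable \<mu>" by simp
    show ?thesis by measurable
  qed
  have "(\<integral>\<^sup>+\<omega>. ennreal ((1 / real (Nn n) * (\<Sum>k=1..Nn n. exp (- E (Y k \<omega>) x)) - zs x)\<^sup>2) \<partial>M) \<le>
      ennreal ((u x)\<^sup>2 / real (Nn n))"
  proof (rule mean_of_iid_sq_le)
    have "indep_vars (\<lambda>_. \<mu>) Y {1..Nn n}" by (rule indep_vars_subset[OF Y_indep]) auto
    then show "indep_vars (\<lambda>_. borel) (\<lambda>k \<omega>. exp (- E (Y k \<omega>) x)) {1..Nn n}"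
      by (rule indep_vars_compose2) (rule Ex)
    show "1 \<le> Nn n" by (rule Nn_ge[OF n])
    fix k assume k: "k \<in> {1..Nn n}"
    show "\<omega> \<in> space M \<Longrightarrow> \<bar>exp (- E (Y k \<omega>) x)\<bar> \<le> u x" for \<omega>
      using k bounds[of "Y k \<omega>" x] measurable_space[OF Y] by simp
    have "expectation (\<lambda>\<omega>. exp (- E (Y k \<omega>) x)) = (\<integral>y. exp (- E y x) \<partial>distr M \<mu> (Y k))"
      using k Ex Y by (subst integral_distr) auto
    then show "expectation (\<lambda>\<omega>. exp (- E (Y k \<omega>) x)) = zs x"
      using k Y_distr[of k] by (simp add: zfun_def)
  qed
  then show ?thesis
    using Z_eq[OF n] by (subst nn_integral_cong) (auto intro!: nn_integral_cong)
qed

lemma sets_zs: "sets (target E ybar \<nu> zs) = sets borel" by (rule sets_target[OF admissible_zstar])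

text \<open>Subtracting \<open>h x0\<close> shifts both means by the same amount and yields a
  function bounded by the distance to \<open>x0\<close>. The constant 6 is the 2 of
  \<open>target_bias_le\<close> times the 3 of \<open>sample_size_ge\<close>.\<close>

lemma bias_le:
  assumes h: "blip B 1 h" and n: "1 \<le> n"
  shows "sqmean M (\<lambda>\<omega>. (\<integral>x. h x \<partial>target E ybar \<nu> (Z n \<omega>)) - (\<integral>x. h x \<partial>target E ybar \<nu> zs)) \<le>
    ennreal (6 * R * real n powr - \<beta>)"
proof -
  let ?f = "\<lambda>x. h x - h x0"
  note [measurable] = blip_measurable[OF h]
  have c: "(\<integral>x. ?f x \<partial>target E ybar \<nu> z) = (\<integral>x. h x \<partial>target E ybar \<nu> z) - h x0" if "admissible z" for z
  proof -
    interpret t: prob_space "target E ybar \<nu> z" by (rule prob_target[OF that])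
    have "integrable (target E ybar \<nu> z) h"
      by (rule blip_integrable[OF h t.prob_space_axioms sets_target[OF that]])
    then show ?thesis by (simp add: t.prob_space)
  qed
  have "sqmean M (\<lambda>\<omega>. (\<integral>x. h x \<partial>target E ybar \<nu> (Z n \<omega>)) - (\<integral>x. h x \<partial>target E ybar \<nu> zs)) =
      (\<integral>\<^sup>+\<omega>. ennreal (((\<integral>x. ?f x \<partial>target E ybar \<nu> (Z n \<omega>)) - (\<integral>x. ?f x \<partial>target E ybar \<nu> zs))\<^sup>2) \<partial>M)"
    unfolding sqmean_def using c[OF Z_adm] c[OF admissible_zstar] by (intro nn_integral_cong) simp
  also have "\<dots> \<le> ennreal (2 / real (Nn n)) * (\<integral>\<^sup>+x. (ennreal ((dist x0 x)\<^sup>2) + R1 E ybar \<nu> l u x0) *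
      ennreal ((u x)\<^sup>2 / (l x)\<^sup>2) \<partial>(target E ybar \<nu> (zfun E \<mu>)))"
  proof (rule target_bias_le[OF prob_M Z_joint[OF n] Z_adm])
    show "\<bar>?f x\<bar> \<le> B + B" for x using blipD(1)[OF h, of x] blipD(1)[OF h, of x0] by linarith
    show "\<bar>?f x\<bar> \<le> dist x x0" for x using blipD(2)[OF h, of x x0] by simp
  qed (use Z_bounds[OF n] l_pos Nn_ge(2)[OF n] Z_variance[OF n] in auto)
  also have "\<dots> \<le> ennreal (2 / real (Nn n)) * ennreal R"
    using R(2) by (rule mult_left_mono) simp
  also have "\<dots> \<le> ennreal (6 * R * real n powr - \<beta>)"
  proof -
    have "0 < real n powr \<beta> / 3" using n by simp
    then have "2 / real (Nn n) \<le> 2 / (real n powr \<beta> / 3)"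
      using Nn_ge[OF n] by (intro divide_left_mono mult_pos_pos) auto
    then have "2 / real (Nn n) \<le> 6 * real n powr - \<beta>" by (simp add: powr_minus field_simps)
    then have "2 / real (Nn n) * R \<le> 6 * real n powr - \<beta> * R" using R(1) by (rule mult_right_mono)
    then show ?thesis using R(1) by (simp add: mult_ac ennreal_leI flip: ennreal_mult)
  qed
  finally show ?thesis .
qed

text \<open>The triangle inequality through a point drawn from the target of \<open>Z 1\<close>,
  averaged over that point, bounds the distance by two eccentricities. Metric regularity is uniform
  over all pairs of indices, so one parameter serves for both states.\<close>

lemma dist_le:
  "sqmean M (\<lambda>\<omega>. dist (X i \<omega>) (X j \<omega>)) \<le> ennreal (4 * S1)"
proof -
  define e where "e i \<omega> = ecc (target E ybar \<nu>) (Z 1 \<omega>) (X i \<omega>)" for i \<omega>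
  have [measurable]: "e i \<in> borel_measurable M" for i
    unfolding e_def[abs_def] by (rule measurable_ecc[OF prob_M Z_joint Z_adm X]) simp
  have "sqmean M (\<lambda>\<omega>. dist (X i \<omega>) (X j \<omega>)) \<le> (\<integral>\<^sup>+\<omega>. 2 * (e i \<omega>)\<^sup>2 + 2 * (e j \<omega>)\<^sup>2 \<partial>M)"
    unfolding sqmean_def
  proof (rule nn_integral_mono)
    fix \<omega> assume \<omega>: "\<omega> \<in> space M"
    interpret t: prob_space "target E ybar \<nu> (Z 1 \<omega>)" by (rule prob_target[OF Z_adm[OF \<omega>]])
    note [measurable_cong] = sets_target[OF Z_adm[OF \<omega>]]
    have "ennreal (dist (X i \<omega>) (X j \<omega>)) = (\<integral>\<^sup>+x. ennreal (dist (X i \<omega>) (X j \<omega>)) \<partial>target E ybar \<nu> (Z 1 \<omega>))"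
      using t.emeasure_space_1 by simp
    also have "\<dots> \<le> (\<integral>\<^sup>+x. ennreal (dist (X i \<omega>) x) + ennreal (dist (X j \<omega>) x) \<partial>target E ybar \<nu> (Z 1 \<omega>))"
      by (intro nn_integral_mono) (simp add: dist_triangle2 flip: ennreal_plus)
    also have "\<dots> = e i \<omega> + e j \<omega>" unfolding e_def ecc_def by (rule nn_integral_add) measurable
    finally have d: "ennreal (dist (X i \<omega>) (X j \<omega>)) \<le> e i \<omega> + e j \<omega>" .
    have sq: "(a + b)\<^sup>2 \<le> 2 * a\<^sup>2 + 2 * b\<^sup>2" for a b :: ennreal
    proof (cases "a = top \<or> b = top")
      case False
      then obtain r s where rs: "a = ennreal r" "b = ennreal s" "0 \<le> r" "0 \<le> s"
        by (metis ennreal_cases)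
      have "0 \<le> (r - s)\<^sup>2" by simp
      then have "(r + s)\<^sup>2 \<le> 2 * r\<^sup>2 + 2 * s\<^sup>2" by (simp add: power2_eq_square algebra_simps)
      then have "ennreal ((r + s)\<^sup>2) \<le> ennreal (2 * r\<^sup>2 + 2 * s\<^sup>2)" by (rule ennreal_leI)
      then show ?thesis
        using rs by (simp add: ennreal_plus ennreal_mult ennreal_power[symmetric] power2_eq_square)
    qed (auto simp: power2_eq_square ennreal_mult_eq_top_iff)
    have "ennreal ((dist (X i \<omega>) (X j \<omega>))\<^sup>2) = (ennreal (dist (X i \<omega>) (X j \<omega>)))\<^sup>2"
      by (simp add: ennreal_power)
    also have "\<dots> \<le> (e i \<omega> + e j \<omega>)\<^sup>2" using d by (rule power_mono) simp
    also have "\<dots> \<le> 2 * (e i \<omega>)\<^sup>2 + 2 * (e j \<omega>)\<^sup>2" by (rule sq)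
    finally show "ennreal ((dist (X i \<omega>) (X j \<omega>))\<^sup>2) \<le> 2 * (e i \<omega>)\<^sup>2 + 2 * (e j \<omega>)\<^sup>2" .
  qed
  also have "\<dots> = 2 * (\<integral>\<^sup>+\<omega>. (e i \<omega>)\<^sup>2 \<partial>M) + 2 * (\<integral>\<^sup>+\<omega>. (e j \<omega>)\<^sup>2 \<partial>M)"
    by (simp add: nn_integral_add nn_integral_cmult)
  also have "\<dots> \<le> 2 * ennreal S1 + 2 * ennreal S1"
    using S1(2) unfolding e_def by (intro add_mono mult_left_mono) auto
  also have "\<dots> = ennreal (4 * S1)"
    using S1(1) ennreal_mult[of 2 S1] ennreal_plus[of "2 * S1" "2 * S1"] by simp
  finally show ?thesis .
qed

lemma kernel_section:
  assumes "z \<in> Zset E P"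
  shows "contractive_kernel (\<lambda>x. K (z, x)) C \<tau> k0"
proof
  have "Pair z \<in> borel \<rightarrow>\<^sub>M ZM \<Otimes>\<^sub>M borel" using assms by (simp add: ZM)
  from measurable_compose[OF this K] show "(\<lambda>x. K (z, x)) \<in> borel \<rightarrow>\<^sub>M prob_algebra borel" .
qed (use C \<tau> k0 contr(2,3)[OF assms] in auto)

text \<open>Everything generated before \<open>X (Suc n)\<close> is drawn: the conditioning
  \<sigma>-algebra in the last clause of \<open>air_process\<close>.\<close>

definition past :: "nat \<Rightarrow> 'w measure" where
  "past n = history M ZM \<mu> X Z Y {..n} {..n} {k. 1 \<le> k \<and> (\<exists>j. tri j \<le> n \<and> k \<le> N (tri j))}"

lemma past_generators:
  "{X i -` A \<inter> space M | i A. i \<in> {..n} \<and> A \<in> sets borel} \<union>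
      {Z i -` B \<inter> space M | i B. i \<in> {..n} \<and> B \<in> sets ZM} \<union>
      {Y k -` D \<inter> space M | k D. k \<in> {k. 1 \<le> k \<and> (\<exists>j. tri j \<le> n \<and> k \<le> N (tri j))} \<and> D \<in> sets \<mu>}
    \<subseteq> sets M"
  using measurable_sets[OF X] measurable_sets[OF Z] measurable_sets[OF Y] by auto

lemma space_past: "space (past n) = space M"
  unfolding past_def history_def by (rule space_measure_of_conv)

lemma subalgebra_past: "subalgebra M (past n)"
  unfolding subalgebra_def
proof
  show "space (past n) = space M" by (rule space_past)
  have "sigma_sets (space M) G \<subseteq> sets M" if "G \<subseteq> sets M" for G
    using that by (rule sets.sigma_sets_subset)
  from this[OF past_generators] show "sets (past n) \<subseteq> sets M"
    unfolding past_def history_def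
    using past_generators[of n] sets.space_closed
    by (subst sets_measure_of) (auto 0 0)
qed

lemma past_gen_sets:
  assumes "S \<in> {X i -` A \<inter> space M | i A. i \<in> {..n} \<and> A \<in> sets borel} \<union>
      {Z i -` B \<inter> space M | i B. i \<in> {..n} \<and> B \<in> sets ZM}"
  shows "S \<in> sets (past n)"
  unfolding past_def history_def
  using assms past_generators[of n] sets.space_closed[of M]
  by (subst sets_measure_of) (auto intro!: sigma_sets.Basic)

lemma X_past: "i \<le> n \<Longrightarrow> X i \<in> past n \<rightarrow>\<^sub>M borel"
proof (rule measurableI)
  fix A :: "'x set" assume "i \<le> n" "A \<in> sets borel"
  then have "X i -` A \<inter> space M \<in> sets (past n)" by (intro past_gen_sets) auto
  then show "X i -` A \<inter> space (past n) \<in> sets (past n)" by (simp add: space_past)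
qed simp

lemma Z_past: "i \<le> n \<Longrightarrow> Z i \<in> past n \<rightarrow>\<^sub>M ZM"
proof (rule measurableI)
  show "\<omega> \<in> space (past n) \<Longrightarrow> Z i \<omega> \<in> space ZM" for \<omega>
    using measurable_space[OF Z] by (simp add: space_past)
  fix A assume "i \<le> n" "A \<in> sets ZM"
  then have "Z i -` A \<inter> space M \<in> sets (past n)" by (intro past_gen_sets) auto
  then show "Z i -` A \<inter> space (past n) \<in> sets (past n)" by (simp add: space_past)
qed

lemma cond_sampled_next: "cond_sampled M (past n) (X (Suc n)) (\<lambda>\<omega>. K (Z n \<omega>, X n \<omega>))"
proof
  show "subalgebra M (past n)" by (rule subalgebra_past)
  show "X (Suc n) \<in> M \<rightarrow>\<^sub>M borel" by (rule X)
  show "(\<lambda>\<omega>. K (Z n \<omega>, X n \<omega>)) \<in> past n \<rightarrow>\<^sub>M prob_algebra borel"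
    by (rule measurable_compose[OF measurable_Pair[OF Z_past X_past] K]) auto
  show "AE \<omega> in M. real_cond_exp M (past n) (indicator (X (Suc n) -` A)) \<omega> = measure (K (Z n \<omega>, X n \<omega>)) A"
    if "A \<in> sets borel" for A
    using process that unfolding air_process_def past_def by blast
qed

text \<open>The Lipschitz constant that \<open>pot_blip\<close> gives for 1-Lipschitz functions, the
  same for all \<open>m\<close>.\<close>

definition lip0 :: real where "lip0 = C ^ k0 * (real k0 / (1 - \<tau>))"

lemma lip0: "0 < lip0" using C \<tau> k0 by (simp add: lip0_def)

section \<open>Error decomposition for a bounded function and a fixed run length\<close>

context
  fixes h :: "'x \<Rightarrow> real" and B :: real and m n :: nat
  assumes h: "blip B 1 h" and n: "1 \<le> n" and m: "\<tau> ^ m * C ^ k0 \<le> 1 / real n"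
begin

definition U :: "('x \<Rightarrow> real) \<Rightarrow> 'x \<Rightarrow> real" where
  "U z x = (\<Sum>k<m * k0. (kernel_op (\<lambda>x. K (z, x)) ^^ k) h x)"

definition PU :: "('x \<Rightarrow> real) \<Rightarrow> 'x \<Rightarrow> real" where
  "PU z = kernel_op (\<lambda>x. K (z, x)) (U z)"

definition res :: "('x \<Rightarrow> real) \<Rightarrow> 'x \<Rightarrow> real" where
  "res z = (kernel_op (\<lambda>x. K (z, x)) ^^ (m * k0)) h"

lemma
  assumes z: "z \<in> Zset E P"
  shows U_blip: "blip (real (m * k0) * B) lip0 (U z)"
    and PU_blip: "blip (real (m * k0) * B) (lip0 * C) (PU z)"
    and U_eq: "U z x - PU z x = h x - res z x"
    and res_blip: "blip B (1 / real n) (res z)"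
    and res_mean: "(\<integral>x. res z x \<partial>target E ybar \<nu> z) = (\<integral>x. h x \<partial>target E ybar \<nu> z)"
proof -
  interpret k: contractive_kernel "\<lambda>x. K (z, x)" C \<tau> k0 by (rule kernel_section[OF z])
  have U: "U z = k.pot m h" by (rule ext) (simp add: U_def k.pot_def)
  show "blip (real (m * k0) * B) lip0 (U z)"
    unfolding U using k.pot_blip[OF h] by (simp add: lip0_def)
  show "blip (real (m * k0) * B) (lip0 * C) (PU z)"
    unfolding PU_def U using k.kernel_op_pot_blip[OF h] by (simp add: lip0_def)
  show "U z x - PU z x = h x - res z x"
    unfolding PU_def U res_def by (rule k.pot_minus_kernel_op_pot[OF h]) simp
  have "blip B (\<tau> ^ m * C ^ k0) (res z)"
    unfolding res_def using k.kernel_op_pow_blip[OF h, of "m * k0"] k0 by simp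
  then show "blip B (1 / real n) (res z)" using m by (rule blip_mono)
  show "(\<integral>x. res z x \<partial>target E ybar \<nu> z) = (\<integral>x. h x \<partial>target E ybar \<nu> z)"
    unfolding res_def
    by (rule k.kernel_op_pow_stationary[OF h _ prob_target sets_target contr(1)])
       (use admissible_Zset z in auto)
qed

lemma U_measurable: "(\<lambda>p. U (fst p) (snd p)) \<in> borel_measurable (ZM \<Otimes>\<^sub>M borel)"
  unfolding U_def by (intro borel_measurable_sum measurable_kernel_op_pow K blip_measurable[OF h])

lemma PU_measurable: "(\<lambda>p. PU (fst p) (snd p)) \<in> borel_measurable (ZM \<Otimes>\<^sub>M borel)"
proof -
  have "(\<lambda>p. \<integral>y. U (fst p) y \<partial>K p) \<in> borel_measurable (ZM \<Otimes>\<^sub>M borel)"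
  proof (rule integral_measurable_kernel[OF _ measurable_prob_algebraD[OF K]])
    have "(\<lambda>q. (fst (fst q), snd q)) \<in> (ZM \<Otimes>\<^sub>M borel) \<Otimes>\<^sub>M borel \<rightarrow>\<^sub>M ZM \<Otimes>\<^sub>M borel" by measurable
    from measurable_compose[OF this U_measurable]
    show "(\<lambda>(p, y). U (fst p) y) \<in> borel_measurable ((ZM \<Otimes>\<^sub>M borel) \<Otimes>\<^sub>M borel)"
      by (simp add: case_prod_beta')
  qed
  then show ?thesis by (simp add: PU_def kernel_op_def)
qed

lemma res_measurable: "(\<lambda>p. res (fst p) (snd p)) \<in> borel_measurable (ZM \<Otimes>\<^sub>M borel)"
  unfolding res_def by (intro measurable_kernel_op_pow K blip_measurable[OF h])

definition D :: "nat \<Rightarrow> 'w \<Rightarrow> real" where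
  "D i \<omega> = U (Z i \<omega>) (X (Suc i) \<omega>) - PU (Z i \<omega>) (X i \<omega>)"

definition T :: "nat \<Rightarrow> 'w \<Rightarrow> real" where
  "T i \<omega> = PU (Z i \<omega>) (X i \<omega>) - PU (Z i \<omega>) (X (Suc i) \<omega>)"

definition Q :: "nat \<Rightarrow> 'w \<Rightarrow> real" where
  "Q i \<omega> = (\<integral>x. h x \<partial>target E ybar \<nu> (Z i \<omega>)) - (\<integral>x. h x \<partial>target E ybar \<nu> zs)"

definition Rm :: "nat \<Rightarrow> 'w \<Rightarrow> real" where
  "Rm i \<omega> = res (Z i \<omega>) (X (Suc i) \<omega>) - (\<integral>x. h x \<partial>target E ybar \<nu> (Z i \<omega>))"

text \<open>The state \<open>X (Suc i)\<close> is paired with \<open>Z i\<close>, the parameter of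
  the kernel that produced it. Hence \<open>D\<close> is a martingale increment,
  \<open>PU (Z i) (X i)\<close> being the conditional mean of \<open>U (Z i) (X (Suc i))\<close>.
  \<open>T\<close> telescopes as long as \<open>Z\<close> is constant, \<open>Rm\<close> is the
  truncation remainder minus its target mean, and \<open>Q\<close> is the bias.\<close>

lemma decomposition:
  assumes "\<omega> \<in> space M"
  shows "h (X (Suc i) \<omega>) - (\<integral>x. h x \<partial>target E ybar \<nu> zs) = D i \<omega> + T i \<omega> + Rm i \<omega> + Q i \<omega>"
  using U_eq[OF Z_in[OF assms], of i "X (Suc i) \<omega>"] by (simp add: D_def T_def Rm_def Q_def)

lemma D_bound:
  assumes "\<omega> \<in> space M" shows "\<bar>D i \<omega>\<bar> \<le> 2 * (real (m * k0) * B)"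
  using blipD(1)[OF U_blip[OF Z_in[OF assms]], of i "X (Suc i) \<omega>"]
    blipD(1)[OF PU_blip[OF Z_in[OF assms]], of i "X i \<omega>"]
  unfolding D_def by linarith

lemma D_past: "i < j \<Longrightarrow> D i \<in> borel_measurable (past j)"
  unfolding D_def[abs_def]
  using measurable_compose[OF measurable_Pair[OF Z_past X_past] U_measurable, of i j "Suc i"]
    measurable_compose[OF measurable_Pair[OF Z_past X_past] PU_measurable, of i j i]
  by simp

lemma D_measurable[measurable]: "D i \<in> borel_measurable M"
  by (rule measurable_from_subalg[OF subalgebra_past D_past[of i "Suc i"]]) simp

lemma T_measurable[measurable]: "T i \<in> borel_measurable M"
  unfolding T_def[abs_def]
  using measurable_compose[OF measurable_Pair[OF Z[of i] X[of "Suc i"]] PU_measurable]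
    measurable_compose[OF measurable_Pair[OF Z[of i] X[of i]] PU_measurable]
  by simp

lemma Q_measurable:
  assumes "1 \<le> i" shows "Q i \<in> borel_measurable M"
  unfolding Q_def[abs_def]
  using measurable_target_integral[OF prob_M Z_joint[OF assms] Z_adm blip_measurable[OF h]] by simp

lemma Rm_measurable:
  assumes "1 \<le> i" shows "Rm i \<in> borel_measurable M"
  unfolding Rm_def[abs_def]
  using measurable_target_integral[OF prob_M Z_joint[OF assms] Z_adm blip_measurable[OF h]]
    measurable_compose[OF measurable_Pair[OF Z[of i] X[of "Suc i"]] res_measurable] by simp

text \<open>For \<open>i < j\<close> the increment \<open>D i\<close> is determined by
  \<open>past j\<close>, given which \<open>D j\<close> is centred. In the second claim only the
  Lipschitz constant of \<open>U (Z j)\<close> enters, so the bound is free of \<open>m\<close> and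
  \<open>B\<close>.\<close>

lemma
  shows D_orthogonal: "i < j \<Longrightarrow> expectation (\<lambda>\<omega>. D i \<omega> * D j \<omega>) = 0"
    and D_sq: "sqmean M (D j) \<le> ennreal (lip0\<^sup>2 * S2)"
proof -
  interpret c: cond_sampled M "past j" "X (Suc j)" "\<lambda>\<omega>. K (Z j \<omega>, X j \<omega>)" by (rule cond_sampled_next)
  have g: "(\<lambda>p. U (Z j (fst p)) (snd p)) \<in> borel_measurable (past j \<Otimes>\<^sub>M borel)"
    using measurable_compose[OF measurable_Pair[OF measurable_compose[OF measurable_fst Z_past] measurable_snd]
      U_measurable, of j j] by simp
  have bl: "\<And>\<omega>. \<omega> \<in> space M \<Longrightarrow> blip (real (m * k0) * B) lip0 (U (Z j \<omega>))"
    by (rule U_blip[OF Z_in])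
  have eq: "D j \<omega> = U (Z j \<omega>) (X (Suc j) \<omega>) - (\<integral>x. U (Z j \<omega>) x \<partial>K (Z j \<omega>, X j \<omega>))" for \<omega>
    by (simp add: D_def PU_def kernel_op_def)
  show "expectation (\<lambda>\<omega>. D i \<omega> * D j \<omega>) = 0" if "i < j"
    unfolding eq using c.increment_orthogonal[OF g bl D_past[OF that] D_bound] by simp
  have "sqmean M (D j) \<le> (\<integral>\<^sup>+\<omega>. ennreal (lip0\<^sup>2) * kernel_diff K (Z j \<omega>) (X j \<omega>) \<partial>M)"
    unfolding sqmean_def kernel_diff_def eq
    using c.increment_sq_le[OF g bl less_imp_le[OF lip0]] .
  also have "\<dots> = ennreal (lip0\<^sup>2) * (\<integral>\<^sup>+\<omega>. kernel_diff K (Z j \<omega>) (X j \<omega>) \<partial>M)"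
    unfolding kernel_diff_def by (rule nn_integral_cmult[OF c.measurable_kernel_diff])
  also have "\<dots> \<le> ennreal (lip0\<^sup>2) * ennreal S2" using S2(2) by (rule mult_left_mono) simp
  also have "\<dots> = ennreal (lip0\<^sup>2 * S2)" using S2(1) by (simp flip: ennreal_mult)
  finally show "sqmean M (D j) \<le> ennreal (lip0\<^sup>2 * S2)" .
qed

lemma sum_D_sq: "sqmean M (\<lambda>\<omega>. \<Sum>i\<in>{1..<n}. D i \<omega>) \<le> ennreal (real n * (lip0\<^sup>2 * S2))"
proof -
  \<comment> \<open>This bound depends on \<open>m\<close> and \<open>B\<close> and serves only to
    make the products integrable.\<close>
  let ?b = "2 * (real (m * k0) * B)"
  have int: "integrable M (\<lambda>\<omega>. D i \<omega> * D j \<omega>)" for i j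
  proof (rule integrable_const_bound)
    have "\<bar>D i \<omega> * D j \<omega>\<bar> \<le> ?b * ?b" if "\<omega> \<in> space M" for \<omega>
      unfolding abs_mult using D_bound[OF that, of i] D_bound[OF that, of j]
      by (intro mult_mono order_trans[OF abs_ge_zero D_bound[OF that, of i]]) auto
    then show "AE \<omega> in M. norm (D i \<omega> * D j \<omega>) \<le> ?b * ?b" by (intro AE_I2) simp
  qed measurable
  have orth: "expectation (\<lambda>\<omega>. D i \<omega> * D j \<omega>) = 0" if "i \<noteq> j" for i j
  proof (cases "i < j")
    case False
    then have "expectation (\<lambda>\<omega>. D j \<omega> * D i \<omega>) = 0" using that by (intro D_orthogonal) simp
    then show ?thesis by (simp add: mult.commute)
  qed (rule D_orthogonal)
  have sq: "sqmean M f = ennreal (expectation (\<lambda>\<omega>. (f \<omega>)\<^sup>2))" if "integrable M (\<lambda>\<omega>. (f \<omega>)\<^sup>2)" for f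
    unfolding sqmean_def using that by (intro nn_integral_eq_integral) auto
  have ei: "expectation (\<lambda>\<omega>. (D i \<omega>)\<^sup>2) \<le> lip0\<^sup>2 * S2" for i
    using D_sq[of i] sq[of "D i"] int[of i i] S2(1) by (simp add: power2_eq_square)
  have "expectation (\<lambda>\<omega>. (\<Sum>i\<in>{1..<n}. D i \<omega>)\<^sup>2) = (\<Sum>i\<in>{1..<n}. expectation (\<lambda>\<omega>. (D i \<omega>)\<^sup>2))"
    by (rule integral_sum_sq_orthogonal(1)[OF int orth]) auto
  also have "\<dots> \<le> (\<Sum>i\<in>{1..<n}. lip0\<^sup>2 * S2)" by (intro sum_mono ei)
  also have "\<dots> \<le> real n * (lip0\<^sup>2 * S2)" using S2(1) by (simp add: mult_right_mono)
  finally have "expectation (\<lambda>\<omega>. (\<Sum>i\<in>{1..<n}. D i \<omega>)\<^sup>2) \<le> real n * (lip0\<^sup>2 * S2)" .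
  moreover have "integrable M (\<lambda>\<omega>. (\<Sum>i\<in>{1..<n}. D i \<omega>)\<^sup>2)"
    by (rule integral_sum_sq_orthogonal(2)[OF int orth]) auto
  ultimately show ?thesis using sq by (simp add: ennreal_leI)
qed

lemma ecc_deviation_sq:
  assumes f: "\<And>\<omega>. \<omega> \<in> space M \<Longrightarrow> ennreal \<bar>f \<omega>\<bar> \<le> ennreal c * ecc (target E ybar \<nu>) (Z i \<omega>) (X j \<omega>)"
    and c: "0 \<le> c" and i: "1 \<le> i"
  shows "sqmean M f \<le> ennreal (c\<^sup>2 * S1)"
proof -
  let ?e = "\<lambda>\<omega>. ecc (target E ybar \<nu>) (Z i \<omega>) (X j \<omega>)"
  have [measurable]: "?e \<in> borel_measurable M"
    by (rule measurable_ecc[OF prob_M Z_joint[OF i] Z_adm X])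
  have "sqmean M f \<le> (\<integral>\<^sup>+\<omega>. ennreal (c\<^sup>2) * (?e \<omega>)\<^sup>2 \<partial>M)"
    unfolding sqmean_def by (intro nn_integral_mono ennreal_le_mult_sq f c)
  also have "\<dots> = ennreal (c\<^sup>2) * (\<integral>\<^sup>+\<omega>. (?e \<omega>)\<^sup>2 \<partial>M)" by (rule nn_integral_cmult) measurable
  also have "\<dots> \<le> ennreal (c\<^sup>2) * ennreal S1" using S1(2) by (rule mult_left_mono) simp
  also have "\<dots> = ennreal (c\<^sup>2 * S1)" using S1(1) by (simp flip: ennreal_mult)
  finally show ?thesis .
qed

text \<open>By stationarity \<open>res\<close> has the same target mean as \<open>h\<close>, and its
  Lipschitz constant is at most \<open>1 / n\<close>. Each term thus has mean square at most
  \<open>S1 / n\<^sup>2\<close>, and summing fewer than \<open>n\<close> of them costs at most a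
  factor \<open>n\<^sup>2\<close>.\<close>

lemma sum_Rm_sq: "sqmean M (\<lambda>\<omega>. \<Sum>i\<in>{1..<n}. Rm i \<omega>) \<le> ennreal S1"
proof -
  have "sqmean M (Rm i) \<le> ennreal ((1 / real n)\<^sup>2 * S1)" if "1 \<le> i" for i
  proof (rule ecc_deviation_sq[OF _ _ that])
    fix \<omega> assume \<omega>: "\<omega> \<in> space M"
    show "ennreal \<bar>Rm i \<omega>\<bar> \<le> ennreal (1 / real n) * ecc (target E ybar \<nu>) (Z i \<omega>) (X (Suc i) \<omega>)"
      using stationary_mean_deviation[OF res_blip[OF Z_in[OF \<omega>, of i]] _
          prob_target[OF Z_adm[OF \<omega>, of i]] sets_target[OF Z_adm[OF \<omega>, of i]], where x="X (Suc i) \<omega>"]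
      by (simp add: Rm_def ecc_def res_mean[OF Z_in[OF \<omega>]])
  qed simp
  then have "sqmean M (\<lambda>\<omega>. \<Sum>i\<in>{1..<n}. Rm i \<omega>) \<le> ennreal ((real (card {1..<n}))\<^sup>2 * ((1 / real n)\<^sup>2 * S1))"
    using S1(1) Rm_measurable by (intro sqmean_sum_const) auto
  also have "\<dots> \<le> ennreal S1"
  proof (rule ennreal_leI)
    have "(real (card {1..<n}) * (1 / real n))\<^sup>2 \<le> 1\<^sup>2"
      using n by (intro power_mono) (auto simp: field_simps)
    then have "(real (card {1..<n}) * (1 / real n))\<^sup>2 * S1 \<le> 1 * S1"
      using S1(1) by (intro mult_right_mono) auto
    then show "(real (card {1..<n}))\<^sup>2 * ((1 / real n)\<^sup>2 * S1) \<le> S1"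
      by (simp only: power_mult_distrib mult.assoc mult_1)
  qed
  finally show ?thesis .
qed

text \<open>\<open>X 1\<close> was produced with \<open>Z 0\<close>, which need not be a sample
  average; it is compared with the target of \<open>Z 1\<close> instead, as the moments in metric
  regularity are bounded over all pairs of indices.\<close>

lemma first_sq:
  "sqmean M (\<lambda>\<omega>. h (X 1 \<omega>) - (\<integral>x. h x \<partial>target E ybar \<nu> (Z 1 \<omega>))) \<le> ennreal S1"
proof -
  have "sqmean M (\<lambda>\<omega>. h (X 1 \<omega>) - (\<integral>x. h x \<partial>target E ybar \<nu> (Z 1 \<omega>))) \<le> ennreal (1\<^sup>2 * S1)"
  proof (rule ecc_deviation_sq)
    fix \<omega> assume \<omega>: "\<omega> \<in> space M"
    show "ennreal \<bar>h (X 1 \<omega>) - (\<integral>x. h x \<partial>target E ybar \<nu> (Z 1 \<omega>))\<bar> \<le>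
        ennreal 1 * ecc (target E ybar \<nu>) (Z 1 \<omega>) (X 1 \<omega>)"
      using stationary_mean_deviation[OF h _ prob_target[OF Z_adm[OF \<omega>]]
          sets_target[OF Z_adm[OF \<omega>]], where x="X 1 \<omega>"]
      unfolding ecc_def by simp
  qed auto
  then show ?thesis by simp
qed

text \<open>Summation by parts. Measured relative to its value at \<open>X 1\<close>, the function \<open>PU (Z i)\<close> only
  changes at the times in \<open>range tri\<close>, of which there are about \<open>sqrt (2 * n)\<close> up to \<open>n\<close>.\<close>

lemma sum_T_le:
  assumes \<omega>: "\<omega> \<in> space M" and k: "1 \<le> k"
  shows "\<bar>\<Sum>i\<in>{1..<k}. T i \<omega>\<bar> \<le> (lip0 * C) * dist (X k \<omega>) (X 1 \<omega>) +
    2 * (lip0 * C) * (\<Sum>i\<in>{i \<in> {1..<k}. i \<in> range tri}. dist (X i \<omega>) (X 1 \<omega>))"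
proof -
  \<comment> \<open>Subtracting the value at \<open>X 1\<close> turns the Lipschitz bound into a
    bound by a distance and so avoids the sup bound of \<open>PU\<close>, which grows with
    \<open>m\<close>.\<close>
  define c where "c i x = PU (Z i \<omega>) x - PU (Z i \<omega>) (X 1 \<omega>)" for i x
  have c: "\<bar>c i x\<bar> \<le> (lip0 * C) * dist x (X 1 \<omega>)" for i x
    unfolding c_def by (rule blipD(2)[OF PU_blip[OF Z_in[OF \<omega>]]])
  have T: "T i \<omega> = c i (X i \<omega>) - c i (X (Suc i) \<omega>)" for i by (simp add: T_def c_def)
  \<comment> \<open>The added term closes the telescoping sum: from \<open>k\<close> to
    \<open>Suc k\<close> the expression inside the absolute value changes only by
    \<open>c k - c (k - 1)\<close> at \<open>X k \<omega>\<close>, which vanishes unless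
    \<open>k\<close> is an update time.\<close>
  have "\<bar>(\<Sum>i\<in>{1..<k}. T i \<omega>) + c (k - 1) (X k \<omega>)\<bar> \<le>
      2 * (lip0 * C) * (\<Sum>i\<in>{i \<in> {1..<k}. i \<in> range tri}. dist (X i \<omega>) (X 1 \<omega>))"
    using k
  proof (induction k rule: dec_induct)
    case base
    then show ?case by (simp add: c_def)
  next
    case (step k)
    have eq: "(\<Sum>i\<in>{1..<Suc k}. T i \<omega>) + c k (X (Suc k) \<omega>) =
        ((\<Sum>i\<in>{1..<k}. T i \<omega>) + c (k - 1) (X k \<omega>)) + (c k (X k \<omega>) - c (k - 1) (X k \<omega>))"
      using step(1) by (simp add: T)
    show ?case
    proof (cases "k \<in> range tri")
      case True
      have "\<bar>c k (X k \<omega>) - c (k - 1) (X k \<omega>)\<bar> \<le> 2 * (lip0 * C) * dist (X k \<omega>) (X 1 \<omega>)"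
        using c[of k "X k \<omega>"] c[of "k - 1" "X k \<omega>"] by linarith
      moreover have "{i \<in> {1..<Suc k}. i \<in> range tri} = insert k {i \<in> {1..<k}. i \<in> range tri}"
        using True step(1) by auto
      ultimately show ?thesis
        using step(3) eq by (simp add: distrib_left)
    next
      case False
      then have "c k (X k \<omega>) - c (k - 1) (X k \<omega>) = 0"
        using Z_step[OF step(1) False \<omega>] by (simp add: c_def)
      moreover have "{i \<in> {1..<Suc k}. i \<in> range tri} = {i \<in> {1..<k}. i \<in> range tri}"
        using False by (auto simp: less_Suc_eq)
      ultimately show ?thesis using step(3) eq by simp
    qed
  qed
  then show ?thesis using c[of "k - 1" "X k \<omega>"] by linarith
qed

text \<open>\<open>72 = 8 + 64\<close>: the end point contributes \<open>2 * 4\<close>, and the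
  update times contribute \<open>2 * 4 * 4\<close> times their squared number, which is at most
  \<open>2 * n\<close>.\<close>

lemma sum_T_sq: "sqmean M (\<lambda>\<omega>. \<Sum>i\<in>{1..<n}. T i \<omega>) \<le> ennreal (72 * (lip0 * C)\<^sup>2 * S1 * real n)"
proof -
  let ?D = "lip0 * C"
  let ?J = "{i \<in> {1..<n}. i \<in> range tri}"
  have D0: "0 \<le> ?D" using lip0 C by simp
  have dm[measurable]: "(\<lambda>\<omega>. dist (X i \<omega>) (X j \<omega>)) \<in> borel_measurable M" for i j by measurable
  have "sqmean M (\<lambda>\<omega>. \<Sum>i\<in>{1..<n}. T i \<omega>) \<le> sqmean M (\<lambda>\<omega>. ?D * dist (X n \<omega>) (X 1 \<omega>) +
      2 * ?D * (\<Sum>i\<in>?J. dist (X i \<omega>) (X 1 \<omega>)))"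
    using sum_T_le[OF _ n] by (intro sqmean_mono) (rule order_trans[OF _ abs_ge_self])
  also have "\<dots> \<le> ennreal (2 * (?D\<^sup>2 * (4 * S1) + (2 * ?D)\<^sup>2 * ((real (card ?J))\<^sup>2 * (4 * S1))))"
  proof (rule sqmean_add)
    show "sqmean M (\<lambda>\<omega>. ?D * dist (X n \<omega>) (X 1 \<omega>)) \<le> ennreal (?D\<^sup>2 * (4 * S1))"
      using S1(1) by (intro sqmean_cmult_le dist_le dm) simp
    have "sqmean M (\<lambda>\<omega>. \<Sum>i\<in>?J. dist (X i \<omega>) (X 1 \<omega>)) \<le> ennreal ((real (card ?J))\<^sup>2 * (4 * S1))"
      using dist_le S1(1) by (intro sqmean_sum_const) auto
    then show "sqmean M (\<lambda>\<omega>. 2 * ?D * (\<Sum>i\<in>?J. dist (X i \<omega>) (X 1 \<omega>))) \<le>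
        ennreal ((2 * ?D)\<^sup>2 * ((real (card ?J))\<^sup>2 * (4 * S1)))"
      using S1(1) by (intro sqmean_cmult_le borel_measurable_sum dm) simp_all
  qed (use S1(1) in auto)
  also have "\<dots> \<le> ennreal (72 * ?D\<^sup>2 * S1 * real n)"
  proof (rule ennreal_leI)
    have "card ?J \<le> card {i \<in> {1..n}. i \<in> range tri}" by (intro card_mono) auto
    then have "(real (card ?J))\<^sup>2 \<le> (real (card {i \<in> {1..n}. i \<in> range tri}))\<^sup>2"
      by (intro power_mono) auto
    also have "\<dots> \<le> 2 * real n" by (rule card_tri_le)
    finally have "(32 * ?D\<^sup>2 * S1) * (real (card ?J))\<^sup>2 \<le> (32 * ?D\<^sup>2 * S1) * (2 * real n)"
      using S1(1) by (intro mult_left_mono) auto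
    moreover have "(8 * ?D\<^sup>2 * S1) * 1 \<le> (8 * ?D\<^sup>2 * S1) * real n"
      using S1(1) n by (intro mult_left_mono) auto
    ultimately show "2 * (?D\<^sup>2 * (4 * S1) + (2 * ?D)\<^sup>2 * ((real (card ?J))\<^sup>2 * (4 * S1))) \<le> 72 * ?D\<^sup>2 * S1 * real n"
      by (simp add: power_mult_distrib algebra_simps)
  qed
  finally show ?thesis .
qed

text \<open>\<open>max 1 (j - 1)\<close> is the parameter index belonging to \<open>X j\<close>,
  with \<open>Z 1\<close> standing in for \<open>Z 0\<close>. It is at least \<open>j / 2\<close>,
  which costs a factor \<open>2 powr \<beta> \<le> 2\<close> and turns 6 into 12.\<close>

lemma Q_sq:
  assumes j: "1 \<le> j"
  shows "sqmean M (Q (max 1 (j - 1))) \<le> ennreal (12 * R * real j powr - \<beta>)"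
proof -
  let ?i = "max 1 (j - 1)"
  have "sqmean M (Q ?i) \<le> ennreal (6 * R * real ?i powr - \<beta>)"
    unfolding Q_def[abs_def] by (rule bias_le[OF h]) simp
  also have "\<dots> \<le> ennreal (12 * R * real j powr - \<beta>)"
  proof (rule ennreal_leI)
    have "real ?i powr - \<beta> \<le> (real j / 2) powr - \<beta>"
      using \<beta> j by (intro powr_mono2') auto
    also have "\<dots> = 2 powr \<beta> * real j powr - \<beta>"
      by (simp add: powr_divide powr_minus field_simps)
    also have "\<dots> \<le> 2 powr 1 * real j powr - \<beta>"
      using \<beta> by (intro mult_right_mono powr_mono) auto
    finally have "6 * R * real ?i powr - \<beta> \<le> 6 * R * (2 * real j powr - \<beta>)"
      using R(1) by (intro mult_left_mono) auto
    then show "6 * R * real ?i powr - \<beta> \<le> 12 * R * real j powr - \<beta>" by simp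
  qed
  finally show ?thesis .
qed

text \<open>The weights \<open>1 / sqrt j\<close> sum to order \<open>sqrt n\<close>. By
  \<open>\<beta> \<le> 1\<close>, \<open>sqrt j * j powr - \<beta>\<close> is at most
  \<open>n powr (1 - \<beta>) / sqrt j\<close>, so the second sum is of order
  \<open>n powr (1 - \<beta>) * sqrt n\<close>. Equal weights would lead to \<open>n\<close> times
  the sum of \<open>j powr - \<beta>\<close>, hence to a logarithm at
  \<open>\<beta> = 1\<close>.\<close>

lemma sum_Q_sq: "sqmean M (\<lambda>\<omega>. \<Sum>j=1..n. Q (max 1 (j - 1)) \<omega>) \<le> ennreal (48 * R * real n powr (2 - \<beta>))"
proof -
  let ?w = "\<lambda>j. 1 / sqrt (real j)"
  have "sqmean M (\<lambda>\<omega>. \<Sum>j=1..n. Q (max 1 (j - 1)) \<omega>) \<le>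
      ennreal (\<Sum>j=1..n. ?w j) * (\<Sum>j=1..n. ennreal (1 / ?w j) * sqmean M (Q (max 1 (j - 1))))"
    unfolding sqmean_def by (rule nn_integral_sum_sq_weighted) (auto intro: Q_measurable)
  also have "\<dots> \<le> ennreal (2 * sqrt (real n)) * ennreal (12 * R * real n powr (1 - \<beta>) * (2 * sqrt (real n)))"
  proof (intro mult_mono)
    show "ennreal (\<Sum>j=1..n. ?w j) \<le> ennreal (2 * sqrt (real n))"
      by (rule ennreal_leI[OF sum_inverse_sqrt_le])
    have "(\<Sum>j=1..n. ennreal (1 / ?w j) * sqmean M (Q (max 1 (j - 1)))) \<le>
        (\<Sum>j=1..n. ennreal (12 * R * real n powr (1 - \<beta>) * ?w j))"
    proof (rule sum_mono)
      fix j assume j: "j \<in> {1..n}"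
      have "ennreal (1 / ?w j) * sqmean M (Q (max 1 (j - 1))) \<le>
          ennreal (sqrt (real j)) * ennreal (12 * R * real j powr - \<beta>)"
        using Q_sq[of j] j by (intro mult_mono) auto
      also have "\<dots> = ennreal (12 * R * (sqrt (real j) * real j powr - \<beta>))"
        using R(1) by (simp add: mult_ac flip: ennreal_mult)
      also have "\<dots> \<le> ennreal (12 * R * real n powr (1 - \<beta>) * ?w j)"
      proof (rule ennreal_leI)
        have j0: "0 < real j" using j by simp
        have "sqrt (real j) = real j * ?w j" using j0 by (simp add: real_div_sqrt)
        moreover have "real j * real j powr - \<beta> = real j powr (1 - \<beta>)"
          using j0 powr_add[of "real j" 1 "- \<beta>"] by simp
        moreover have "real j * ?w j * real j powr - \<beta> = (real j * real j powr - \<beta>) * ?w j"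
          by (simp only: mult_ac)
        ultimately have "sqrt (real j) * real j powr - \<beta> = real j powr (1 - \<beta>) * ?w j"
          by metis
        also have "\<dots> \<le> real n powr (1 - \<beta>) * ?w j"
          using j \<beta> by (intro mult_right_mono powr_mono2) auto
        finally have "12 * R * (sqrt (real j) * real j powr - \<beta>) \<le> 12 * R * (real n powr (1 - \<beta>) * ?w j)"
          using R(1) by (intro mult_left_mono) auto
        then show "12 * R * (sqrt (real j) * real j powr - \<beta>) \<le> 12 * R * real n powr (1 - \<beta>) * ?w j"
          by (simp only: mult.assoc)
      qed
      finally show "ennreal (1 / ?w j) * sqmean M (Q (max 1 (j - 1))) \<le>
          ennreal (12 * R * real n powr (1 - \<beta>) * ?w j)" .
    qed
    also have "\<dots> = ennreal (12 * R * real n powr (1 - \<beta>) * (\<Sum>j=1..n. ?w j))"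
      using R(1) unfolding sum_distrib_left by (intro sum_ennreal) auto
    also have "\<dots> \<le> ennreal (12 * R * real n powr (1 - \<beta>) * (2 * sqrt (real n)))"
      using R(1) by (intro ennreal_leI mult_left_mono sum_inverse_sqrt_le) auto
    finally show "(\<Sum>j=1..n. ennreal (1 / ?w j) * sqmean M (Q (max 1 (j - 1)))) \<le>
        ennreal (12 * R * real n powr (1 - \<beta>) * (2 * sqrt (real n)))" .
  qed auto
  also have "\<dots> = ennreal (48 * R * real n powr (2 - \<beta>))"
  proof -
    have "2 * sqrt (real n) * (12 * R * real n powr (1 - \<beta>) * (2 * sqrt (real n))) =
        48 * R * (real n powr (1 - \<beta>) * (sqrt (real n) * sqrt (real n)))" by (simp add: mult_ac)
    also have "real n powr (1 - \<beta>) * (sqrt (real n) * sqrt (real n)) = real n powr (2 - \<beta>)"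
      using n powr_add[of "real n" "1 - \<beta>" 1] by simp
    finally show ?thesis using R(1) by (simp flip: ennreal_mult)
  qed
  finally show ?thesis .
qed

lemma sum_error_sq:
  "sqmean M (\<lambda>\<omega>. \<Sum>j=1..n. h (X j \<omega>) - (\<integral>x. h x \<partial>target E ybar \<nu> zs)) \<le>
    ennreal ((80 * S1 + 16 * lip0\<^sup>2 * S2 + 576 * (lip0 * C)\<^sup>2 * S1 + 96 * R) * real n powr (2 - \<beta>))"
proof -
  let ?F = "\<lambda>\<omega>. h (X 1 \<omega>) - (\<integral>x. h x \<partial>target E ybar \<nu> (Z 1 \<omega>))"
  let ?\<Sigma> = "\<lambda>G \<omega>. \<Sum>i\<in>{1..<n}. G i \<omega>"
  let ?Q = "\<lambda>\<omega>. \<Sum>j=1..n. Q (max 1 (j - 1)) \<omega>"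
  note [measurable] = blip_measurable[OF h]
  have F[measurable]: "?F \<in> borel_measurable M"
    using measurable_target_integral[OF prob_M Z_joint Z_adm blip_measurable[OF h], of 1] by simp
  have Rm[measurable]: "?\<Sigma> Rm \<in> borel_measurable M" using Rm_measurable by (intro borel_measurable_sum) auto
  have Q[measurable]: "?Q \<in> borel_measurable M" using Q_measurable by (intro borel_measurable_sum) auto
  have split: "(\<Sum>j=1..n. a j) = a 1 + (\<Sum>i\<in>{1..<n}. a (Suc i))" for a :: "nat \<Rightarrow> real"
  proof -
    have "(\<Sum>j=1..n. a j) = a 1 + sum a {Suc 1..<Suc n}"
      by (simp only: sum.atLeast_Suc_atMost[OF n] atLeastLessThanSuc_atLeastAtMost)
    then show ?thesis by (simp only: sum.shift_bounds_Suc_ivl)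
  qed
  have "sqmean M (\<lambda>\<omega>. \<Sum>j=1..n. h (X j \<omega>) - (\<integral>x. h x \<partial>target E ybar \<nu> zs)) =
      sqmean M (\<lambda>\<omega>. ((?F \<omega> + ?\<Sigma> Rm \<omega>) + (?\<Sigma> D \<omega> + ?\<Sigma> T \<omega>)) + ?Q \<omega>)"
  proof (rule sqmean_cong)
    fix \<omega> assume \<omega>: "\<omega> \<in> space M"
    have "?Q \<omega> = Q 1 \<omega> + (\<Sum>i\<in>{1..<n}. Q i \<omega>)" unfolding split by (auto intro!: sum.cong)
    moreover have "(\<Sum>j=1..n. h (X j \<omega>) - (\<integral>x. h x \<partial>target E ybar \<nu> zs)) =
        (?F \<omega> + Q 1 \<omega>) + (\<Sum>i\<in>{1..<n}. D i \<omega> + T i \<omega> + Rm i \<omega> + Q i \<omega>)"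
      unfolding split decomposition[OF \<omega>, symmetric] by (simp add: Q_def)
    ultimately show "(\<Sum>j=1..n. h (X j \<omega>) - (\<integral>x. h x \<partial>target E ybar \<nu> zs)) =
        ((?F \<omega> + ?\<Sigma> Rm \<omega>) + (?\<Sigma> D \<omega> + ?\<Sigma> T \<omega>)) + ?Q \<omega>"
      by (simp add: sum.distrib)
  qed
  \<comment> \<open>Nested uses of \<open>sqmean_add\<close> put a factor 8 on the four terms in the
    inner sums and a factor 2 on the bias. The coefficients 80 and 16 in the claim leave room above
    the 16 and 8 obtained here.\<close>
  also have "\<dots> \<le> ennreal (2 * (2 * (2 * (S1 + S1) +
      2 * (real n * (lip0\<^sup>2 * S2) + 72 * (lip0 * C)\<^sup>2 * S1 * real n)) + 48 * R * real n powr (2 - \<beta>)))"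
    using S1(1) S2(1) R(1)
    by (intro sqmean_add first_sq sum_Rm_sq sum_D_sq sum_T_sq sum_Q_sq Rm Q F
        borel_measurable_add borel_measurable_sum D_measurable T_measurable
        add_nonneg_nonneg mult_nonneg_nonneg) auto
  also have "\<dots> \<le> ennreal ((80 * S1 + 16 * lip0\<^sup>2 * S2 + 576 * (lip0 * C)\<^sup>2 * S1 + 96 * R) * real n powr (2 - \<beta>))"
  proof (rule ennreal_leI)
    define t where "t = real n powr (2 - \<beta>)"
    \<comment> \<open>Capping \<beta> at 1 pays off here: every term of order \<open>n\<close> is
      absorbed into the order of the bias.\<close>
    have "real n powr 1 \<le> t" unfolding t_def using n \<beta> by (intro powr_mono) auto
    then have t: "real n \<le> t" "1 \<le> t" using n by auto
    have "16 * S1 * 1 \<le> 16 * S1 * t" using S1(1) t by (intro mult_left_mono) auto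
    moreover have "S1 * t \<ge> 0" using S1(1) t by simp
    moreover have "(8 * lip0\<^sup>2 * S2) * real n \<le> (8 * lip0\<^sup>2 * S2) * t"
      using S2(1) t by (intro mult_left_mono) auto
    moreover have "0 \<le> lip0\<^sup>2 * S2 * t" using S2(1) t by simp
    moreover have "(576 * (lip0 * C)\<^sup>2 * S1) * real n \<le> (576 * (lip0 * C)\<^sup>2 * S1) * t"
      using S1(1) t by (intro mult_left_mono) auto
    ultimately show "2 * (2 * (2 * (S1 + S1) +
        2 * (real n * (lip0\<^sup>2 * S2) + 72 * (lip0 * C)\<^sup>2 * S1 * real n)) + 48 * R * real n powr (2 - \<beta>)) \<le>
        (80 * S1 + 16 * lip0\<^sup>2 * S2 + 576 * (lip0 * C)\<^sup>2 * S1 + 96 * R) * real n powr (2 - \<beta>)"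
      unfolding t_def[symmetric] by (simp add: algebra_simps)
  qed
  finally show ?thesis .
qed

end

end

section \<open>The rate of convergence\<close>

lemma lip_seminorm_le_1D:
  assumes "lip_seminorm h \<le> 1" shows "\<bar>h x - h y\<bar> \<le> dist x y"
proof (cases "x = y")
  case False
  then have "ennreal (\<bar>h x - h y\<bar> / dist x y) \<le> lip_seminorm h"
    unfolding lip_seminorm_def by (intro SUP_upper2[of "(x, y)"]) auto
  then have "ennreal (\<bar>h x - h y\<bar> / dist x y) \<le> 1" using assms by (rule order_trans)
  then have "\<bar>h x - h y\<bar> / dist x y \<le> 1" by (simp only: ennreal_le_1)
  then show ?thesis using False by (simp add: divide_le_eq_1)
qed simp

context air
begin

definition rate_const :: real where
  "rate_const = 80 * S1 + 16 * lip0\<^sup>2 * S2 + 576 * (lip0 * C)\<^sup>2 * S1 + 96 * R"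

lemma rate_const: "0 \<le> rate_const"
  using S1(1) S2(1) R(1) by (simp add: rate_const_def)

lemma error_sq_bounded:
  assumes h: "blip B 1 h" and n: "1 \<le> n"
  shows "(\<integral>\<^sup>+\<omega>. ennreal (\<bar>pi_hat X n h \<omega> - (\<integral>x. h x \<partial>target E ybar \<nu> zs)\<bar>\<^sup>2) \<partial>M) \<le>
    ennreal (rate_const * real n powr - \<beta>)"
proof -
  have "0 < 1 / (real n * C ^ k0)" using n C by simp
  \<comment> \<open>\<open>m\<close> may depend on \<open>n\<close>, since \<open>rate_const\<close>
    contains neither \<open>m\<close> nor \<open>B\<close>.\<close>
  then obtain m where "\<tau> ^ m < 1 / (real n * C ^ k0)" using real_arch_pow_inv \<tau>(2) by blast
  then have m: "\<tau> ^ m * C ^ k0 \<le> 1 / real n" using n C by (simp add: field_simps)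
  note [measurable] = blip_measurable[OF h]
  have "(\<integral>\<^sup>+\<omega>. ennreal (\<bar>pi_hat X n h \<omega> - (\<integral>x. h x \<partial>target E ybar \<nu> zs)\<bar>\<^sup>2) \<partial>M) =
      sqmean M (\<lambda>\<omega>. (1 / real n) * (\<Sum>j=1..n. h (X j \<omega>) - (\<integral>x. h x \<partial>target E ybar \<nu> zs)))"
    unfolding sqmean_def pi_hat_def using n
    by (intro nn_integral_cong) (simp add: sum_subtractf right_diff_distrib)
  also have "\<dots> \<le> ennreal ((1 / real n)\<^sup>2 * (rate_const * real n powr (2 - \<beta>)))"
    unfolding rate_const_def
  proof (rule sqmean_cmult_le[OF _ sum_error_sq[OF h n m]])
    show "(\<lambda>\<omega>. \<Sum>j=1..n. h (X j \<omega>) - (\<integral>x. h x \<partial>target E ybar \<nu> zs)) \<in> borel_measurable M"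
      by measurable
  qed (use rate_const in \<open>simp add: rate_const_def\<close>)
  also have "(1 / real n)\<^sup>2 * (rate_const * real n powr (2 - \<beta>)) = rate_const * real n powr - \<beta>"
  proof -
    have "real n powr (2 - \<beta>) = (real n)\<^sup>2 * real n powr - \<beta>"
      using n powr_add[of "real n" 2 "- \<beta>"] by simp
    then show ?thesis using n by (simp add: power_divide)
  qed
  finally show ?thesis .
qed

text \<open>Clipping keeps the function 1-Lipschitz, and \<open>rate_const\<close> does not depend
  on the level. At each sample point the empirical mean of the clipped function is eventually that
  of \<open>h\<close>, while its target mean converges by dominated convergence.\<close>

lemma error_sq:
  assumes lip: "\<And>x y. \<bar>h x - h y\<bar> \<le> dist x y"
    and int: "integrable (target E ybar \<nu> zs) h" and n: "1 \<le> n"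
  shows "(\<integral>\<^sup>+\<omega>. ennreal (\<bar>pi_hat X n h \<omega> - (\<integral>x. h x \<partial>target E ybar \<nu> zs)\<bar>\<^sup>2) \<partial>M) \<le>
    ennreal (rate_const * real n powr - \<beta>)"
proof -
  define g where "g k x = max (- real k) (min (real k) (h x))" for k x
  have blip: "blip (real k) 1 (g k)" for k
    unfolding blip_def
  proof (intro conjI allI)
    fix x y
    show "\<bar>g k x\<bar> \<le> real k" by (auto simp: g_def)
    have "\<bar>g k x - g k y\<bar> \<le> \<bar>h x - h y\<bar>" by (auto simp: g_def)
    then show "\<bar>g k x - g k y\<bar> \<le> 1 * dist x y" using lip[of x y] by simp
  qed
  note [measurable] = blip_measurable[OF blip]
  have conv: "(\<lambda>k. g k x) \<longlonglongrightarrow> h x" for x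
  proof (rule tendsto_eventually)
    obtain k0 where "\<bar>h x\<bar> \<le> real k0" using real_arch_simple by blast
    then have "g k x = h x" if "k0 \<le> k" for k using that by (auto simp: g_def)
    then show "\<forall>\<^sub>F k in sequentially. g k x = h x" unfolding eventually_sequentially by blast
  qed
  have conv_int: "(\<lambda>k. \<integral>x. g k x \<partial>target E ybar \<nu> zs) \<longlonglongrightarrow> (\<integral>x. h x \<partial>target E ybar \<nu> zs)"
  proof (rule integral_dominated_convergence)
    show "integrable (target E ybar \<nu> zs) (\<lambda>x. \<bar>h x\<bar>)" using int by simp
    show "h \<in> borel_measurable (target E ybar \<nu> zs)" using int by simp
    show "g k \<in> borel_measurable (target E ybar \<nu> zs)" for k
      using blip_measurable[OF blip] sets_zs by (simp cong: measurable_cong_sets)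
    show "AE x in target E ybar \<nu> zs. norm (g k x) \<le> \<bar>h x\<bar>" for k by (auto simp: g_def)
  qed (simp add: conv)
  let ?e = "\<lambda>h \<omega>. ennreal (\<bar>pi_hat X n h \<omega> - (\<integral>x. h x \<partial>target E ybar \<nu> zs)\<bar>\<^sup>2)"
  have lim: "(\<lambda>k. ?e (g k) \<omega>) \<longlonglongrightarrow> ?e h \<omega>" for \<omega>
    unfolding pi_hat_def by (intro tendsto_intros conv conv_int tendsto_ennrealI)
  have "(\<integral>\<^sup>+\<omega>. ?e h \<omega> \<partial>M) = (\<integral>\<^sup>+\<omega>. liminf (\<lambda>k. ?e (g k) \<omega>) \<partial>M)"
    by (intro nn_integral_cong lim_imp_Liminf[OF trivial_limit_sequentially lim, symmetric])
  also have "\<dots> \<le> liminf (\<lambda>k. \<integral>\<^sup>+\<omega>. ?e (g k) \<omega> \<partial>M)"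
    unfolding pi_hat_def by (rule nn_integral_liminf) measurable
  also have "\<dots> \<le> liminf (\<lambda>k. ennreal (rate_const * real n powr - \<beta>))"
    by (intro Liminf_mono always_eventually allI error_sq_bounded[OF blip n])
  also have "\<dots> = ennreal (rate_const * real n powr - \<beta>)" by (simp add: Liminf_const)
  finally show ?thesis .
qed

lemma mse_sup_le:
  assumes "1 \<le> n"
  shows "mse_sup (Zset E P) (target E ybar \<nu>) zs M X n \<le> ennreal (rate_const * real n powr - \<beta>)"
  unfolding mse_sup_def
proof (rule SUP_least)
  fix h :: "'x \<Rightarrow> real"
  assume "h \<in> {h. lip_seminorm h \<le> 1 \<and> (\<forall>z\<in>Zset E P \<union> {zs}. integrable (target E ybar \<nu> z) h)}"
  then show "(\<integral>\<^sup>+\<omega>. ennreal (\<bar>pi_hat X n h \<omega> - (\<integral>x. h x \<partial>target E ybar \<nu> zs)\<bar>\<^sup>2) \<partial>M) \<le>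
      ennreal (rate_const * real n powr - \<beta>)"
    using lip_seminorm_le_1D assms by (intro error_sq) auto
qed

end

lemma dominatedI: "(\<And>r. r \<in> I \<Longrightarrow> a r \<le> ennreal c * b r) \<Longrightarrow> dominated I a b"
  unfolding dominated_def by blast

text \<open>For \<open>\<epsilon> \<le> \<epsilon>0\<close> the logarithm is at least
  \<open>L = ln (1 / \<epsilon>0) > 0\<close>, so inserting its square costs at most a factor
  \<open>1 / L\<^sup>2\<close>. This factor is unbounded as \<open>\<epsilon>0\<close> tends to
  1.\<close>

lemma dominated_powr_imp_dominated_log:
  assumes f: "dominated {0<..<1} f (\<lambda>\<epsilon>. ennreal (\<epsilon> powr - 2))" and \<epsilon>0: "0 < \<epsilon>0" "\<epsilon>0 < 1"
  shows "dominated {0<..\<epsilon>0} f (\<lambda>\<epsilon>. ennreal ((ln (1 / \<epsilon>) / \<epsilon>)\<^sup>2))"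
proof -
  obtain c where c: "\<forall>\<epsilon>\<in>{0<..<1}. f \<epsilon> \<le> ennreal c * ennreal (\<epsilon> powr - 2)"
    using f unfolding dominated_def by blast
  define L where "L = ln (1 / \<epsilon>0)"
  have L: "0 < L" unfolding L_def using \<epsilon>0 by (intro ln_gt_zero) simp
  show ?thesis
  proof (rule dominatedI)
    fix \<epsilon> assume "\<epsilon> \<in> {0<..\<epsilon>0}"
    then have \<epsilon>: "0 < \<epsilon>" "\<epsilon> \<le> \<epsilon>0" by auto
    have "L \<le> ln (1 / \<epsilon>)" unfolding L_def using \<epsilon> \<epsilon>0 by (intro ln_mono divide_left_mono) auto
    then have "L\<^sup>2 \<le> (ln (1 / \<epsilon>))\<^sup>2" using L by (intro power_mono) auto
    then have "\<bar>c\<bar> * 1 \<le> \<bar>c\<bar> * ((ln (1 / \<epsilon>))\<^sup>2 / L\<^sup>2)"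
      using L by (intro mult_left_mono) auto
    then have "\<bar>c\<bar> * \<epsilon> powr - 2 \<le> \<bar>c\<bar> * ((ln (1 / \<epsilon>))\<^sup>2 / L\<^sup>2) * \<epsilon> powr - 2"
      by (intro mult_right_mono) auto
    also have "\<dots> = \<bar>c\<bar> / L\<^sup>2 * (ln (1 / \<epsilon>) / \<epsilon>)\<^sup>2"
      using \<epsilon> by (simp add: powr_minus power_divide field_simps)
    finally have le: "\<bar>c\<bar> * \<epsilon> powr - 2 \<le> \<bar>c\<bar> / L\<^sup>2 * (ln (1 / \<epsilon>) / \<epsilon>)\<^sup>2" .
    have "f \<epsilon> \<le> ennreal c * ennreal (\<epsilon> powr - 2)" using c \<epsilon> \<epsilon>0 by simp
    also have "\<dots> \<le> ennreal \<bar>c\<bar> * ennreal (\<epsilon> powr - 2)" by (intro mult_right_mono ennreal_leI) auto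
    also have "\<dots> \<le> ennreal (\<bar>c\<bar> / L\<^sup>2) * ennreal ((ln (1 / \<epsilon>) / \<epsilon>)\<^sup>2)"
      using le L by (simp add: ennreal_leI flip: ennreal_mult)
    finally show "f \<epsilon> \<le> ennreal (\<bar>c\<bar> / L\<^sup>2) * ennreal ((ln (1 / \<epsilon>) / \<epsilon>)\<^sup>2)" .
  qed
qed

theorem corollary4p5:
  fixes \<mu> :: "'d measure" and ybar :: 'd
    and \<nu> :: "'x::{metric_space, second_countable_topology} measure"
    and E :: "'d \<Rightarrow> 'x \<Rightarrow> real" and P :: "'d measure set"
    and ZM :: "('x \<Rightarrow> real) measure" and K :: "('x \<Rightarrow> real) \<times> 'x \<Rightarrow> 'x measure"
    and l u :: "'x \<Rightarrow> real" and \<alpha> c1 c2 c3 :: real and N :: "nat \<Rightarrow> nat"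
    and M :: "'w measure" and X :: "nat \<Rightarrow> 'w \<Rightarrow> 'x"
    and Z :: "nat \<Rightarrow> 'w \<Rightarrow> 'x \<Rightarrow> real" and Y :: "nat \<Rightarrow> 'w \<Rightarrow> 'd"
  assumes setting: "doubly_intractable \<mu> ybar \<nu> E P"
    and ZM: "space ZM = Zset E P"
    and K: "K \<in> ZM \<Otimes>\<^sub>M borel \<rightarrow>\<^sub>M prob_algebra borel"
    and contractive:
      "simultaneous_wasserstein_contractive (Zset E P) (target E ybar \<nu>) K"
    and bounds_pos: "\<And>x. 0 < l x" "\<And>x. 0 < u x"
    and bounds: "\<And>y x. y \<in> space \<mu> \<Longrightarrow> l x \<le> exp (- E y x) \<and> exp (- E y x) \<le> u x"
    and R_finite: "Rbound \<mu> E ybar \<nu> l u < \<infinity>"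
    and alpha: "0 \<le> \<alpha>"
    and N: "N 0 = 0" "\<And>j. 1 \<le> j \<Longrightarrow> N (tri j) = nat \<lceil>real j powr (1 + \<alpha>)\<rceil>"
    and process: "air_process \<mu> E ZM K N M X Z Y"
    and regular: "metric_regular (target E ybar \<nu>) K M X Z"
    and costs_pos: "0 < c1" "0 < c2" "0 < c3"
    and cost_order: "same_order {1..} (\<lambda>n. ennreal (cost c1 c2 c3 N n))
                       (\<lambda>n. ennreal (real n powr ((3 + \<alpha>) / 2)))"
  shows "(\<alpha> < 1 \<longrightarrow>
           dominated {0<..<1}
             (cost_eps c1 c2 c3 N (Zset E P) (target E ybar \<nu>) (zfun E \<mu>) M X)
             (\<lambda>\<epsilon>. ennreal (\<epsilon> powr (- ((3 + \<alpha>) / (1 + \<alpha>)))))) \<and>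
         (\<alpha> = 1 \<longrightarrow> (\<forall>\<epsilon>0\<in>{0<..<1}.
           dominated {0<..\<epsilon>0}
             (cost_eps c1 c2 c3 N (Zset E P) (target E ybar \<nu>) (zfun E \<mu>) M X)
             (\<lambda>\<epsilon>. ennreal ((ln (1 / \<epsilon>) / \<epsilon>)\<^sup>2)))) \<and>
         (1 < \<alpha> \<longrightarrow>
           dominated {0<..<1}
             (cost_eps c1 c2 c3 N (Zset E P) (target E ybar \<nu>) (zfun E \<mu>) M X)
             (\<lambda>\<epsilon>. ennreal (\<epsilon> powr (- ((3 + \<alpha>) / 2)))))"
proof -
  interpret doubly_intractable \<mu> ybar \<nu> E P by (rule setting)
  let ?\<pi> = "target E ybar \<nu>"
  obtain C' \<tau>' k0 where C': "0 < C'" and \<tau>': "0 \<le> \<tau>'" "\<tau>' < 1" and k0: "1 \<le> k0"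
    and con: "\<And>z. z \<in> Zset E P \<Longrightarrow> (?\<pi> z \<bind> (\<lambda>x. K (z, x))) = ?\<pi> z \<and>
         wasserstein_contraction (\<lambda>x. K (z, x)) \<le> ennreal C' \<and>
         wasserstein_contraction (kernel_power (\<lambda>x. K (z, x)) k0) \<le> ennreal \<tau>'"
    using contractive unfolding simultaneous_wasserstein_contractive_def by blast
  \<comment> \<open>The constants are enlarged to fit the normalization \<open>1 \<le> C\<close> and
    \<open>0 < \<tau>\<close>; the maximum of \<open>1 / 2\<close> and \<open>\<tau>'\<close> stays
    below 1.\<close>
  define C where "C = max 1 C'"
  define \<tau> where "\<tau> = max (1 / 2) \<tau>'"
  have C: "1 \<le> C" "ennreal C' \<le> ennreal C" by (auto simp: C_def intro!: ennreal_leI)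
  have \<tau>: "0 < \<tau>" "\<tau> < 1" "ennreal \<tau>' \<le> ennreal \<tau>" using \<tau>' by (auto simp: \<tau>_def intro!: ennreal_leI)
  \<comment> \<open>A finite infimum is finite at some point, and this point serves as the centre
    for all functions \<open>h\<close>.\<close>
  obtain x0 where x0: "(\<integral>\<^sup>+x. (ennreal ((dist x0 x)\<^sup>2) + R1 E ybar \<nu> l u x0) *
      ennreal ((u x)\<^sup>2 / (l x)\<^sup>2) \<partial>(?\<pi> (zfun E \<mu>))) < \<infinity>"
    using R_finite unfolding Rbound_def INF_less_iff by blast
  define R where "R = enn2real (\<integral>\<^sup>+x. (ennreal ((dist x0 x)\<^sup>2) + R1 E ybar \<nu> l u x0) *
      ennreal ((u x)\<^sup>2 / (l x)\<^sup>2) \<partial>(?\<pi> (zfun E \<mu>)))"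
  define S1 where "S1 = enn2real (SUP (j, k)\<in>UNIV. \<integral>\<^sup>+\<omega>. (ecc ?\<pi> (Z j \<omega>) (X k \<omega>))\<^sup>2 \<partial>M)"
  define S2 where "S2 = enn2real (SUP (j, k)\<in>UNIV. \<integral>\<^sup>+\<omega>. kernel_diff K (Z j \<omega>) (X k \<omega>) \<partial>M)"
  have S1: "(\<integral>\<^sup>+\<omega>. (ecc ?\<pi> (Z j \<omega>) (X k \<omega>))\<^sup>2 \<partial>M) \<le> ennreal S1" for j k
  proof -
    have "(\<integral>\<^sup>+\<omega>. (ecc ?\<pi> (Z j \<omega>) (X k \<omega>))\<^sup>2 \<partial>M) \<le> (SUP (j, k)\<in>UNIV. \<integral>\<^sup>+\<omega>. (ecc ?\<pi> (Z j \<omega>) (X k \<omega>))\<^sup>2 \<partial>M)"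
      by (rule SUP_upper2[of "(j, k)"]) auto
    also have "\<dots> = ennreal S1" unfolding S1_def using regular by (simp add: metric_regular_def)
    finally show ?thesis .
  qed
  have S2: "(\<integral>\<^sup>+\<omega>. kernel_diff K (Z j \<omega>) (X k \<omega>) \<partial>M) \<le> ennreal S2" for j k
  proof -
    have "(\<integral>\<^sup>+\<omega>. kernel_diff K (Z j \<omega>) (X k \<omega>) \<partial>M) \<le> (SUP (j, k)\<in>UNIV. \<integral>\<^sup>+\<omega>. kernel_diff K (Z j \<omega>) (X k \<omega>) \<partial>M)"
      by (rule SUP_upper2[of "(j, k)"]) auto
    also have "\<dots> = ennreal S2" unfolding S2_def using regular by (simp add: metric_regular_def)
    finally show ?thesis .
  qed
  interpret air \<mu> ybar \<nu> E P ZM K l u \<alpha> N M X Z Y C \<tau> S1 S2 R k0 x0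
  proof
    show "0 \<le> R" "0 \<le> S1" "0 \<le> S2" by (simp_all add: R_def S1_def S2_def)
    show "(\<integral>\<^sup>+x. (ennreal ((dist x0 x)\<^sup>2) + R1 E ybar \<nu> l u x0) *
      ennreal ((u x)\<^sup>2 / (l x)\<^sup>2) \<partial>(?\<pi> (zfun E \<mu>))) \<le> ennreal R"
      unfolding R_def using x0 by simp
    fix z assume "z \<in> Zset E P"
    from con[OF this] C(2) \<tau>(3)
    show "(?\<pi> z \<bind> (\<lambda>x. K (z, x))) = ?\<pi> z" "wasserstein_contraction (\<lambda>x. K (z, x)) \<le> ennreal C"
      "wasserstein_contraction (kernel_power (\<lambda>x. K (z, x)) k0) \<le> ennreal \<tau>"
      by (auto intro: order_trans)
  qed (fact ZM K C(1) \<tau>(1,2) k0 bounds_pos(1) bounds alpha N(2) process S1 S2)+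
  let ?ce = "cost_eps c1 c2 c3 N (Zset E P) ?\<pi> (zfun E \<mu>) M X"
  obtain c where c: "\<And>n. 1 \<le> n \<Longrightarrow>
      ennreal (cost c1 c2 c3 N n) \<le> ennreal c * ennreal (real n powr ((3 + \<alpha>) / 2))"
    using cost_order unfolding same_order_def dominated_def by auto
  \<comment> \<open>The maximum with 1 supplies the condition \<open>1 \<le> A\<close> of
    \<open>cost_eps_le\<close>.\<close>
  have mse: "mse_sup (Zset E P) ?\<pi> (zfun E \<mu>) M X n \<le> ennreal (max 1 rate_const * real n powr - \<beta>)"
    if "1 \<le> n" for n
    by (rule order_trans[OF mse_sup_le[OF that]]) (intro ennreal_leI mult_right_mono, auto)
  have ce: "?ce \<epsilon> \<le> ennreal (\<bar>c\<bar> * (2 * max 1 rate_const powr (1 / \<beta>)) powr ((3 + \<alpha>) / 2)) *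
      ennreal (\<epsilon> powr (- ((3 + \<alpha>) / 2 / \<beta>)))" if "\<epsilon> \<in> {0<..<1}" for \<epsilon>
    using mse c that \<beta> alpha by (intro cost_eps_le) auto
  \<comment> \<open>All three cases come from this bound: \<beta> is
    \<open>(1 + \<alpha>) / 2\<close> for \<open>\<alpha> \<le> 1\<close> and \<open>1\<close> for
    \<open>1 \<le> \<alpha>\<close>, and the exponent is that of the cost divided by
    \<beta>.\<close>
  have dom: "dominated {0<..<1} ?ce (\<lambda>\<epsilon>. ennreal (\<epsilon> powr (- ((3 + \<alpha>) / 2 / \<beta>))))"
    by (rule dominatedI[OF ce])
  show ?thesis
  proof (intro conjI impI ballI)
    assume "\<alpha> < 1"
    then have "(3 + \<alpha>) / 2 / \<beta> = (3 + \<alpha>) / (1 + \<alpha>)"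
      using alpha by (simp add: \<beta>_def field_simps)
    with dom show "dominated {0<..<1} ?ce (\<lambda>\<epsilon>. ennreal (\<epsilon> powr (- ((3 + \<alpha>) / (1 + \<alpha>)))))"
      by (simp only:)
  next
    fix \<epsilon>0 :: real assume "\<alpha> = 1" and \<epsilon>0: "\<epsilon>0 \<in> {0<..<1}"
    then have "(3 + \<alpha>) / 2 / \<beta> = 2" unfolding \<beta>_def by simp
    with dom have "dominated {0<..<1} ?ce (\<lambda>\<epsilon>. ennreal (\<epsilon> powr - 2))" by simp
    then show "dominated {0<..\<epsilon>0} ?ce (\<lambda>\<epsilon>. ennreal ((ln (1 / \<epsilon>) / \<epsilon>)\<^sup>2))"
      using \<epsilon>0 by (intro dominated_powr_imp_dominated_log) auto
  next
    assume "1 < \<alpha>"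
    then have "(3 + \<alpha>) / 2 / \<beta> = (3 + \<alpha>) / 2" unfolding \<beta>_def by simp
    with dom show "dominated {0<..<1} ?ce (\<lambda>\<epsilon>. ennreal (\<epsilon> powr (- ((3 + \<alpha>) / 2))))"
      by (simp only:)
  qed
qed

end
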